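(* If $p=2$, the Gross lattice of the unique (up to $\overline{\mathbb{F}}_2$-isomorphism) supersingular elliptic curve over $\overline{\mathbb{F}}_2$ is well-rounded but not orthogonal, and the Gram matrix of a normalized successive minimal basis of it is $$\begin{pmatrix} 3 & 1 & 1\\ 1 & 3 & -1\\ 1 & -1 & 3\end{pmatrix}.$$ If $p\ge 3$, the Gross lattice of every supersingular elliptic curve over $\overline{\mathbb{F}}_p$ is neither orthogonal nor well-rounded.
   Context: $B_p$ is the quaternion algebra over $\mathbb{Q}$ ramified exactly at $p$ and $\infty$, with standard involution $x\mapsto\overline{x}$, $\mathrm{trd}(x)=x+\overline{x}$, $\mathrm{nrd}(x)=x\overline{x}$, inner product $(x,y)=\frac12\mathrm{trd}(x\overline{y})$, $\|x\|^2=\mathrm{nrd}(x)$. For a supersingular elliptic curve $E$ over $\overline{\mathbb{F}}_p$, $\mathrm{End}(E)$ is isomorphic to a maximal order $\mathcal{O}$ of $B_p$, and its Gross lattice is $\mathcal{O}^T=\{2x-\mathrm{trd}(x):x\in\mathcal{O}\}$. Successive minima (non-standard convention): $D_i$ is the smallest value such that the $\mathbb{Z}$-span of $\{x\in\mathcal{O}^T:\|x\|^2\le D_i\}$ has rank at least $i$. A successive minimal basis is an ordered $\mathbb{Z}$-basis $\{\beta_1,\beta_2,\beta_3\}$ with $\|\beta_i\|^2=D_i$; it is normalized if $(\beta_1,\beta_2)\ge0$ and $(\beta_1,\beta_3)\ge0$; its Gram matrix is $((\beta_i,\beta_j))$. A lattice is orthogonal if it has a $\mathbb{Z}$-basis whose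 elements are pairwise orthogonal; a rank-$n$ lattice is well-rounded if it has $n$ linearly independent vectors of minimal nonzero norm, i.e. all its successive minima are equal. *)

theory Defs
  imports Complex_Main "HOL-Computational_Algebra.Primes"
begin

text \<open>Elements x0 + x1 i + x2 j + x3 k with i^2 = a, j^2 = b, k = ij = -ji.\<close>

datatype qel = QE (c0: rat) (c1: rat) (c2: rat) (c3: rat)

definition qzero :: qel where "qzero = QE 0 0 0 0"
definition qone :: qel where "qone = QE 1 0 0 0"
definition qscalar :: "rat \<Rightarrow> qel" where "qscalar r = QE r 0 0 0"
definition qadd :: "qel \<Rightarrow> qel \<Rightarrow> qel" where
  "qadd x y = QE (c0 x + c0 y) (c1 x + c1 y) (c2 x + c2 y) (c3 x + c3 y)"
definition qsmult :: "rat \<Rightarrow> qel \<Rightarrow> qel" where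
  "qsmult r x = QE (r * c0 x) (r * c1 x) (r * c2 x) (r * c3 x)"
definition qsub :: "qel \<Rightarrow> qel \<Rightarrow> qel" where
  "qsub x y = qadd x (qsmult (-1) y)"

definition qmul :: "int \<Rightarrow> int \<Rightarrow> qel \<Rightarrow> qel \<Rightarrow> qel" where
  "qmul a b x y = (let A = rat_of_int a; B = rat_of_int b in
     QE (c0 x * c0 y + A * c1 x * c1 y + B * c2 x * c2 y - A * B * c3 x * c3 y)
        (c0 x * c1 y + c1 x * c0 y - B * c2 x * c3 y + B * c3 x * c2 y)
        (c0 x * c2 y + c2 x * c0 y + A * c1 x * c3 y - A * c3 x * c1 y)
        (c0 x * c3 y + c3 x * c0 y + c1 x * c2 y - c2 x * c1 y))"

definition qconj :: "qel \<Rightarrow> qel" where "qconj x = QE (c0 x) (- c1 x) (- c2 x) (- c3 x)"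
definition qtrd :: "int \<Rightarrow> int \<Rightarrow> qel \<Rightarrow> rat" where
  "qtrd a b x = c0 (qadd x (qconj x))"
definition qnrd :: "int \<Rightarrow> int \<Rightarrow> qel \<Rightarrow> rat" where
  "qnrd a b x = c0 (qmul a b x (qconj x))"
definition qinner :: "int \<Rightarrow> int \<Rightarrow> qel \<Rightarrow> qel \<Rightarrow> rat" where
  "qinner a b x y = qtrd a b (qmul a b x (qconj y)) / 2"

definition hilbert_trivial_inf :: "int \<Rightarrow> int \<Rightarrow> bool" where
  "hilbert_trivial_inf a b \<longleftrightarrow>
     (\<exists>x y z :: real. (x, y, z) \<noteq> (0, 0, 0) \<and> of_int a * x^2 + of_int b * y^2 = z^2)"

text \<open>(a,b)_l = 1 iff a x^2 + b y^2 = z^2 has a nontrivial solution in Q_l; equivalently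
  (compactness of primitive vectors in Z_l^3) it has primitive integer solutions modulo l^k
  for every k.\<close>
definition hilbert_trivial_at :: "nat \<Rightarrow> int \<Rightarrow> int \<Rightarrow> bool" where
  "hilbert_trivial_at l a b \<longleftrightarrow>
     (\<forall>k::nat. \<exists>x y z :: int. \<not> (int l dvd x \<and> int l dvd y \<and> int l dvd z) \<and>
        (int l) ^ k dvd (a * x^2 + b * y^2 - z^2))"

text \<open>(a,b)_Q is ramified exactly at p and infinity, i.e. it is (a model of) B_p.\<close>
definition is_Bp :: "nat \<Rightarrow> int \<Rightarrow> int \<Rightarrow> bool" where
  "is_Bp p a b \<longleftrightarrow> a \<noteq> 0 \<and> b \<noteq> 0 \<and> \<not> hilbert_trivial_inf a b \<and> \<not> hilbert_trivial_at p a b \<and>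
     (\<forall>l. prime l \<and> l \<noteq> p \<longrightarrow> hilbert_trivial_at l a b)"

definition lincomb :: "(nat \<Rightarrow> rat) \<Rightarrow> qel list \<Rightarrow> qel" where
  "lincomb c vs = QE (\<Sum>i<length vs. c i * c0 (vs ! i)) (\<Sum>i<length vs. c i * c1 (vs ! i))
                     (\<Sum>i<length vs. c i * c2 (vs ! i)) (\<Sum>i<length vs. c i * c3 (vs ! i))"

definition lin_indep :: "qel list \<Rightarrow> bool" where
  "lin_indep vs \<longleftrightarrow> (\<forall>c. lincomb c vs = qzero \<longrightarrow> (\<forall>i<length vs. c i = 0))"

definition zspan :: "qel list \<Rightarrow> qel set" where
  "zspan vs = {lincomb c vs | c. \<forall>i<length vs. c i \<in> \<int>}"

definition is_Zbasis :: "qel set \<Rightarrow> qel list \<Rightarrow> bool" where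
  "is_Zbasis L vs \<longleftrightarrow> lin_indep vs \<and> L = zspan vs"

definition is_order :: "int \<Rightarrow> int \<Rightarrow> qel set \<Rightarrow> bool" where
  "is_order a b R \<longleftrightarrow> (\<exists>vs. length vs = 4 \<and> is_Zbasis R vs) \<and> qone \<in> R \<and>
     (\<forall>x\<in>R. \<forall>y\<in>R. qmul a b x y \<in> R)"

definition maximal_order :: "int \<Rightarrow> int \<Rightarrow> qel set \<Rightarrow> bool" where
  "maximal_order a b R \<longleftrightarrow> is_order a b R \<and> (\<forall>R'. is_order a b R' \<and> R \<subseteq> R' \<longrightarrow> R' = R)"

definition gross :: "int \<Rightarrow> int \<Rightarrow> qel set \<Rightarrow> qel set" where
  "gross a b R = {qsub (qsmult 2 x) (qscalar (qtrd a b x)) | x. x \<in> R}"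

definition succ_min :: "int \<Rightarrow> int \<Rightarrow> qel set \<Rightarrow> nat \<Rightarrow> rat" where
  "succ_min a b L i = (LEAST D. \<exists>vs. length vs = i \<and> lin_indep vs \<and>
                                     set vs \<subseteq> {x \<in> L. qnrd a b x \<le> D})"

definition succ_min_basis :: "int \<Rightarrow> int \<Rightarrow> qel set \<Rightarrow> qel list \<Rightarrow> bool" where
  "succ_min_basis a b L vs \<longleftrightarrow> length vs = 3 \<and> is_Zbasis L vs \<and>
     (\<forall>i<3. qnrd a b (vs ! i) = succ_min a b L (Suc i))"

definition normalized :: "int \<Rightarrow> int \<Rightarrow> qel list \<Rightarrow> bool" where
  "normalized a b vs \<longleftrightarrow> qinner a b (vs ! 0) (vs ! 1) \<ge> 0 \<and> qinner a b (vs ! 0) (vs ! 2) \<ge> 0"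

definition gram :: "int \<Rightarrow> int \<Rightarrow> qel list \<Rightarrow> rat list list" where
  "gram a b vs = map (\<lambda>x. map (\<lambda>y. qinner a b x y) vs) vs"

definition orthogonal_lattice :: "int \<Rightarrow> int \<Rightarrow> qel set \<Rightarrow> bool" where
  "orthogonal_lattice a b L \<longleftrightarrow> (\<exists>vs. is_Zbasis L vs \<and>
     (\<forall>i<length vs. \<forall>j<length vs. i \<noteq> j \<longrightarrow> qinner a b (vs ! i) (vs ! j) = 0))"

definition well_rounded :: "int \<Rightarrow> int \<Rightarrow> nat \<Rightarrow> qel set \<Rightarrow> bool" where
  "well_rounded a b n L \<longleftrightarrow> (\<exists>vs. length vs = n \<and> lin_indep vs \<and> set vs \<subseteq> L \<and>
     (\<forall>v\<in>set vs. \<forall>x\<in>L. x \<noteq> qzero \<longrightarrow> qnrd a b v \<le> qnrd a b x))"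

end

(* A maximal order R of a definite quaternion algebra is the even Clifford algebra of a positive
   ternary form f, and the Gram matrix of its Gross lattice is the adjugate of the Gram matrix of f;
   so the Gross lattice has determinant 4 N^2, where N is the half-discriminant of f.
   If a prime l divides N, then either f can be rescaled at l to give a larger order, or f is
   anisotropic at l, the algebra is ramified at l and l divides N exactly once; Selling reduction
   excludes N = 1.  Hence N = p.
   An orthogonal basis would make f diagonal, so that 4 divides N.  If all successive minima equal D,
   then 4p divides D^2 - x^2 for every off-diagonal Gram entry x, which contradicts
   D^3 <= 2 * 4p^2 when p > 2.  For p = 2 Selling reduction leaves a single form f. *)
theory Submission
  imports Defs "HOL-Analysis.Cartesian_Space"
begin

text \<open>The hypothesis on the algebra consists of congruences modulo prime powers, and the local
  arguments stay at that level: no completions, only integral base changes of forms and one descent.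
  The local analysis goes in one direction. It shows that a prime dividing N ramifies, not that the
  ramified prime divides N. The missing direction is replaced by a global bound: N is at least 2, so
  some prime divides N, and this prime has to be p. The bound comes from Selling parameters, which
  turn 2N into the weighted number of spanning trees of the complete graph on four vertices. The
  weights that give N = 2 can be listed, and this also settles p = 2. The factor 4p of the
  well-rounded case is 4N: the principal 2x2 minors of the adjugate of the Gram matrix of f are 4N
  times the diagonal coefficients of f.\<close>

definition lin :: "qel \<Rightarrow> qel \<Rightarrow> qel \<Rightarrow> rat \<Rightarrow> rat \<Rightarrow> rat \<Rightarrow> rat \<Rightarrow> qel" where
  "lin e1 e2 e3 x0 x1 x2 x3 =
     QE (x0 + x1 * c0 e1 + x2 * c0 e2 + x3 * c0 e3) (x1 * c1 e1 + x2 * c1 e2 + x3 * c1 e3)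
        (x1 * c2 e1 + x2 * c2 e2 + x3 * c2 e3) (x1 * c3 e1 + x2 * c3 e2 + x3 * c3 e3)"

definition lin3 :: "qel \<Rightarrow> qel \<Rightarrow> qel \<Rightarrow> rat \<Rightarrow> rat \<Rightarrow> rat \<Rightarrow> qel" where
  "lin3 e1 e2 e3 x1 x2 x3 = lin e1 e2 e3 0 x1 x2 x3"

section \<open>Integral spans and independence in explicit coordinates\<close>

lemma lessThan_nums:
  "{..<4::nat} = {0,1,2,3}" "{..<3::nat} = {0,1,2}"
  by auto

lemma all_less4: "(\<forall>i<Suc (Suc (Suc (Suc 0))). P i) \<longleftrightarrow> P 0 \<and> P 1 \<and> P 2 \<and> P 3"
  "(\<forall>i<4. P i) \<longleftrightarrow> P 0 \<and> P 1 \<and> P 2 \<and> P 3"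
  by (auto simp: numeral_eq_Suc less_Suc_eq)

lemma all_less3: "(\<forall>i<Suc (Suc (Suc 0)). P i) \<longleftrightarrow> P 0 \<and> P 1 \<and> P 2"
  "(\<forall>i<3. P i) \<longleftrightarrow> P 0 \<and> P 1 \<and> P 2"
  by (auto simp: numeral_eq_Suc less_Suc_eq)

lemma lincomb4: "lincomb c [qone, e1, e2, e3] = lin e1 e2 e3 (c 0) (c 1) (c 2) (c 3)"
  by (simp add: lincomb_def lin_def lessThan_nums qone_def numeral_eq_Suc)

lemma lincomb3: "lincomb c [e1, e2, e3] = lin3 e1 e2 e3 (c 0) (c 1) (c 2)"
  by (simp add: lincomb_def lin_def lin3_def lessThan_nums numeral_eq_Suc)

lemma ex_fun4: "(\<exists>c::nat \<Rightarrow> rat. P (c 0) (c 1) (c 2) (c (3::nat))) \<longleftrightarrow> (\<exists>x0 x1 x2 x3. P x0 x1 x2 x3)"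
proof
  assume "\<exists>x0 x1 x2 x3. P x0 x1 x2 x3"
  then obtain x0 x1 x2 x3 where "P x0 x1 x2 x3" by blast
  then show "\<exists>c::nat \<Rightarrow> rat. P (c 0) (c 1) (c 2) (c (3::nat))"
    by (intro exI[of _ "\<lambda>i. [x0,x1,x2,x3] ! i"]) (simp add: numeral_eq_Suc)
qed blast

lemma zspan4:
  "zspan [qone, e1, e2, e3] =
     {lin e1 e2 e3 (of_int x0) (of_int x1) (of_int x2) (of_int x3) | x0 x1 x2 x3 :: int. True}"
  (is "_ = ?S")
proof -
  have "x \<in> zspan [qone, e1, e2, e3] \<longleftrightarrow>
      (\<exists>c. x = lin e1 e2 e3 (c 0) (c 1) (c 2) (c (3::nat)) \<and> c 0 \<in> \<int> \<and> c 1 \<in> \<int> \<and> c (2::nat) \<in> \<int> \<and> c 3 \<in> \<int>)" for x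
    unfolding zspan_def lincomb4[symmetric] by (auto simp add: all_less4)
  also have "\<dots> x \<longleftrightarrow> (\<exists>x0 x1 x2 x3. x = lin e1 e2 e3 x0 x1 x2 x3 \<and> x0 \<in> \<int> \<and> x1 \<in> \<int> \<and> x2 \<in> \<int> \<and> x3 \<in> \<int>)" for x
    by (rule ex_fun4)
  also have "\<dots> x \<longleftrightarrow> x \<in> ?S" for x
    by (blast elim: Ints_cases intro: Ints_of_int)
  finally show ?thesis by blast
qed

lemma zspan3:
  "zspan [e1, e2, e3] = {lin3 e1 e2 e3 (of_int x1) (of_int x2) (of_int x3) | x1 x2 x3 :: int. True}"
  (is "_ = ?S")
proof -
  have "x \<in> zspan [e1, e2, e3] \<longleftrightarrow>
      (\<exists>c. x = lin3 e1 e2 e3 (c 0) (c 1) (c (2::nat)) \<and> c 0 \<in> \<int> \<and> c 1 \<in> \<int> \<and> c 2 \<in> \<int>)" for x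
    unfolding zspan_def lincomb3[symmetric] by (auto simp add: all_less3)
  also have "\<dots> x \<longleftrightarrow> (\<exists>x1 x2 x3 x0::rat. x = lin3 e1 e2 e3 x1 x2 x3 \<and> x1 \<in> \<int> \<and> x2 \<in> \<int> \<and> x3 \<in> \<int>)" for x
    by (rule ex_fun4)
  also have "\<dots> x \<longleftrightarrow> x \<in> ?S" for x
    by (blast elim: Ints_cases intro: Ints_of_int)
  finally show ?thesis by blast
qed

lemma lin_indep3:
  "lin_indep [e1, e2, e3] \<longleftrightarrow>
    (\<forall>x y z. lin3 e1 e2 e3 x y z = qzero \<longrightarrow> x = 0 \<and> y = 0 \<and> z = 0)" (is "?l = ?r")
proof
  assume l: ?l
  show ?r
  proof (intro allI impI)
    fix x y z assume "lin3 e1 e2 e3 x y z = qzero"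
    then have "lincomb (\<lambda>i. [x,y,z] ! i) [e1,e2,e3] = qzero" by (simp add: lincomb3)
    then have "\<forall>i<length [e1,e2,e3]. [x,y,z] ! i = 0"
      using l unfolding lin_indep_def by blast
    then show "x = 0 \<and> y = 0 \<and> z = 0" by (simp add: all_less3)
  qed
next
  assume ?r then show ?l unfolding lin_indep_def by (simp add: lincomb3 all_less3 flip: One_nat_def)
qed

lemma lin_indep4:
  assumes "\<And>x0 x1 x2 x3. lin e1 e2 e3 x0 x1 x2 x3 = qzero \<Longrightarrow> x0 = 0 \<and> x1 = 0 \<and> x2 = 0 \<and> x3 = 0"
  shows "lin_indep [qone, e1, e2, e3]"
  unfolding lin_indep_def using assms by (simp add: lincomb4 all_less4 flip: One_nat_def)

section \<open>Orders attached to integral ternary quadratic forms\<close>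

text \<open>Multiplication table of the even Clifford algebra of
  \<open>A x\<^sup>2 + B y\<^sup>2 + C z\<^sup>2 + U y z + V x z + W x y\<close> in a basis \<open>1, e1, e2, e3\<close>.\<close>
definition ftab :: "int \<Rightarrow> int \<Rightarrow> qel \<Rightarrow> qel \<Rightarrow> qel \<Rightarrow> rat \<Rightarrow> rat \<Rightarrow> rat \<Rightarrow> rat \<Rightarrow> rat \<Rightarrow> rat \<Rightarrow> bool" where
  "ftab a b e1 e2 e3 A B C U V W \<longleftrightarrow>
     c0 e1 = U / 2 \<and> c0 e2 = V / 2 \<and> c0 e3 = W / 2 \<and>
     qmul a b e1 e1 = lin e1 e2 e3 (- B * C) U 0 0 \<and>
     qmul a b e2 e2 = lin e1 e2 e3 (- A * C) 0 V 0 \<and>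
     qmul a b e3 e3 = lin e1 e2 e3 (- A * B) 0 0 W \<and>
     qmul a b e2 e3 = lin e1 e2 e3 (A * U) (- A) 0 0 \<and>
     qmul a b e3 e1 = lin e1 e2 e3 (B * V) 0 (- B) 0 \<and>
     qmul a b e1 e2 = lin e1 e2 e3 (C * W) 0 0 (- C) \<and>
     qmul a b e3 e2 = lin e1 e2 e3 (- V * W) A W V \<and>
     qmul a b e1 e3 = lin e1 e2 e3 (- U * W) W B U \<and>
     qmul a b e2 e1 = lin e1 e2 e3 (- U * V) V U C"

lemma lin_mul:
  assumes "ftab a b e1 e2 e3 A B C U V W"
  shows "qmul a b (lin e1 e2 e3 x0 x1 x2 x3) (lin e1 e2 e3 y0 y1 y2 y3) = lin e1 e2 e3
     (x0*y0 - B*C*x1*y1 - A*C*x2*y2 - A*B*x3*y3 + A*U*x2*y3 + B*V*x3*y1 + C*W*x1*y2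
        - V*W*x3*y2 - U*W*x1*y3 - U*V*x2*y1)
     (x0*y1 + x1*y0 + U*x1*y1 - A*x2*y3 + A*x3*y2 + W*x1*y3 + V*x2*y1)
     (x0*y2 + x2*y0 + V*x2*y2 - B*x3*y1 + W*x3*y2 + B*x1*y3 + U*x2*y1)
     (x0*y3 + x3*y0 + W*x3*y3 - C*x1*y2 + V*x3*y2 + U*x1*y3 + C*x2*y1)"
proof -
  let ?s = qsmult and ?m = "qmul a b"
  have "?m (lin e1 e2 e3 x0 x1 x2 x3) (lin e1 e2 e3 y0 y1 y2 y3) =
    qadd (lin e1 e2 e3 (x0*y0) (x0*y1 + x1*y0) (x0*y2+x2*y0) (x0*y3+x3*y0))
    (qadd (qadd (qadd (?s (x1*y1) (?m e1 e1)) (?s (x1*y2) (?m e1 e2))) (?s (x1*y3) (?m e1 e3)))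
    (qadd (qadd (qadd (?s (x2*y1) (?m e2 e1)) (?s (x2*y2) (?m e2 e2))) (?s (x2*y3) (?m e2 e3)))
    (qadd (qadd (?s (x3*y1) (?m e3 e1)) (?s (x3*y2) (?m e3 e2))) (?s (x3*y3) (?m e3 e3)))))"
    by (simp add: qmul_def lin_def qadd_def qsmult_def Let_def algebra_simps)
  also have "\<dots> = lin e1 e2 e3
     (x0*y0 - B*C*x1*y1 - A*C*x2*y2 - A*B*x3*y3 + A*U*x2*y3 + B*V*x3*y1 + C*W*x1*y2
        - V*W*x3*y2 - U*W*x1*y3 - U*V*x2*y1)
     (x0*y1 + x1*y0 + U*x1*y1 - A*x2*y3 + A*x3*y2 + W*x1*y3 + V*x2*y1)
     (x0*y2 + x2*y0 + V*x2*y2 - B*x3*y1 + W*x3*y2 + B*x1*y3 + U*x2*y1)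
     (x0*y3 + x3*y0 + W*x3*y3 - C*x1*y2 + V*x3*y2 + U*x1*y3 + C*x2*y1)"
    using assms unfolding ftab_def
    by (simp add: lin_def qadd_def qsmult_def) (simp add: algebra_simps)
  finally show ?thesis .
qed

text \<open>Half the determinant of the Gram matrix with diagonal 2A, 2B, 2C and off-diagonal
  entries W, V, U. The determinant itself is always even, so its half is the finer invariant at the
  prime 2.\<close>

definition hdisc :: "'a::comm_ring_1 \<Rightarrow> 'a \<Rightarrow> 'a \<Rightarrow> 'a \<Rightarrow> 'a \<Rightarrow> 'a \<Rightarrow> 'a" where
  "hdisc A B C U V W = 4*A*B*C + U*V*W - A*U^2 - B*V^2 - C*W^2"

lemma hdisc_of_int:
  "hdisc (of_int A) (of_int B) (of_int C) (of_int U) (of_int V) (of_int W) =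
     of_int (hdisc A B C U V W)"
  by (simp add: hdisc_def)

lemma lin_cong:
  "x0 = y0 \<Longrightarrow> x1 = y1 \<Longrightarrow> x2 = y2 \<Longrightarrow> x3 = y3 \<Longrightarrow> lin e1 e2 e3 x0 x1 x2 x3 = lin e1 e2 e3 y0 y1 y2 y3"
  by simp

lemma c0_lin:
  assumes "ftab a b e1 e2 e3 A B C U V W"
  shows "c0 (lin e1 e2 e3 x0 x1 x2 x3) = x0 + (x1 * U + x2 * V + x3 * W) / 2"
proof -
  have c: "c0 e1 = U / 2" "c0 e2 = V / 2" "c0 e3 = W / 2" using assms by (simp_all add: ftab_def)
  show ?thesis unfolding lin_def c by (simp add: add_divide_distrib)
qed

lemma lin_lin:
  "lin (lin e1 e2 e3 p0 p1 p2 p3) (lin e1 e2 e3 q0 q1 q2 q3) (lin e1 e2 e3 r0 r1 r2 r3) x0 x1 x2 x3 =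
     lin e1 e2 e3 (x0 + x1*p0 + x2*q0 + x3*r0) (x1*p1 + x2*q1 + x3*r1)
       (x1*p2 + x2*q2 + x3*r2) (x1*p3 + x2*q3 + x3*r3)"
  by (simp add: lin_def algebra_simps)

lemma lin_unit:
  "lin e1 e2 e3 0 1 0 0 = e1" "lin e1 e2 e3 0 0 1 0 = e2" "lin e1 e2 e3 0 0 0 1 = e3"
  "lin e1 e2 e3 1 0 0 0 = qone"
  by (simp_all add: lin_def qone_def)

lemma c0_zero_right: "X = qzero \<Longrightarrow> c0 (qmul a b X y) = 0"
  by (simp add: qmul_def qzero_def Let_def)

text \<open>The rows of the Gram matrix of the form give elements dual to \<open>e1, e2, e3\<close> under the trace
  pairing, so pairing with them isolates each coordinate.\<close>
lemma ftab_indep: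
  assumes t: "ftab a b e1 e2 e3 A B C U V W" and N: "hdisc A B C U V W \<noteq> 0"
    and z: "lin e1 e2 e3 x0 x1 x2 x3 = qzero"
  shows "x0 = 0 \<and> x1 = 0 \<and> x2 = 0 \<and> x3 = 0"
proof -
  note c = c0_zero_right[OF z, of a b "lin e1 e2 e3 _ _ _ _", unfolded lin_mul[OF t] c0_lin[OF t]]
  have "hdisc A B C U V W * x1 = 0"
    \<comment> \<open>The first argument makes the second factor traceless, so \<open>x0\<close>
      does not contribute.\<close>
    using c[of "- 2*A*U - 2*V*W" "4*A" "2*W" "2*V"]
    by (simp add: hdisc_def field_simps power2_eq_square)
  moreover have "hdisc A B C U V W * x2 = 0"
    using c[of "- 2*B*V - 2*U*W" "2*W" "4*B" "2*U"]
    by (simp add: hdisc_def field_simps power2_eq_square)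
  moreover have "hdisc A B C U V W * x3 = 0"
    using c[of "- 2*C*W - 2*U*V" "2*V" "2*U" "4*C"]
    by (simp add: hdisc_def field_simps power2_eq_square)
  ultimately have "x1 = 0" "x2 = 0" "x3 = 0" using N by auto
  then show ?thesis using z by (simp add: lin_def qzero_def)
qed

lemma lin_eq_iff:
  assumes "ftab a b e1 e2 e3 A B C U V W" "hdisc A B C U V W \<noteq> 0"
  shows "lin e1 e2 e3 x0 x1 x2 x3 = lin e1 e2 e3 y0 y1 y2 y3 \<longleftrightarrow>
    x0 = y0 \<and> x1 = y1 \<and> x2 = y2 \<and> x3 = y3" (is "?l \<longleftrightarrow> _")
proof
  assume ?l
  then have "lin e1 e2 e3 (x0 - y0) (x1 - y1) (x2 - y2) (x3 - y3) = qzero"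
    by (simp add: lin_def qzero_def algebra_simps)
  then show "x0 = y0 \<and> x1 = y1 \<and> x2 = y2 \<and> x3 = y3" using ftab_indep[OF assms] by force
qed simp

lemma ftab_order:
  fixes A B C U V W :: int
  assumes t: "ftab a b e1 e2 e3 (of_int A) (of_int B) (of_int C) (of_int U) (of_int V) (of_int W)"
    and N: "hdisc A B C U V W \<noteq> 0"
  shows "is_order a b (zspan [qone, e1, e2, e3])"
  unfolding is_order_def
proof (intro conjI ballI)
  have "hdisc (of_int A) (of_int B) (of_int C) (of_int U) (of_int V) (of_int W) \<noteq> (0::rat)"
    using N by (simp add: hdisc_of_int)
  then have "is_Zbasis (zspan [qone, e1, e2, e3]) [qone, e1, e2, e3]"
    unfolding is_Zbasis_def using lin_indep4 ftab_indep[OF t] by blast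
  then show "\<exists>vs. length vs = 4 \<and> is_Zbasis (zspan [qone, e1, e2, e3]) vs" by force
  have "qone = lin e1 e2 e3 (of_int 1) (of_int 0) (of_int 0) (of_int 0)"
    by (simp add: lin_unit)
  then show "qone \<in> zspan [qone, e1, e2, e3]" unfolding zspan4 by blast
  fix x y assume "x \<in> zspan [qone, e1, e2, e3]" "y \<in> zspan [qone, e1, e2, e3]"
  then obtain x0 x1 x2 x3 y0 y1 y2 y3 :: int where
    "x = lin e1 e2 e3 (of_int x0) (of_int x1) (of_int x2) (of_int x3)"
    "y = lin e1 e2 e3 (of_int y0) (of_int y1) (of_int y2) (of_int y3)"
    unfolding zspan4 by blast
  then show "qmul a b x y \<in> zspan [qone, e1, e2, e3]"
    unfolding zspan4
    by (simp only: lin_mul[OF t] flip: of_int_add of_int_mult of_int_diff) blast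
qed

lemma zspan4_mono:
  assumes "{e1, e2, e3} \<subseteq> zspan [qone, f1, f2, f3]"
  shows "zspan [qone, e1, e2, e3] \<subseteq> zspan [qone, f1, f2, f3]"
proof
  fix x assume "x \<in> zspan [qone, e1, e2, e3]"
  then obtain x0 x1 x2 x3 :: int where
    x: "x = lin e1 e2 e3 (of_int x0) (of_int x1) (of_int x2) (of_int x3)"
    unfolding zspan4 by blast
  from assms obtain p0 p1 p2 p3 q0 q1 q2 q3 r0 r1 r2 r3 :: int where
    "e1 = lin f1 f2 f3 (of_int p0) (of_int p1) (of_int p2) (of_int p3)"
    "e2 = lin f1 f2 f3 (of_int q0) (of_int q1) (of_int q2) (of_int q3)"
    "e3 = lin f1 f2 f3 (of_int r0) (of_int r1) (of_int r2) (of_int r3)"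
    unfolding zspan4 by auto
  then show "x \<in> zspan [qone, f1, f2, f3]" unfolding zspan4 x
    by (simp only: lin_lin flip: of_int_add of_int_mult of_int_diff) blast
qed

lemma lin_in_zspan4:
  "lin e1 e2 e3 (of_int x0) (of_int x1) (of_int x2) (of_int x3) \<in> zspan [qone, e1, e2, e3]"
  unfolding zspan4 by blast

lemma lin_in_zspan4':
  assumes "x0 \<in> \<int>" "x1 \<in> \<int>" "x2 \<in> \<int>" "x3 \<in> \<int>"
  shows "lin e1 e2 e3 x0 x1 x2 x3 \<in> zspan [qone, e1, e2, e3]"
  using assms by (elim Ints_cases) (simp add: lin_in_zspan4)

lemma e_in_zspan4: "{e1, e2, e3} \<subseteq> zspan [qone, e1, e2, e3]"
  using lin_in_zspan4'[of 0 1 0 0 e1 e2 e3] lin_in_zspan4'[of 0 0 1 0 e1 e2 e3]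
    lin_in_zspan4'[of 0 0 0 1 e1 e2 e3] by (simp add: lin_unit)

section \<open>Changes of variables and rescalings of the form\<close>

lemma ftab_cyc:
  "ftab a b e1 e2 e3 A B C U V W \<Longrightarrow> ftab a b e2 e3 e1 B C A V W U"
  by (simp add: ftab_def lin_def algebra_simps)

text \<open>Let h1, h2, h3 be the basis of the ternary lattice inside its Clifford algebra, so that
  e1 = h2 h3, e2 = h3 h1 and e3 = h1 h2. Replacing h2 by h2 + k h1 turns e1 into e1 + k h1 h3 = e1 +
  k (V - e2) and e3 into e3 + k A. The form becomes f(x + k y, y, z).\<close>

lemma ftab_shear:
  assumes t: "ftab a b e1 e2 e3 A B C U V W"
  shows "ftab a b (lin e1 e2 e3 (k*V) 1 (-k) 0) (lin e1 e2 e3 0 0 1 0) (lin e1 e2 e3 (k*A) 0 0 1)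
     A (B + k*W + k^2*A) C (U + k*V) V (W + 2*k*A)"
  unfolding ftab_def lin_mul[OF t] lin_lin c0_lin[OF t]
  by (intro conjI lin_cong; simp add: algebra_simps add_divide_distrib diff_divide_distrib power2_eq_square)

text \<open>Exchanging h1 and h2 gives the products h1 h3 = V - e2, h3 h2 = U - e1 and h2 h1 = W -
  e3.\<close>

lemma ftab_swap:
  assumes t: "ftab a b e1 e2 e3 A B C U V W"
  shows "ftab a b (lin e1 e2 e3 V 0 (-1) 0) (lin e1 e2 e3 U (-1) 0 0) (lin e1 e2 e3 W 0 0 (-1))
     B A C V U W"
  unfolding ftab_def lin_mul[OF t] lin_lin c0_lin[OF t]
  by (intro conjI lin_cong; simp add: algebra_simps add_divide_distrib diff_divide_distrib power2_eq_square)

text \<open>The effect of replacing h3 by -h3.\<close>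

lemma ftab_neg:
  assumes t: "ftab a b e1 e2 e3 A B C U V W"
  shows "ftab a b (lin e1 e2 e3 0 (-1) 0 0) (lin e1 e2 e3 0 0 (-1) 0) (lin e1 e2 e3 0 0 0 1)
     A B C (-U) (-V) W"
  unfolding ftab_def lin_mul[OF t] lin_lin c0_lin[OF t]
  by (intro conjI lin_cong; simp add: algebra_simps add_divide_distrib diff_divide_distrib power2_eq_square)

text \<open>The new form is f(x, y, l z) / l. If it is integral, the order has been enlarged by e3 /
  l.\<close>

lemma ftab_div3:
  assumes t: "ftab a b e1 e2 e3 A B C U V W" and l: "l \<noteq> 0"
  shows "ftab a b (lin e1 e2 e3 0 1 0 0) (lin e1 e2 e3 0 0 1 0) (lin e1 e2 e3 0 0 0 (1/l))
     (A/l) (B/l) (C*l) U V (W/l)"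
  unfolding ftab_def lin_mul[OF t] lin_lin c0_lin[OF t]
  by (intro conjI lin_cong; use l in \<open>simp add: divide_simps power2_eq_square\<close>; simp add: algebra_simps)

text \<open>The new form is f(x / l, y, z): dividing h1 by l divides e2 and e3 by l.\<close>

lemma ftab_div23:
  assumes t: "ftab a b e1 e2 e3 A B C U V W" and l: "l \<noteq> 0"
  shows "ftab a b (lin e1 e2 e3 0 1 0 0) (lin e1 e2 e3 0 0 (1/l) 0) (lin e1 e2 e3 0 0 0 (1/l))
     (A/l^2) B C U (V/l) (W/l)"
  unfolding ftab_def lin_mul[OF t] lin_lin c0_lin[OF t]
  by (intro conjI lin_cong; use l in \<open>simp add: divide_simps power2_eq_square\<close>; simp add: algebra_simps)

text \<open>The forms f and -f give the same order, with e1, e2, e3 negated. The sign of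
  \<open>hdisc\<close> selects one of the two; if a and b are negative, it is the positive definite
  one.\<close>

definition has_form :: "int \<Rightarrow> int \<Rightarrow> qel set \<Rightarrow> int \<Rightarrow> int \<Rightarrow> int \<Rightarrow> int \<Rightarrow> int \<Rightarrow> int \<Rightarrow> bool" where
  "has_form a b R A B C U V W \<longleftrightarrow> hdisc A B C U V W > 0 \<and>
     (\<exists>e1 e2 e3. R = zspan [qone, e1, e2, e3] \<and>
        ftab a b e1 e2 e3 (of_int A) (of_int B) (of_int C) (of_int U) (of_int V) (of_int W))"

lemma has_form_cyc:
  assumes "has_form a b R A B C U V W" shows "has_form a b R B C A V W U"
proof -
  from assms obtain e1 e2 e3 where e: "R = zspan [qone, e1, e2, e3]"
    "ftab a b e1 e2 e3 (of_int A) (of_int B) (of_int C) (of_int U) (of_int V) (of_int W)"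
    "hdisc A B C U V W > 0"
    unfolding has_form_def by blast
  have "zspan [qone, e2, e3, e1] = zspan [qone, e1, e2, e3]"
    using e_in_zspan4[of e1 e2 e3] e_in_zspan4[of e2 e3 e1] by (intro equalityI zspan4_mono) auto
  moreover have "hdisc B C A V W U = hdisc A B C U V W" by (simp add: hdisc_def)
  ultimately show ?thesis unfolding has_form_def using e(1,3) ftab_cyc[OF e(2)] by auto
qed

lemma has_form_transform:
  assumes "R = zspan [qone, e1, e2, e3]"
    and "ftab a b f1 f2 f3 (of_int A) (of_int B) (of_int C) (of_int U) (of_int V) (of_int W)"
    and "hdisc A B C U V W > 0"
    and "{f1, f2, f3} \<subseteq> zspan [qone, e1, e2, e3]" "{e1, e2, e3} \<subseteq> zspan [qone, f1, f2, f3]"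
  shows "has_form a b R A B C U V W"
  unfolding has_form_def using assms zspan4_mono[OF assms(4)] zspan4_mono[OF assms(5)] by blast

lemma has_form_shear:
  assumes "has_form a b R A B C U V W"
  shows "has_form a b R A (B + k*W + k^2*A) C (U + k*V) V (W + 2*k*A)"
proof -
  from assms obtain e1 e2 e3 where e: "R = zspan [qone, e1, e2, e3]"
    "ftab a b e1 e2 e3 (of_int A) (of_int B) (of_int C) (of_int U) (of_int V) (of_int W)"
    "hdisc A B C U V W > 0"
    unfolding has_form_def by blast
  let ?k = "of_int k :: rat"
  let ?f1 = "lin e1 e2 e3 (?k*of_int V) 1 (-?k) 0" and ?f2 = "lin e1 e2 e3 0 0 1 0"
    and ?f3 = "lin e1 e2 e3 (?k*of_int A) 0 0 1"
  have t: "ftab a b ?f1 ?f2 ?f3 (of_int A) (of_int (B + k*W + k^2*A)) (of_int C) (of_int (U + k*V))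
     (of_int V) (of_int (W + 2*k*A))"
    using ftab_shear[OF e(2), of ?k] by simp
  have "{e1, e2, e3} \<subseteq> zspan [qone, ?f1, ?f2, ?f3]"
    using e_in_zspan4[of ?f1 ?f2 ?f3] lin_in_zspan4'[of "-?k * of_int V" 1 ?k 0 ?f1 ?f2 ?f3]
      lin_in_zspan4'[of "-?k * of_int A" 0 0 1 ?f1 ?f2 ?f3]
    unfolding lin_lin by (simp add: lin_unit)
  moreover have "{?f1, ?f2, ?f3} \<subseteq> zspan [qone, e1, e2, e3]"
    by (auto intro!: lin_in_zspan4')
  moreover have "hdisc A (B + k*W + k^2*A) C (U + k*V) V (W + 2*k*A) > 0"
    using e(3) by (simp add: hdisc_def algebra_simps power2_eq_square)
  ultimately show ?thesis using has_form_transform[OF e(1) t] by blast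
qed

lemma has_form_swap:
  assumes "has_form a b R A B C U V W"
  shows "has_form a b R B A C V U W"
proof -
  from assms obtain e1 e2 e3 where e: "R = zspan [qone, e1, e2, e3]"
    "ftab a b e1 e2 e3 (of_int A) (of_int B) (of_int C) (of_int U) (of_int V) (of_int W)"
    "hdisc A B C U V W > 0"
    unfolding has_form_def by blast
  let ?f1 = "lin e1 e2 e3 (of_int V) 0 (-1) 0" and ?f2 = "lin e1 e2 e3 (of_int U) (-1) 0 0"
    and ?f3 = "lin e1 e2 e3 (of_int W) 0 0 (-1)"
  have "{e1, e2, e3} \<subseteq> zspan [qone, ?f1, ?f2, ?f3]"
    using lin_in_zspan4'[of "of_int U" 0 "-1" 0 ?f1 ?f2 ?f3]
      lin_in_zspan4'[of "of_int V" "-1" 0 0 ?f1 ?f2 ?f3]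
      lin_in_zspan4'[of "of_int W" 0 0 "-1" ?f1 ?f2 ?f3]
    unfolding lin_lin by (simp add: lin_unit)
  moreover have "{?f1, ?f2, ?f3} \<subseteq> zspan [qone, e1, e2, e3]"
    by (auto intro!: lin_in_zspan4')
  moreover have "hdisc B A C V U W > 0"
    using e(3) by (simp add: hdisc_def algebra_simps power2_eq_square)
  ultimately show ?thesis using has_form_transform[OF e(1) ftab_swap[OF e(2)]] by blast
qed

lemma has_form_neg:
  assumes "has_form a b R A B C U V W"
  shows "has_form a b R A B C (-U) (-V) W"
proof -
  from assms obtain e1 e2 e3 where e: "R = zspan [qone, e1, e2, e3]"
    "ftab a b e1 e2 e3 (of_int A) (of_int B) (of_int C) (of_int U) (of_int V) (of_int W)"
    "hdisc A B C U V W > 0"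
    unfolding has_form_def by blast
  let ?f1 = "lin e1 e2 e3 0 (-1) 0 0" and ?f2 = "lin e1 e2 e3 0 0 (-1) 0"
    and ?f3 = "lin e1 e2 e3 0 0 0 1"
  have "{e1, e2, e3} \<subseteq> zspan [qone, ?f1, ?f2, ?f3]"
    using lin_in_zspan4'[of 0 "-1" 0 0 ?f1 ?f2 ?f3] lin_in_zspan4'[of 0 0 "-1" 0 ?f1 ?f2 ?f3]
      lin_in_zspan4'[of 0 0 0 1 ?f1 ?f2 ?f3]
    unfolding lin_lin by (simp add: lin_unit)
  moreover have "{?f1, ?f2, ?f3} \<subseteq> zspan [qone, e1, e2, e3]"
    by (auto intro!: lin_in_zspan4')
  moreover have "hdisc A B C (-U) (-V) W > 0"
    using e(3) by (simp add: hdisc_def)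
  moreover have t: "ftab a b ?f1 ?f2 ?f3 (of_int A) (of_int B) (of_int C) (of_int (-U)) (of_int (-V)) (of_int W)"
    using ftab_neg[OF e(2)] by simp
  ultimately show ?thesis using has_form_transform[OF e(1) t] by blast
qed

text \<open>Under these divisibilities f(x, y, l z) / l is integral and its order properly contains
  R.\<close>

lemma maximal_order_no_div3:
  assumes f: "has_form a b R A B C U V W" and m: "maximal_order a b R"
    and l: "l > 1" and d: "l dvd A" "l dvd B" "l dvd W"
  shows False
proof -
  from f obtain e1 e2 e3 where e: "R = zspan [qone, e1, e2, e3]"
    "ftab a b e1 e2 e3 (of_int A) (of_int B) (of_int C) (of_int U) (of_int V) (of_int W)"
    "hdisc A B C U V W > 0"
    unfolding has_form_def by blast
  let ?l = "of_int l :: rat"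
  have l0: "?l \<noteq> 0" using l by simp
  let ?f1 = "lin e1 e2 e3 0 1 0 0" and ?f2 = "lin e1 e2 e3 0 0 1 0"
    and ?f3 = "lin e1 e2 e3 0 0 0 (1/?l)"
  from d obtain A' B' W' where ABW: "A = l*A'" "B = l*B'" "W = l*W'" by (elim dvdE)
  have t: "ftab a b ?f1 ?f2 ?f3 (of_int A') (of_int B') (of_int (C*l)) (of_int U) (of_int V) (of_int W')"
    using ftab_div3[OF e(2) l0] l0 by (simp add: ABW)
  have "hdisc A B C U V W = l * hdisc A' B' (C*l) U V W'"
    by (simp add: ABW hdisc_def algebra_simps power2_eq_square)
  then have "hdisc A' B' (C*l) U V W' \<noteq> 0" using e(3) by auto
  then have o: "is_order a b (zspan [qone, ?f1, ?f2, ?f3])" using ftab_order[OF t] by blast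
  have "{e1, e2, e3} \<subseteq> zspan [qone, ?f1, ?f2, ?f3]"
    using e_in_zspan4[of ?f1 ?f2 ?f3] lin_in_zspan4'[of 0 0 0 ?l ?f1 ?f2 ?f3] l0
    unfolding lin_lin by (simp add: lin_unit)
  from zspan4_mono[OF this] have "R \<subseteq> zspan [qone, ?f1, ?f2, ?f3]" unfolding e(1) .
  then have "zspan [qone, ?f1, ?f2, ?f3] = R" using m o unfolding maximal_order_def by blast
  then have "?f3 \<in> zspan [qone, e1, e2, e3]"
    using e(1) e_in_zspan4[of ?f1 ?f2 ?f3] by simp
  then obtain n0 n1 n2 n :: int where
    n: "?f3 = lin e1 e2 e3 (of_int n0) (of_int n1) (of_int n2) (of_int n)"
    unfolding zspan4 by blast
  have "hdisc (of_int A) (of_int B) (of_int C) (of_int U) (of_int V) (of_int W) \<noteq> (0::rat)"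
    using e(3) by (simp add: hdisc_of_int)
  \<comment> \<open>Comparing the last coordinates of e3 / l in the two descriptions would make 1 /
    l an integer.\<close>
  from n[unfolded lin_eq_iff[OF e(2) this]] have "1/?l = of_int n" by blast
  then have "of_int (n * l) = (1::rat)" using l0 by (simp add: field_simps)
  then have "n * l = 1" by linarith
  then show False using l by (simp add: zmult_eq_1_iff)
qed

text \<open>Here f(x / l, y, z) is integral and its order properly contains R.\<close>

lemma maximal_order_no_div23:
  assumes f: "has_form a b R A B C U V W" and m: "maximal_order a b R"
    and l: "l > 1" and d: "l^2 dvd A" "l dvd V" "l dvd W"
  shows False
proof -
  from f obtain e1 e2 e3 where e: "R = zspan [qone, e1, e2, e3]"
    "ftab a b e1 e2 e3 (of_int A) (of_int B) (of_int C) (of_int U) (of_int V) (of_int W)"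
    "hdisc A B C U V W > 0"
    unfolding has_form_def by blast
  let ?l = "of_int l :: rat"
  have l0: "?l \<noteq> 0" using l by simp
  let ?f1 = "lin e1 e2 e3 0 1 0 0" and ?f2 = "lin e1 e2 e3 0 0 (1/?l) 0"
    and ?f3 = "lin e1 e2 e3 0 0 0 (1/?l)"
  from d obtain A' V' W' where ABW: "A = l^2*A'" "V = l*V'" "W = l*W'" by (elim dvdE)
  have t: "ftab a b ?f1 ?f2 ?f3 (of_int A') (of_int B) (of_int C) (of_int U) (of_int V') (of_int W')"
    using ftab_div23[OF e(2) l0] l0 by (simp add: ABW)
  have "hdisc A B C U V W = l^2 * hdisc A' B C U V' W'"
    by (simp add: ABW hdisc_def algebra_simps power2_eq_square)
  then have "hdisc A' B C U V' W' \<noteq> 0" using e(3) by auto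
  then have o: "is_order a b (zspan [qone, ?f1, ?f2, ?f3])" using ftab_order[OF t] by blast
  have "{e1, e2, e3} \<subseteq> zspan [qone, ?f1, ?f2, ?f3]"
    using e_in_zspan4[of ?f1 ?f2 ?f3] lin_in_zspan4'[of 0 0 0 ?l ?f1 ?f2 ?f3]
      lin_in_zspan4'[of 0 0 ?l 0 ?f1 ?f2 ?f3] l0
    unfolding lin_lin by (simp add: lin_unit)
  from zspan4_mono[OF this] have "R \<subseteq> zspan [qone, ?f1, ?f2, ?f3]" unfolding e(1) .
  then have "zspan [qone, ?f1, ?f2, ?f3] = R" using m o unfolding maximal_order_def by blast
  then have "?f3 \<in> zspan [qone, e1, e2, e3]"
    using e(1) e_in_zspan4[of ?f1 ?f2 ?f3] by simp
  then obtain n0 n1 n2 n :: int where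
    n: "?f3 = lin e1 e2 e3 (of_int n0) (of_int n1) (of_int n2) (of_int n)"
    unfolding zspan4 by blast
  have "hdisc (of_int A) (of_int B) (of_int C) (of_int U) (of_int V) (of_int W) \<noteq> (0::rat)"
    using e(3) by (simp add: hdisc_of_int)
  from n[unfolded lin_eq_iff[OF e(2) this]] have "1/?l = of_int n" by blast
  then have "of_int (n * l) = (1::rat)" using l0 by (simp add: field_simps)
  then have "n * l = 1" by linarith
  then show False using l by (simp add: zmult_eq_1_iff)
qed

section \<open>Local analysis of the form of a maximal order\<close>

definition formN :: "int \<Rightarrow> int \<Rightarrow> qel set \<Rightarrow> int \<Rightarrow> int \<Rightarrow> int \<Rightarrow> int \<Rightarrow> int \<Rightarrow> int \<Rightarrow> int \<Rightarrow> bool" where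
  "formN a b R N A B C U V W \<longleftrightarrow> has_form a b R A B C U V W \<and> hdisc A B C U V W = N"

lemma formN_cyc: "formN a b R N A B C U V W \<Longrightarrow> formN a b R N B C A V W U"
  unfolding formN_def using has_form_cyc by (auto simp: hdisc_def)

lemma formN_swap: "formN a b R N A B C U V W \<Longrightarrow> formN a b R N B A C V U W"
  unfolding formN_def using has_form_swap by (auto simp: hdisc_def)

text \<open>In the names of the shears the digits i j mean that k times the i-th basis vector is
  added to the j-th. The first shear is computed directly, the others are its conjugates under
  permutations of the variables.\<close>

lemma formN_shear12:
  "formN a b R N A B C U V W \<Longrightarrow> formN a b R N A (B + k*W + k^2*A) C (U + k*V) V (W + 2*k*A)"
  unfolding formN_def using has_form_shear[of a b R A B C U V W k]
  by (simp add: hdisc_def algebra_simps power2_eq_square)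

lemma formN_shear21:
  "formN a b R N A B C U V W \<Longrightarrow> formN a b R N (A + k*W + k^2*B) B C U (V + k*U) (W + 2*k*B)"
  by (drule formN_swap, drule formN_shear12[of _ _ _ _ _ _ _ _ _ _ k], erule formN_swap)

lemma formN_shear32:
  "formN a b R N A B C U V W \<Longrightarrow> formN a b R N A (B + k*U + k^2*C) C (U + 2*k*C) V (W + k*V)"
  by (drule formN_cyc, drule formN_shear21[of _ _ _ _ _ _ _ _ _ _ k], drule formN_cyc, erule formN_cyc)

lemma formN_shear31:
  "formN a b R N A B C U V W \<Longrightarrow> formN a b R N (A + k*V + k^2*C) B C U (V + 2*k*C) (W + k*U)"
  by (drule formN_swap, drule formN_shear32[of _ _ _ _ _ _ _ _ _ _ k], erule formN_swap)

lemma formN_shear13: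
  "formN a b R N A B C U V W \<Longrightarrow> formN a b R N A B (C + k*V + k^2*A) (U + k*W) (V + 2*k*A) W"
  by (drule formN_cyc, drule formN_cyc, drule formN_shear21[of _ _ _ _ _ _ _ _ _ _ k], erule formN_cyc)

lemma formN_neg1:
  "formN a b R N A B C U V W \<Longrightarrow> formN a b R N A B C U (-V) (-W)"
proof -
  assume "formN a b R N A B C U V W"
  from formN_cyc[OF this] have "has_form a b R B C A (-V) (-W) U" "hdisc A B C U V W = N"
    using has_form_neg by (auto simp: formN_def hdisc_def)
  then have "formN a b R N B C A (-V) (-W) U" by (simp add: formN_def hdisc_def algebra_simps)
  then show ?thesis using formN_cyc by blast
qed

lemma formN_no_div3:
  assumes "formN a b R N A B C U V W" "maximal_order a b R" "prime (l::int)"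
    "l dvd A" "l dvd B" "l dvd W"
  shows False
  using maximal_order_no_div3[of a b R A B C U V W l] assms prime_gt_1_int unfolding formN_def by blast

lemma prime_inverse_mod:
  fixes l r :: int
  assumes "prime l" "\<not> l dvd r"
  obtains s q where "s * r = 1 + l * q"
proof -
  have "coprime r l" using assms by (metis coprime_commute prime_imp_coprime)
  then obtain s t where "s * r + t * l = 1" using bezout_int[of r l] by (auto simp: coprime_iff_gcd_eq_1)
  then have "s * r = 1 + l * (- t)" by (simp add: algebra_simps)
  then show ?thesis using that by blast
qed

text \<open>Modulo l, f and its derivatives in the last two variables vanish at r. As
  \<open>r1\<close> is a unit, r can be scaled to (1, y, z), and two shears make this the first
  basis vector. The new A is f(1, y, z), and the new W and V are the two derivatives there.\<close>

lemma radical_vector1: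
  fixes l :: int
  assumes F: "formN a b R N A B C U V W" and l: "prime l" and r1: "\<not> l dvd r1"
    and g: "l dvd W*r1 + 2*B*r2 + U*r3" "l dvd V*r1 + U*r2 + 2*C*r3"
      "l dvd A*r1^2 + B*r2^2 + C*r3^2 + U*r2*r3 + V*r1*r3 + W*r1*r2"
  shows "\<exists>A B C U V W. formN a b R N A B C U V W \<and> l dvd A \<and> l dvd V \<and> l dvd W"
proof -
  obtain s q where s: "s * r1 = 1 + l * q" using prime_inverse_mod[OF l r1] .
  define y z where "y = s * r2" and "z = s * r3"
  have F': "formN a b R N (A + y*W + y^2*B + z*(V+y*U) + z^2*C) B C U (V + y*U + 2*z*C) (W + 2*y*B + z*U)"
    using formN_shear31[OF formN_shear21[OF F, of y], of z] by simp
  \<comment> \<open>Modulo l, \<open>r1\<close> times (1, y, z) is r, so each value at (1, y, z),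
    times a power of \<open>r1\<close>, is congruent to the value at r.\<close>
  have yz: "r1 * y = r2 + l * (q * r2)" "r1 * z = r3 + l * (q * r3)"
    using arg_cong[OF s, of "\<lambda>t. t * r2"] arg_cong[OF s, of "\<lambda>t. t * r3"]
    by (simp_all add: y_def z_def algebra_simps)
  have "r1 * (W + 2*y*B + z*U) = W*r1 + 2*B*(r1*y) + U*(r1*z)" by (simp add: algebra_simps)
  also have "\<dots> = (W*r1 + 2*B*r2 + U*r3) + l * (2*B*(q*r2) + U*(q*r3))"
    unfolding yz by (simp add: algebra_simps)
  finally have "l dvd r1 * (W + 2*y*B + z*U)" using g(1) by simp
  then have 1: "l dvd W + 2*y*B + z*U" using l r1 by (meson prime_dvd_mult_iff)
  have "r1 * (V + y*U + 2*z*C) = V*r1 + U*(r1*y) + 2*C*(r1*z)" by (simp add: algebra_simps)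
  also have "\<dots> = (V*r1 + U*r2 + 2*C*r3) + l * (U*(q*r2) + 2*C*(q*r3))"
    unfolding yz by (simp add: algebra_simps)
  finally have "l dvd r1 * (V + y*U + 2*z*C)" using g(2) by simp
  then have 2: "l dvd V + y*U + 2*z*C" using l r1 by (meson prime_dvd_mult_iff)
  have "r1^2 * (A + y*W + y^2*B + z*(V+y*U) + z^2*C)
      = A*r1^2 + B*(r1*y)^2 + C*(r1*z)^2 + U*(r1*y)*(r1*z) + V*r1*(r1*z) + W*r1*(r1*y)"
    by (simp add: algebra_simps power2_eq_square)
  also have "\<dots> = (A*r1^2 + B*r2^2 + C*r3^2 + U*r2*r3 + V*r1*r3 + W*r1*r2)
     + l * (B*(2*r2*(q*r2) + l*(q*r2)^2) + C*(2*r3*(q*r3) + l*(q*r3)^2)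
       + U*(r2*(q*r3) + (q*r2)*r3 + l*(q*r2)*(q*r3)) + V*r1*(q*r3) + W*r1*(q*r2))"
    unfolding yz by (simp add: algebra_simps power2_eq_square)
  finally have "l dvd r1^2 * (A + y*W + y^2*B + z*(V+y*U) + z^2*C)" using g(3) by simp
  then have 3: "l dvd A + y*W + y^2*B + z*(V+y*U) + z^2*C"
    using l r1 by (meson prime_dvd_mult_iff prime_dvd_power)
  show ?thesis using F' 1 2 3 by blast
qed

lemma radical_vector:
  fixes l :: int
  assumes F: "formN a b R N A B C U V W" and l: "prime l" and r: "\<not> (l dvd r1 \<and> l dvd r2 \<and> l dvd r3)"
    and g: "l dvd 2*A*r1 + W*r2 + V*r3" "l dvd W*r1 + 2*B*r2 + U*r3" "l dvd V*r1 + U*r2 + 2*C*r3"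
      "l dvd A*r1^2 + B*r2^2 + C*r3^2 + U*r2*r3 + V*r1*r3 + W*r1*r2"
  shows "\<exists>A B C U V W. formN a b R N A B C U V W \<and> l dvd A \<and> l dvd V \<and> l dvd W"
proof -
  consider "\<not> l dvd r1" | "\<not> l dvd r2" | "\<not> l dvd r3" using r by blast
  then show ?thesis
  proof cases
    case 1 then show ?thesis using radical_vector1[OF F l, of r1 r2 r3] g by simp
  next
    case 2 then show ?thesis using radical_vector1[OF formN_cyc[OF F] l, of r2 r3 r1] g
      by (simp add: algebra_simps)
  next
    case 3 then show ?thesis using radical_vector1[OF formN_cyc[OF formN_cyc[OF F]] l, of r3 r1 r2] g
      by (simp add: algebra_simps)
  qed
qed

text \<open>The minors say that f has rank one modulo l. A change of variables makes it congruent to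
  C z^2, so that l divides A, B and W, which maximality forbids.\<close>

lemma rank_one_impossible:
  fixes l :: int
  assumes F: "formN a b R N A B C U V W" and m: "maximal_order a b R" and l: "prime l"
    and g: "l dvd 4*B*C - U^2" "l dvd 4*A*C - V^2" "l dvd U*V - 2*C*W" and C: "\<not> l dvd C"
    and g33: "l dvd 4*A*B - W^2"
  shows False
proof (cases "l = 2")
  case True
  have e: "even U" "even V" "even W" using g g33 unfolding True by (auto simp: even_diff)
  \<comment> \<open>Modulo 2 the mixed terms vanish and f = (A x + B y + z)^2, because C is odd. The
    shears absorb A x + B y into z.\<close>
  have F': "formN a b R N (A + A*V + A^2*C) (B + B*U + B^2*C) C (U + 2*B*C) (V + 2*A*C)
      (W + A*U + B*(V + 2*A*C))"
    using formN_shear32[OF formN_shear31[OF F, of A], of B] by simp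
  show False using formN_no_div3[OF F' m l] C e unfolding True by auto
next
  case False
  then have l2: "\<not> l dvd 2" using l primes_dvd_imp_eq[of l 2] by auto
  then have "\<not> l dvd 2 * C" using C l by (meson prime_dvd_mult_iff)
  then obtain s q where s: "s * (2*C) = 1 + l * q" using prime_inverse_mod[OF l] by blast
  \<comment> \<open>Completing the square: x and y solve V + 2 x C = 0 and U + 2 y C = 0 modulo
    l.\<close>
  define x y where "x = - s * V" and "y = - s * U"
  have x: "V + 2*x*C = - l * q * V" "U + 2*y*C = - l * q * U"
    using arg_cong[OF s, of "\<lambda>t. t * V"] arg_cong[OF s, of "\<lambda>t. t * U"]
    by (simp_all add: x_def y_def algebra_simps)
  have F': "formN a b R N (A + x*V + x^2*C) (B + y*U + y^2*C) C (U + 2*y*C) (V + 2*x*C)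
      (W + x*U + y*(V + 2*x*C))"
    using formN_shear32[OF formN_shear31[OF F, of x], of y] by simp
  have l4: "\<not> l dvd 4 * C" using l2 C l prime_dvd_mult_iff[of l 2 2] prime_dvd_mult_iff[of l 4 C] by auto
  have "4*C*(A + x*V + x^2*C) = (4*A*C - V^2) + (V + 2*x*C)^2"
    by (simp add: algebra_simps power2_eq_square)
  moreover have "l dvd (V + 2*x*C)^2" unfolding x by (simp add: power2_eq_square)
  ultimately have "l dvd 4*C*(A + x*V + x^2*C)" using g(2) by simp
  then have 1: "l dvd A + x*V + x^2*C" using l l4 by (meson prime_dvd_mult_iff)
  have "4*C*(B + y*U + y^2*C) = (4*B*C - U^2) + (U + 2*y*C)^2"
    by (simp add: algebra_simps power2_eq_square)
  moreover have "l dvd (U + 2*y*C)^2" unfolding x by (simp add: power2_eq_square)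
  ultimately have "l dvd 4*C*(B + y*U + y^2*C)" using g(1) by simp
  then have 2: "l dvd B + y*U + y^2*C" using l l4 by (meson prime_dvd_mult_iff)
  have "2*C*(W + x*U + y*(V + 2*x*C)) = (U + 2*y*C)*(V + 2*x*C) - (U*V - 2*C*W)"
    by (simp add: algebra_simps power2_eq_square)
  moreover have "l dvd (U + 2*y*C)*(V + 2*x*C)" unfolding x by simp
  ultimately have "l dvd 2*C*(W + x*U + y*(V + 2*x*C))" using g(3) by simp
  then have 3: "l dvd W + x*U + y*(V + 2*x*C)" using l \<open>\<not> l dvd 2 * C\<close> by (meson prime_dvd_mult_iff)
  show False using formN_no_div3[OF F' m l 1 2 3] .
qed

text \<open>Let G be the Gram matrix. Since G adj(G) = 2N, every column of the adjugate is a radical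
  vector modulo l, and f takes a multiple of N as its value there. Either one of the columns is
  nonzero modulo l, or G has rank at most one modulo l, which contradicts maximality.\<close>

lemma local_form1:
  fixes l :: int
  assumes F: "formN a b R N A B C U V W" and m: "maximal_order a b R" and l: "prime l" and N: "l dvd N"
  shows "\<exists>A B C U V W. formN a b R N A B C U V W \<and> l dvd A \<and> l dvd V \<and> l dvd W"
proof -
  let ?g11 = "4*B*C - U^2" and ?g22 = "4*A*C - V^2" and ?g33 = "4*A*B - W^2"
    and ?g12 = "U*V - 2*C*W" and ?g13 = "U*W - 2*B*V" and ?g23 = "V*W - 2*A*U"
  have N': "N = 4*A*B*C + U*V*W - A*U^2 - B*V^2 - C*W^2" using F by (simp add: formN_def hdisc_def)
  have c1: "2*A*?g11 + W*?g12 + V*?g13 = N * 2" "W*?g11 + 2*B*?g12 + U*?g13 = 0"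
    "V*?g11 + U*?g12 + 2*C*?g13 = 0"
    "A*?g11^2 + B*?g12^2 + C*?g13^2 + U*?g12*?g13 + V*?g11*?g13 + W*?g11*?g12 = N * ?g11"
    unfolding N' by (simp_all add: algebra_simps power2_eq_square)
  have c2: "2*A*?g12 + W*?g22 + V*?g23 = 0" "W*?g12 + 2*B*?g22 + U*?g23 = N * 2"
    "V*?g12 + U*?g22 + 2*C*?g23 = 0"
    "A*?g12^2 + B*?g22^2 + C*?g23^2 + U*?g22*?g23 + V*?g12*?g23 + W*?g12*?g22 = N * ?g22"
    unfolding N' by (simp_all add: algebra_simps power2_eq_square)
  have c3: "2*A*?g13 + W*?g23 + V*?g33 = 0" "W*?g13 + 2*B*?g23 + U*?g33 = 0"
    "V*?g13 + U*?g23 + 2*C*?g33 = N * 2"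
    "A*?g13^2 + B*?g23^2 + C*?g33^2 + U*?g23*?g33 + V*?g13*?g33 + W*?g13*?g23 = N * ?g33"
    unfolding N' by (simp_all add: algebra_simps power2_eq_square)
  show ?thesis
  proof (cases "l dvd ?g11 \<and> l dvd ?g22 \<and> l dvd ?g33 \<and> l dvd ?g12 \<and> l dvd ?g13 \<and> l dvd ?g23")
    case False
    then show ?thesis
      using radical_vector[OF F l, of ?g11 ?g12 ?g13, unfolded c1]
        radical_vector[OF F l, of ?g12 ?g22 ?g23, unfolded c2]
        radical_vector[OF F l, of ?g13 ?g23 ?g33, unfolded c3] dvd_mult2[OF N] dvd_0_right by blast
  next
    case True
    have False
    proof (cases "l dvd A \<and> l dvd B \<and> l dvd C")
      case t: True
      \<comment> \<open>With the diagonal divisible by l, the minor 4AB - W^2 forces l to divide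
        W.\<close>
      then have "l dvd 4*A*B - (4*A*B - W^2)" using True by (metis dvd_diff dvd_mult dvd_mult2)
      then have "l dvd W" using l prime_dvd_power by (simp add: prime_dvd_power_iff)
      then show False using formN_no_div3[OF F m l] t by blast
    next
      case False
      then consider "\<not> l dvd C" | "\<not> l dvd A" | "\<not> l dvd B" by blast
      then show False
      proof cases
        case 1 then show False using rank_one_impossible[OF F m l] True by blast
      next
        case 2 then show False using rank_one_impossible[OF formN_cyc[OF F] m l] True
          by (simp add: mult.commute mult.left_commute)
      next
        case 3 then show False using rank_one_impossible[OF formN_cyc[OF formN_cyc[OF F]] m l] True
          by (simp add: mult.commute mult.left_commute)
      qed
    qed
    then show ?thesis ..
  qed
qed

text \<open>Both additional properties come from maximality. If l^2 divided A, then f(x / l, y, z)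
  would be integral. A zero of the binary part modulo l could be made a basis vector; its
  coefficient and A would then both be divisible by l, which permits the division of f by l after
  scaling the third variable.\<close>

lemma local_form:
  fixes l :: int
  assumes F: "formN a b R N A B C U V W" and m: "maximal_order a b R" and l: "prime l" and N: "l dvd N"
  obtains A B C U V W where "formN a b R N A B C U V W" "l dvd A" "l dvd V" "l dvd W" "\<not> l^2 dvd A"
    "\<And>y z. l dvd B*y^2 + U*y*z + C*z^2 \<Longrightarrow> l dvd y \<and> l dvd z"
proof -
  from local_form1[OF assms] obtain A B C U V W where F: "formN a b R N A B C U V W"
    and d: "l dvd A" "l dvd V" "l dvd W" by blast
  have "\<not> l^2 dvd A"
    using maximal_order_no_div23[OF _ m prime_gt_1_int[OF l], of A B C U V W] F d
    unfolding formN_def by blast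
  moreover have "l dvd y \<and> l dvd z" if i: "l dvd B*y^2 + U*y*z + C*z^2" for y z
  proof (rule ccontr)
    assume n: "\<not> (l dvd y \<and> l dvd z)"
    show False
    proof (cases "l dvd y")
      case False
      obtain s q where s: "s * y = 1 + l * q" using prime_inverse_mod[OF l False] .
      define t where "t = s * z"
      have t: "y * t = z + l * (q * z)"
        using arg_cong[OF s, of "\<lambda>t. t * z"] by (simp add: t_def algebra_simps)
      have "y^2 * (B + t*U + t^2*C) = B*y^2 + U*y*(y*t) + C*(y*t)^2"
        by (simp add: algebra_simps power2_eq_square)
      also have "\<dots> = (B*y^2 + U*y*z + C*z^2) + l * (U*y*(q*z) + C*(2*z*(q*z) + l*(q*z)^2))"
        unfolding t by (simp add: algebra_simps power2_eq_square)
      finally have "l dvd y^2 * (B + t*U + t^2*C)" using i by simp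
      then have "l dvd B + t*U + t^2*C"
        using l False by (meson prime_dvd_mult_iff prime_dvd_power)
      moreover have "l dvd W + t*V" using d by simp
      ultimately show False using formN_no_div3[OF formN_shear32[OF F, of t] m l] d by blast
    next
      case True
      then have "l dvd B*y^2 + U*y*z" by (simp add: power2_eq_square)
      then have "l dvd C*z^2" using i by (metis dvd_add_right_iff)
      then have "l dvd C" using n True l by (meson prime_dvd_mult_iff prime_dvd_power)
      then show False using formN_no_div3[OF formN_cyc[OF formN_cyc[OF F]] m l] d by blast
    qed
  qed
  ultimately show ?thesis using that F d by blast
qed

text \<open>This is anisotropy over the l-adic numbers. Modulo l the binary part forces l to divide
  y and z. Then modulo l^2 only A x^2 remains, and A has exactly one factor l, so l divides x.
  Dividing the equation by l^2 repeats the argument.\<close>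

lemma aniso_descent:
  fixes l :: int
  assumes l: "prime l" and d: "l dvd A" "l dvd V" "l dvd W" "\<not> l^2 dvd A"
    and an: "\<And>y z. l dvd B*y^2 + U*y*z + C*z^2 \<Longrightarrow> l dvd y \<and> l dvd z"
    and f: "l^(2*m) dvd A*x^2 + B*y^2 + C*z^2 + U*y*z + V*x*z + W*x*y"
  shows "l^m dvd x \<and> l^m dvd y \<and> l^m dvd z"
  using f
proof (induction m arbitrary: x y z)
  case 0 then show ?case by simp
next
  case (Suc m)
  let ?f = "\<lambda>x y z. A*x^2 + B*y^2 + C*z^2 + U*y*z + V*x*z + W*x*y"
  from d obtain A' V' W' where e: "A = l*A'" "V = l*V'" "W = l*W'" by (elim dvdE)
  have A': "\<not> l dvd A'" using d(4) e(1) by (simp add: power2_eq_square)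
  have l0: "l \<noteq> 0" using l by auto
  have "l^2 * l^(2*m) dvd ?f x y z" using Suc.prems by (simp add: power_add power2_eq_square mult.assoc)
  then have l2: "l^2 dvd ?f x y z" using dvd_mult_left by blast
  then have "l dvd ?f x y z" by (metis dvd_mult_left power2_eq_square)
  moreover have "?f x y z = (B*y^2 + U*y*z + C*z^2) + l*(A'*x^2 + V'*x*z + W'*x*y)"
    by (simp add: e algebra_simps)
  ultimately have "l dvd B*y^2 + U*y*z + C*z^2" by (simp add: dvd_add_left_iff)
  then obtain y' z' where yz: "y = l*y'" "z = l*z'" using an by (metis dvdE)
  have "?f x y z = l * (A'*x^2) + l^2 * (B*y'^2 + U*y'*z' + C*z'^2 + V'*x*z' + W'*x*y')"
    by (simp add: e yz algebra_simps power2_eq_square)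
  with l2 have "l^2 dvd l * (A'*x^2)" by (simp add: dvd_add_left_iff)
  then have "l dvd A'*x^2" using l0 by (simp add: power2_eq_square)
  then have "l dvd x" using l A' by (meson prime_dvd_mult_iff prime_dvd_power)
  then obtain x' where x: "x = l*x'" by (elim dvdE)
  have "?f x y z = l^2 * ?f x' y' z'" by (simp add: x yz algebra_simps power2_eq_square)
  then have "l^2 * l^(2*m) dvd l^2 * ?f x' y' z'"
    using \<open>l^2 * l^(2*m) dvd ?f x y z\<close> by simp
  then have "l^(2*m) dvd ?f x' y' z'" using l0 by simp
  from Suc.IH[OF this] show ?case by (simp add: x yz)
qed

text \<open>Modulo l^2 the half-discriminant is A (4BC - U^2). The first factor contains l exactly
  once, the second not at all, since a binary form anisotropic modulo l is nondegenerate
  there.\<close>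

lemma aniso_disc:
  fixes l :: int
  assumes l: "prime l" and d: "l dvd A" "l dvd V" "l dvd W" "\<not> l^2 dvd A"
    and an: "\<And>y z. l dvd B*y^2 + U*y*z + C*z^2 \<Longrightarrow> l dvd y \<and> l dvd z"
  shows "\<not> l^2 dvd hdisc A B C U V W"
proof
  assume h: "l^2 dvd hdisc A B C U V W"
  from d obtain A' V' W' where e: "A = l*A'" "V = l*V'" "W = l*W'" by (elim dvdE)
  have A': "\<not> l dvd A'" using d(4) e(1) by (simp add: power2_eq_square)
  have l0: "l \<noteq> 0" using l by auto
  have "hdisc A B C U V W = l * (A'*(4*B*C - U^2)) + l^2 * (U*V'*W' - B*V'^2 - C*W'^2)"
    by (simp add: e hdisc_def algebra_simps power2_eq_square)
  with h have "l^2 dvd l * (A'*(4*B*C - U^2))" by (simp add: dvd_add_left_iff)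
  then have "l dvd A'*(4*B*C - U^2)" using l0 by (simp add: power2_eq_square)
  then have g: "l dvd 4*B*C - U^2" using l A' by (meson prime_dvd_mult_iff)
  have n1: "\<not> l dvd 1" using l by auto
  have C: "\<not> l dvd C" using an[of 0 1] n1 by auto
  have B: "\<not> l dvd B" using an[of 1 0] n1 by auto
  show False
  proof (cases "l = 2")
    case True
    \<comment> \<open>With U even and B, C odd, the vector (1, 1) is a zero modulo 2.\<close>
    then have "even U" using g by simp
    then show False using an[of 1 1] B C True by auto
  next
    case False
    then have l2: "\<not> l dvd 2" using l primes_dvd_imp_eq[of l 2] by auto
    \<comment> \<open>(2C, -U) is the radical vector of the binary part when its discriminant
      vanishes modulo l.\<close>
    have "B*(2*C)^2 + U*(2*C)*(-U) + C*(-U)^2 = C * (4*B*C - U^2)"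
      by (simp add: algebra_simps power2_eq_square)
    then have "l dvd B*(2*C)^2 + U*(2*C)*(-U) + C*(-U)^2" using g by simp
    from an[OF this] have "l dvd 2*C" by blast
    then show False using l2 C l by (meson prime_dvd_mult_iff)
  qed
qed

section \<open>Pure quaternions: determinants, norms and denominators\<close>

definition det3 :: "qel \<Rightarrow> qel \<Rightarrow> qel \<Rightarrow> rat" where
  "det3 u v w = c1 u * (c2 v * c3 w - c3 v * c2 w) - c2 u * (c1 v * c3 w - c3 v * c1 w)
     + c3 u * (c1 v * c2 w - c2 v * c1 w)"

lemma cramer:
  assumes p: "c0 u = 0" "c0 v = 0" "c0 w = 0" "c0 x = 0" and d: "det3 u v w \<noteq> 0"
  shows "x = lin3 u v w (det3 x v w / det3 u v w) (det3 u x w / det3 u v w) (det3 u v x / det3 u v w)"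
proof -
  have "lin3 u v w (det3 x v w) (det3 u x w) (det3 u v x) = qsmult (det3 u v w) x"
    using p by (simp add: lin3_def lin_def qsmult_def det3_def) (simp add: algebra_simps)
  moreover have "lin3 u v w (det3 x v w / det3 u v w) (det3 u x w / det3 u v w) (det3 u v x / det3 u v w)
      = qsmult (1 / det3 u v w) (lin3 u v w (det3 x v w) (det3 u x w) (det3 u v x))"
    by (simp add: lin3_def lin_def qsmult_def add_divide_distrib)
  ultimately have "lin3 u v w (det3 x v w / det3 u v w) (det3 u x w / det3 u v w) (det3 u v x / det3 u v w)
      = qsmult (1 / det3 u v w) (qsmult (det3 u v w) x)" by simp
  also have "\<dots> = x" using d by (cases x) (simp add: qsmult_def)
  finally show ?thesis by simp
qed

lemma c0_triple:
  "c0 u = 0 \<Longrightarrow> c0 v = 0 \<Longrightarrow> c0 w = 0 \<Longrightarrow>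
     c0 (qmul a b u (qmul a b v w)) = - (of_int a * of_int b * det3 u v w)"
  by (simp add: qmul_def det3_def Let_def algebra_simps)

lemma nrd_pure: "c0 x = 0 \<Longrightarrow> qnrd a b x = - c0 (qmul a b x x)"
  by (simp add: qnrd_def qmul_def qconj_def Let_def)

lemma nrd_coords:
  "qnrd a b x = (c0 x)^2 - of_int a * (c1 x)^2 - of_int b * (c2 x)^2 + of_int a * of_int b * (c3 x)^2"
  by (simp add: qnrd_def qmul_def qconj_def Let_def power2_eq_square)

lemma inner_coords:
  "qinner a b x y = c0 x * c0 y - of_int a * c1 x * c1 y - of_int b * c2 x * c2 y
     + of_int a * of_int b * c3 x * c3 y"
  by (simp add: qinner_def qtrd_def qadd_def qmul_def qconj_def Let_def)

lemma lin3_lin: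
  "lin3 (lin e1 e2 e3 p0 p1 p2 p3) (lin e1 e2 e3 q0 q1 q2 q3) (lin e1 e2 e3 r0 r1 r2 r3) x1 x2 x3 =
     lin e1 e2 e3 (x1*p0 + x2*q0 + x3*r0) (x1*p1 + x2*q1 + x3*r1)
       (x1*p2 + x2*q2 + x3*r2) (x1*p3 + x2*q3 + x3*r3)"
  by (simp add: lin3_def lin_lin)

text \<open>These three elements are 2 e - trd e for e = e1, e2, e3, the generators of the Gross
  lattice.\<close>

lemma ftab_traceless:
  assumes "ftab a b e1 e2 e3 A B C U V W"
  shows "c0 (lin e1 e2 e3 (-U) 2 0 0) = 0" "c0 (lin e1 e2 e3 (-V) 0 2 0) = 0"
    "c0 (lin e1 e2 e3 (-W) 0 0 2) = 0"
  unfolding c0_lin[OF assms] by simp_all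

text \<open>Besides the volume this fixes the orientation: positive \<open>hdisc\<close> goes with
  negative a b \<open>det3\<close>.\<close>

lemma ftab_det3:
  assumes t: "ftab a b e1 e2 e3 A B C U V W"
  shows "of_int a * of_int b * det3 (lin e1 e2 e3 (-U) 2 0 0) (lin e1 e2 e3 (-V) 0 2 0) (lin e1 e2 e3 (-W) 0 0 2)
     = - 2 * hdisc A B C U V W"
  using c0_triple[OF ftab_traceless[OF t], of a b] unfolding lin_mul[OF t] c0_lin[OF t]
  by (simp add: hdisc_def algebra_simps power2_eq_square add_divide_distrib diff_divide_distrib)

text \<open>The coefficients are the entries of the adjugate of the Gram matrix of the form.\<close>

lemma ftab_nrd:
  assumes t: "ftab a b e1 e2 e3 A B C U V W"
  shows "qnrd a b (lin3 (lin e1 e2 e3 (-U) 2 0 0) (lin e1 e2 e3 (-V) 0 2 0) (lin e1 e2 e3 (-W) 0 0 2) x y z)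
    = (4*B*C - U^2)*x^2 + (4*A*C - V^2)*y^2 + (4*A*B - W^2)*z^2
      + 2*(V*W - 2*A*U)*y*z + 2*(U*W - 2*B*V)*x*z + 2*(U*V - 2*C*W)*x*y"
proof -
  have "c0 (lin3 (lin e1 e2 e3 (-U) 2 0 0) (lin e1 e2 e3 (-V) 0 2 0) (lin e1 e2 e3 (-W) 0 0 2) x y z) = 0"
    unfolding lin3_lin c0_lin[OF t] by (simp add: add_divide_distrib)
  from nrd_pure[OF this, of a b] show ?thesis
    unfolding lin3_lin lin_mul[OF t] c0_lin[OF t]
    by (simp add: algebra_simps add_divide_distrib diff_divide_distrib power2_eq_square)
qed

lemma common_denominator:
  fixes xs :: "rat list" shows "\<exists>M::int. M > 0 \<and> (\<forall>x\<in>set xs. of_int M * x \<in> \<int>)"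
proof (induction xs)
  case Nil show ?case by (auto intro: exI[of _ 1])
next
  case (Cons x xs)
  then obtain M :: int where M: "M > 0" "\<forall>x\<in>set xs. of_int M * x \<in> \<int>" by blast
  obtain p q where "quotient_of x = (p, q)" by fastforce
  then have q: "q > 0" "x = of_int p / of_int q"
    using quotient_of_denom_pos quotient_of_div by auto
  have x: "of_int (M * q) * x = of_int (M * p)" using q by simp
  have "of_int (M * q) * x \<in> \<int>" unfolding x by (rule Ints_of_int)
  moreover have "of_int (M * q) * y \<in> \<int>" if "y \<in> set xs" for y
  proof -
    have "of_int (M * q) * y = of_int q * (of_int M * y)" by simp
    also have "\<dots> \<in> \<int>" using Ints_mult[OF Ints_of_int M(2)[rule_format, OF that]] .
    finally show ?thesis .
  qed
  ultimately have "\<forall>y\<in>set (x # xs). of_int (M * q) * y \<in> \<int>" unfolding list.set by blast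
  moreover have "M * q > 0" using M(1) q(1) by simp
  ultimately show ?case by blast
qed

lemma common_denominator9:
  fixes x1 x2 x3 y1 y2 y3 z1 z2 z3 :: rat
  obtains M i1 i2 i3 j1 j2 j3 k1 k2 k3 :: int where "M > 0"
    "of_int M * x1 = of_int i1" "of_int M * x2 = of_int i2" "of_int M * x3 = of_int i3"
    "of_int M * y1 = of_int j1" "of_int M * y2 = of_int j2" "of_int M * y3 = of_int j3"
    "of_int M * z1 = of_int k1" "of_int M * z2 = of_int k2" "of_int M * z3 = of_int k3"
proof -
  obtain M :: int where M: "M > 0" "\<forall>x\<in>set [x1,x2,x3,y1,y2,y3,z1,z2,z3]. of_int M * x \<in> \<int>"
    using common_denominator by blast
  then have "of_int M * x1 \<in> \<int>" "of_int M * x2 \<in> \<int>" "of_int M * x3 \<in> \<int>" "of_int M * y1 \<in> \<int>"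
    "of_int M * y2 \<in> \<int>" "of_int M * y3 \<in> \<int>" "of_int M * z1 \<in> \<int>" "of_int M * z2 \<in> \<int>" "of_int M * z3 \<in> \<int>"
    by simp_all
  then show ?thesis by (elim Ints_cases) (rule that[OF M(1)])
qed

lemma power_not_dvd:
  fixes l Q :: int assumes "l > 1" "Q \<noteq> 0" obtains m where "\<not> l^m dvd Q"
proof -
  let ?m = "nat \<bar>Q\<bar>"
  have "\<bar>Q\<bar> < 2 ^ ?m" using of_nat_less_two_power[of ?m, where 'a=int] by simp
  also have "\<dots> \<le> l ^ ?m" using assms by (intro power_mono) auto
  finally have "\<not> l ^ ?m dvd Q" using dvd_imp_le_int[OF assms(2), of "l ^ ?m"] by linarith
  then show ?thesis using that by blast
qed

lemma prime_power_dvd_cancel: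
  fixes l :: int assumes "prime l" "l^m dvd Q * x" "l^m dvd Q * y" "l^m dvd Q * z"
    "\<not> (l dvd x \<and> l dvd y \<and> l dvd z)"
  shows "l^m dvd Q"
proof -
  have *: "l^m dvd Q" if "\<not> l dvd t" "l^m dvd Q * t" for t
  proof -
    have "coprime (l^m) t" using prime_imp_coprime[OF assms(1) that(1)] by simp
    then show ?thesis using that(2) coprime_dvd_mult_left_iff[of "l^m" t Q] by simp
  qed
  then show ?thesis using assms by blast
qed

text \<open>A solution of a x^2 + b y^2 = z^2 modulo l^(2m) yields the pure quaternion b y i + a x j
  + z k of norm -a b (a x^2 + b y^2 - z^2). In coordinates of the Gross lattice the norm is the
  adjugate form, and the adjugate matrix maps the coordinate vector to some X with f(X) equal to N
  times the norm. The descent makes X divisible by l^m, hence also x, y and z up to a factor Q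
  independent of m.\<close>

lemma aniso_not_hilbert:
  fixes l :: nat
  assumes F: "formN a b R N A B C U V W" and ab: "a \<noteq> 0" "b \<noteq> 0" and l: "prime l"
    and d: "int l dvd A" "int l dvd V" "int l dvd W" "\<not> (int l)^2 dvd A"
    and an: "\<And>y z. int l dvd B*y^2 + U*y*z + C*z^2 \<Longrightarrow> int l dvd y \<and> int l dvd z"
  shows "\<not> hilbert_trivial_at l a b"
proof
  assume H: "hilbert_trivial_at l a b"
  have l': "prime (int l)" using l by simp
  from F obtain e1 e2 e3 where
    t: "ftab a b e1 e2 e3 (of_int A) (of_int B) (of_int C) (of_int U) (of_int V) (of_int W)"
    and N: "N = hdisc A B C U V W" "N > 0"
    unfolding formN_def has_form_def by blast
  define v1 v2 v3 where "v1 = lin e1 e2 e3 (- of_int U) 2 0 0" and "v2 = lin e1 e2 e3 (- of_int V) 0 2 0"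
    and "v3 = lin e1 e2 e3 (- of_int W) 0 0 2"
  note v = ftab_traceless[OF t, folded v1_def v2_def v3_def]
  have "det3 v1 v2 v3 \<noteq> 0"
    using ftab_det3[OF t] N by (auto simp: hdisc_of_int v1_def v2_def v3_def)
  note cr = cramer[OF v _ this]
  obtain r11 r12 r13 where r1: "QE 0 1 0 0 = lin3 v1 v2 v3 r11 r12 r13" using cr[of "QE 0 1 0 0"] by auto
  obtain r21 r22 r23 where r2: "QE 0 0 1 0 = lin3 v1 v2 v3 r21 r22 r23" using cr[of "QE 0 0 1 0"] by auto
  obtain r31 r32 r33 where r3: "QE 0 0 0 1 = lin3 v1 v2 v3 r31 r32 r33" using cr[of "QE 0 0 0 1"] by auto
  \<comment> \<open>M clears the denominators of i, j, k in the basis \<open>v1\<close>,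
    \<open>v2\<close>, \<open>v3\<close>; K below clears those of \<open>v1\<close>,
    \<open>v2\<close>, \<open>v3\<close> in i, j, k.\<close>
  obtain M s11 s12 s13 s21 s22 s23 s31 s32 s33 :: int where M: "M > 0"
    "of_int M * r11 = of_int s11" "of_int M * r12 = of_int s12" "of_int M * r13 = of_int s13"
    "of_int M * r21 = of_int s21" "of_int M * r22 = of_int s22" "of_int M * r23 = of_int s23"
    "of_int M * r31 = of_int s31" "of_int M * r32 = of_int s32" "of_int M * r33 = of_int s33"
    by (rule common_denominator9)
  obtain K k11 k12 k13 k21 k22 k23 k31 k32 k33 :: int where K: "K > 0"
    "of_int K * c1 v1 = of_int k11" "of_int K * c2 v1 = of_int k12" "of_int K * c3 v1 = of_int k13"
    "of_int K * c1 v2 = of_int k21" "of_int K * c2 v2 = of_int k22" "of_int K * c3 v2 = of_int k23"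
    "of_int K * c1 v3 = of_int k31" "of_int K * c2 v3 = of_int k32" "of_int K * c3 v3 = of_int k33"
    by (rule common_denominator9)
  \<comment> \<open>Q collects all constants lost on the way. It is fixed before the approximate
    solution is taken, so m can be chosen such that l^m does not divide it. The descent halves
    exponents, which is why the solution is taken modulo l^(2m).\<close>
  define Q where "Q = 2*N*K*M*a*b"
  have "Q \<noteq> 0" using N K(1) M(1) ab by (simp add: Q_def)
  then obtain m where m: "\<not> (int l)^m dvd Q" using power_not_dvd prime_gt_1_int[OF l'] by blast
  from H obtain x y z :: int where xyz: "\<not> (int l dvd x \<and> int l dvd y \<and> int l dvd z)"
    "(int l)^(2*m) dvd a*x^2 + b*y^2 - z^2" unfolding hilbert_trivial_at_def by blast
  define n1 n2 n3 where "n1 = b*y * s11 + a*x * s21 + z * s31" and "n2 = b*y * s12 + a*x * s22 + z * s32"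
    and "n3 = b*y * s13 + a*x * s23 + z * s33"
  have w: "lin3 v1 v2 v3 (of_int n1) (of_int n2) (of_int n3)
      = QE 0 (of_int (M*b*y)) (of_int (M*a*x)) (of_int (M*z))"
  proof -
    have "lin3 v1 v2 v3 (of_int n1) (of_int n2) (of_int n3) =
      qadd (qadd (qsmult (of_int (M*b*y)) (lin3 v1 v2 v3 r11 r12 r13))
        (qsmult (of_int (M*a*x)) (lin3 v1 v2 v3 r21 r22 r23)))
        (qsmult (of_int (M*z)) (lin3 v1 v2 v3 r31 r32 r33))"
      unfolding n1_def n2_def n3_def
      by (simp add: M(2-)[symmetric] lin3_def lin_def qadd_def qsmult_def algebra_simps)
    then show ?thesis unfolding r1[symmetric] r2[symmetric] r3[symmetric]
      by (simp add: qadd_def qsmult_def)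
  qed
  let ?G = "(4*B*C - U^2)*n1^2 + (4*A*C - V^2)*n2^2 + (4*A*B - W^2)*n3^2
      + 2*(V*W - 2*A*U)*n2*n3 + 2*(U*W - 2*B*V)*n1*n3 + 2*(U*V - 2*C*W)*n1*n2"
  have "(of_int ?G::rat) = qnrd a b (lin3 v1 v2 v3 (of_int n1) (of_int n2) (of_int n3))"
    unfolding v1_def v2_def v3_def ftab_nrd[OF t] by simp
  also have "\<dots> = of_int (-a*b*M^2*(a*x^2+b*y^2-z^2))"
    unfolding w nrd_coords by (simp add: algebra_simps power2_eq_square)
  finally have G: "?G = -a*b*M^2*(a*x^2+b*y^2-z^2)" unfolding of_int_eq_iff .
  \<comment> \<open>X is the adjugate matrix applied to n; the Gram matrix then carries X back to 2N
    n.\<close>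
  define X1 X2 X3 where "X1 = (4*B*C - U^2)*n1 + (U*V - 2*C*W)*n2 + (U*W - 2*B*V)*n3"
    and "X2 = (U*V - 2*C*W)*n1 + (4*A*C - V^2)*n2 + (V*W - 2*A*U)*n3"
    and "X3 = (U*W - 2*B*V)*n1 + (V*W - 2*A*U)*n2 + (4*A*B - W^2)*n3"
  have "A*X1^2 + B*X2^2 + C*X3^2 + U*X2*X3 + V*X1*X3 + W*X1*X2 = N * ?G"
    unfolding N hdisc_def X1_def X2_def X3_def by (simp add: algebra_simps power2_eq_square)
  then have "(int l)^(2*m) dvd A*X1^2 + B*X2^2 + C*X3^2 + U*X2*X3 + V*X1*X3 + W*X1*X2"
    unfolding G using xyz(2) by simp
  from aniso_descent[OF l' d an this]
  have X: "int l^m dvd X1" "int l^m dvd X2" "int l^m dvd X3" by blast+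
  have "2*N*n1 = 2*A*X1 + W*X2 + V*X3" "2*N*n2 = W*X1 + 2*B*X2 + U*X3" "2*N*n3 = V*X1 + U*X2 + 2*C*X3"
    unfolding N hdisc_def X1_def X2_def X3_def by (simp_all add: algebra_simps power2_eq_square)
  then have n: "int l^m dvd 2*N*n1" "int l^m dvd 2*N*n2" "int l^m dvd 2*N*n3"
    using X by simp_all
  have "rat_of_int (K*(M*b*y)) = of_int (n1*k11 + n2*k21 + n3*k31)"
    "rat_of_int (K*(M*a*x)) = of_int (n1*k12 + n2*k22 + n3*k32)"
    "rat_of_int (K*(M*z)) = of_int (n1*k13 + n2*k23 + n3*k33)"
    using arg_cong[OF w, of "\<lambda>t. of_int K * c1 t"] arg_cong[OF w, of "\<lambda>t. of_int K * c2 t"]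
      arg_cong[OF w, of "\<lambda>t. of_int K * c3 t"]
    by (simp_all add: K(2-)[symmetric] lin3_def lin_def algebra_simps)
  then have k: "K*(M*b*y) = n1*k11 + n2*k21 + n3*k31" "K*(M*a*x) = n1*k12 + n2*k22 + n3*k32"
    "K*(M*z) = n1*k13 + n2*k23 + n3*k33" unfolding of_int_eq_iff by blast+
  have "Q * y = a * (k11 * (2*N*n1) + k21 * (2*N*n2) + k31 * (2*N*n3))"
    using arg_cong[OF k(1), of "\<lambda>t. 2*N*a*t"] by (simp add: Q_def algebra_simps)
  moreover have "Q * x = b * (k12 * (2*N*n1) + k22 * (2*N*n2) + k32 * (2*N*n3))"
    using arg_cong[OF k(2), of "\<lambda>t. 2*N*b*t"] by (simp add: Q_def algebra_simps)
  moreover have "Q * z = a * b * (k13 * (2*N*n1) + k23 * (2*N*n2) + k33 * (2*N*n3))"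
    using arg_cong[OF k(3), of "\<lambda>t. 2*N*a*b*t"] by (simp add: Q_def algebra_simps)
  ultimately have "int l^m dvd Q*x" "int l^m dvd Q*y" "int l^m dvd Q*z"
    using n by (simp_all add: dvd_add dvd_mult)
  then show False using prime_power_dvd_cancel[OF l' _ _ _ xyz(1)] m by blast
qed

section \<open>Spanning tree sums of small weight\<close>

lemma nat_cases_012: "P 0 \<Longrightarrow> P 1 \<Longrightarrow> (\<And>k. P (k + 2)) \<Longrightarrow> P (n::nat)"
  by (metis One_nat_def add_2_eq_Suc' not0_implies_Suc)

text \<open>The cubic sum runs over the sixteen spanning trees of the complete graph on four
  vertices, where \<open>x1\<close> and \<open>y1\<close>, \<open>x2\<close> and \<open>y2\<close>,
  \<open>x3\<close> and \<open>y3\<close> weight opposite edges. The seven positivity conditions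
  concern its seven cuts, and the parities come from even diagonal entries of a Gram matrix.
  Splitting every weight into 0, 1 and k + 2 leaves 729 elementary cases.\<close>

lemma tree_bound:
  fixes x1 x2 x3 y1 y2 y3 :: nat
  shows "even (x2+x3+y1) \<longrightarrow> even (x1+x3+y2) \<longrightarrow> even (x1+x2+y3) \<longrightarrow> 
    x2+x3+y1 > 0 \<longrightarrow> x1+x3+y2 > 0 \<longrightarrow> x1+x2+y3 > 0 \<longrightarrow> y1+y2+y3 > 0 \<longrightarrow>
    x1+y1+x2+y2 > 0 \<longrightarrow> x1+y1+x3+y3 > 0 \<longrightarrow> x2+y2+x3+y3 > 0 \<longrightarrow> 
   x1*x2*y3+x1*x3*y2+x2*x3*y1+y1*y2*y3 + x1*y1*(x2+y2+x3+y3)+x2*y2*(x1+y1+x3+y3)+x3*y3*(x1+y1+x2+y2) > 4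
   \<or> x1*x2*y3+x1*x3*y2+x2*x3*y1+y1*y2*y3 + x1*y1*(x2+y2+x3+y3)+x2*y2*(x1+y1+x3+y3)+x3*y3*(x1+y1+x2+y2) = 4 \<and>
   ((x1,y1,x2,y2,x3,y3) = (0,0,1,1,1,1) \<or> (x1,y1,x2,y2,x3,y3) = (1,1,0,0,1,1) \<or> (x1,y1,x2,y2,x3,y3) = (1,1,1,1,0,0))"
  apply (rule nat_cases_012[of _ x1]; rule nat_cases_012[of _ y1]; rule nat_cases_012[of _ x2]; 
    rule nat_cases_012[of _ y2]; rule nat_cases_012[of _ x3]; rule nat_cases_012[of _ y3])
  apply (simp_all add: algebra_simps)
  done

section \<open>Selling reduction\<close>

lemma nrd_pos:
  assumes "a < 0" "b < 0" "x \<noteq> qzero" shows "qnrd a b x > 0"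
proof (rule ccontr)
  assume n: "\<not> qnrd a b x > 0"
  have p: "of_int a < (0::rat)" "of_int b < (0::rat)" using assms by simp_all
  have "(c0 x)^2 \<ge> 0" "- of_int a * (c1 x)^2 \<ge> 0" "- of_int b * (c2 x)^2 \<ge> 0"
    "of_int a * of_int b * (c3 x)^2 \<ge> 0"
    using p by (simp_all add: mult_nonpos_nonneg mult_nonpos_nonpos)
  with n have "(c0 x)^2 = 0" "- of_int a * (c1 x)^2 = 0" "- of_int b * (c2 x)^2 = 0"
    "of_int a * of_int b * (c3 x)^2 = 0"
    unfolding nrd_coords by linarith+
  then have "x = qzero" using p by (cases x) (simp add: qzero_def)
  then show False using assms(3) by simp
qed

text \<open>The vector of the Gross lattice whose coordinates are the first row of the Gram matrix G
  has norm 4NA, because G adj(G) G = 2N G. Norms and N are positive.\<close>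

lemma formN_pos:
  assumes ab: "a < 0" "b < 0" and F: "formN a b R N A B C U V W" shows "A > 0"
proof -
  from F obtain e1 e2 e3 where
    t: "ftab a b e1 e2 e3 (of_int A) (of_int B) (of_int C) (of_int U) (of_int V) (of_int W)"
    and N: "N = hdisc A B C U V W" "N > 0"
    unfolding formN_def has_form_def by blast
  define v1 v2 v3 where "v1 = lin e1 e2 e3 (- of_int U) 2 0 0" and "v2 = lin e1 e2 e3 (- of_int V) 0 2 0"
    and "v3 = lin e1 e2 e3 (- of_int W) 0 0 2"
  let ?x = "lin3 v1 v2 v3 (of_int (2*A)) (of_int W) (of_int V)"
  have N': "hdisc (of_int A) (of_int B) (of_int C) (of_int U) (of_int V) (of_int W) \<noteq> (0::rat)"
    using N by (simp add: hdisc_of_int)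
  have "?x \<noteq> qzero"
  proof
    assume "?x = qzero"
    from ftab_indep[OF t N' this[unfolded v1_def v2_def v3_def lin3_lin]] have "A = 0" "V = 0" "W = 0"
      by simp_all
    then show False using N by (simp add: hdisc_def)
  qed
  then have "qnrd a b ?x > 0" by (rule nrd_pos[OF ab])
  also have "qnrd a b ?x = of_int (4*N*A)"
    unfolding v1_def v2_def v3_def ftab_nrd[OF t] N hdisc_def
    by (simp add: algebra_simps power2_eq_square)
  finally have "4*N*A > 0" unfolding of_int_0_less_iff .
  then show ?thesis using N(2) by (simp add: zero_less_mult_iff)
qed

text \<open>The sum of the values of f on the superbase h1, h2, h3, -(h1 + h2 + h3).\<close>

definition selling_sum :: "int \<Rightarrow> int \<Rightarrow> int \<Rightarrow> int \<Rightarrow> int \<Rightarrow> int \<Rightarrow> int" where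
  "selling_sum A B C U V W = 2*A + 2*B + 2*C + U + V + W"

text \<open>Every value of f at a nonzero vector with entries 0 and 1 becomes a leading coefficient
  after a rotation or shears.\<close>

lemma formN_values_pos:
  assumes ab: "a < 0" "b < 0" and F: "formN a b R N A B C U V W"
  shows "A > 0" "B > 0" "C > 0" "A + B + W > 0" "B + C + U > 0" "A + C + V > 0"
    "A + B + C + U + V + W > 0"
proof -
  note pos = formN_pos[OF ab]
  show "A > 0" using pos[OF F] .
  show "B > 0" using pos[OF formN_cyc[OF F]] .
  show "C > 0" using pos[OF formN_cyc[OF formN_cyc[OF F]]] .
  show "A + B + W > 0" using pos[OF formN_shear21[OF F, of 1]] by simp
  show "B + C + U > 0" using pos[OF formN_shear21[OF formN_cyc[OF F], of 1]] by simp
  show "A + C + V > 0" using pos[OF formN_shear31[OF F, of 1]] by simp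
  show "A + B + C + U + V + W > 0"
    using pos[OF formN_shear31[OF formN_shear21[OF F, of 1], of 1]] by simp
qed

text \<open>The basis -h1, h2, h3 + h1 lowers the sum by W, so W cannot be positive at a
  minimum.\<close>

lemma selling_step1:
  assumes F: "formN a b R N A B C U V W"
  shows "\<exists>A' B' C' U' V' W'. formN a b R N A' B' C' U' V' W' \<and>
    selling_sum A' B' C' U' V' W' = selling_sum A B C U V W - W"
  using formN_neg1[OF formN_shear13[OF F, of 1]]
  by (intro exI conjI, assumption) (simp add: selling_sum_def)

text \<open>The basis -h1, h2 + h1, h3 + h1 does the same for h1 and the fourth vector of the
  superbase, whose pairing in the Gram matrix is -(2A + V + W).\<close>

lemma selling_step2:
  assumes F: "formN a b R N A B C U V W"
  shows "\<exists>A' B' C' U' V' W'. formN a b R N A' B' C' U' V' W' \<and>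
    selling_sum A' B' C' U' V' W' = selling_sum A B C U V W + (2*A + V + W)"
  using formN_neg1[OF formN_shear12[OF formN_shear13[OF F, of 1], of 1]]
  by (intro exI conjI, assumption) (simp add: selling_sum_def)

text \<open>A form minimising \<open>selling_sum\<close> has an obtuse superbase (Selling reduction).\<close>
lemma selling_reduced:
  assumes ab: "a < 0" "b < 0" and F: "formN a b R N A B C U V W"
  obtains A B C U V W where "formN a b R N A B C U V W" "U \<le> 0" "V \<le> 0" "W \<le> 0"
    "2*A + V + W \<ge> 0" "2*B + U + W \<ge> 0" "2*C + U + V \<ge> 0"
proof -
  define P where "P n \<longleftrightarrow> (\<exists>A B C U V W. formN a b R N A B C U V W \<and> nat (selling_sum A B C U V W) = n)" for n
  have "\<exists>n. P n" using F unfolding P_def by blast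
  then have L: "P (LEAST n. P n)" by (rule LeastI_ex)
  then obtain A B C U V W where F: "formN a b R N A B C U V W"
    and m: "nat (selling_sum A B C U V W) = (LEAST n. P n)" unfolding P_def by blast
  have min: "selling_sum A B C U V W \<le> selling_sum A' B' C' U' V' W'"
    if F': "formN a b R N A' B' C' U' V' W'" for A' B' C' U' V' W'
  proof -
    have "P (nat (selling_sum A' B' C' U' V' W'))" unfolding P_def using F' by blast
    then have "(LEAST n. P n) \<le> nat (selling_sum A' B' C' U' V' W')" by (rule Least_le)
    \<comment> \<open>The sums are positive, so comparing them as natural numbers loses
      nothing.\<close>
    then show ?thesis using m formN_values_pos[OF ab F'] by (simp add: selling_sum_def)
  qed
  have cyc: "selling_sum B C A V W U = selling_sum A B C U V W" "selling_sum C A B W U V = selling_sum A B C U V W"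
    by (simp_all add: selling_sum_def)
  note F2 = formN_cyc[OF F] and F3 = formN_cyc[OF formN_cyc[OF F]]
  have "W \<le> 0" using selling_step1[OF F] min by force
  moreover have "U \<le> 0" using selling_step1[OF F2] min unfolding cyc by force
  moreover have "V \<le> 0" using selling_step1[OF F3] min unfolding cyc by force
  moreover have "2*A + V + W \<ge> 0" using selling_step2[OF F] min by force
  moreover have "2*B + W + U \<ge> 0" using selling_step2[OF F2] min unfolding cyc by force
  moreover have "2*C + U + V \<ge> 0" using selling_step2[OF F3] min unfolding cyc by force
  ultimately show ?thesis using that F by (simp add: add_ac)
qed

text \<open>For an obtuse superbase the Gram matrix is the reduced Laplacian of the complete graph
  on four vertices with nonnegative weights. By the matrix-tree theorem its determinant 2N is the
  spanning tree sum. The three weightings with sum 4 are rotations of each other and give one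
  form.\<close>

lemma small_disc:
  assumes ab: "a < 0" "b < 0" and F: "formN a b R N A B C U V W"
  shows "N \<ge> 2" and "N = 2 \<Longrightarrow> formN a b R N 1 1 1 (-1) (-1) 0"
proof -
  obtain A B C U V W where F: "formN a b R N A B C U V W" and r: "U \<le> 0" "V \<le> 0" "W \<le> 0"
    "2*A + V + W \<ge> 0" "2*B + U + W \<ge> 0" "2*C + U + V \<ge> 0"
    using selling_reduced[OF assms] .
  define x1 x2 x3 y1 y2 y3 where "x1 = nat (-U)" and "x2 = nat (-V)" and "x3 = nat (-W)"
    and "y1 = nat (2*A+V+W)" and "y2 = nat (2*B+U+W)" and "y3 = nat (2*C+U+V)"
  have i: "U = - int x1" "V = - int x2" "W = - int x3" "2*A+V+W = int y1" "2*B+U+W = int y2"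
    "2*C+U+V = int y3"
    using r unfolding x1_def x2_def x3_def y1_def y2_def y3_def by simp_all
  note pos = formN_values_pos[OF ab F]
  \<comment> \<open>The weights of the seven cuts are twice values of f.\<close>
  have e: "int (x2+x3+y1) = 2*A" "int (x1+x3+y2) = 2*B" "int (x1+x2+y3) = 2*C"
    "int (y1+y2+y3) = 2*(A+B+C+U+V+W)" "int (x1+y1+x2+y2) = 2*(A+B+W)"
    "int (x1+y1+x3+y3) = 2*(A+C+V)" "int (x2+y2+x3+y3) = 2*(B+C+U)"
    using i by simp_all
  let ?t = "x1*x2*y3+x1*x3*y2+x2*x3*y1+y1*y2*y3 + x1*y1*(x2+y2+x3+y3)+x2*y2*(x1+y1+x3+y3)+x3*y3*(x1+y1+x2+y2)"
  have "even (int (x2+x3+y1))" "even (int (x1+x3+y2))" "even (int (x1+x2+y3))"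
    unfolding e by simp_all
  then have ev: "even (x2+x3+y1)" "even (x1+x3+y2)" "even (x1+x2+y3)" unfolding even_of_nat_iff .
  have p: "x2+x3+y1 > 0" "x1+x3+y2 > 0" "x1+x2+y3 > 0" "y1+y2+y3 > 0" "x1+y1+x2+y2 > 0"
    "x1+y1+x3+y3 > 0" "x2+y2+x3+y3 > 0"
  proof -
    have "int (x2+x3+y1) > 0" "int (x1+x3+y2) > 0" "int (x1+x2+y3) > 0" "int (y1+y2+y3) > 0"
      "int (x1+y1+x2+y2) > 0" "int (x1+y1+x3+y3) > 0" "int (x2+y2+x3+y3) > 0"
      unfolding e using pos by simp_all
    then show "x2+x3+y1 > 0" "x1+x3+y2 > 0" "x1+x2+y3 > 0" "y1+y2+y3 > 0" "x1+y1+x2+y2 > 0"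
      "x1+y1+x3+y3 > 0" "x2+y2+x3+y3 > 0" unfolding of_nat_0_less_iff .
  qed
  note tb = tree_bound[rule_format, OF ev p]
  have x: "int x1 = -U" "int x2 = -V" "int x3 = -W" "int y1 = 2*A+V+W" "int y2 = 2*B+U+W" "int y3 = 2*C+U+V"
    using i by simp_all
  have "int ?t = 2 * N"
    using F unfolding formN_def hdisc_def
    by (simp add: x algebra_simps power2_eq_square)
  then show "N \<ge> 2" using tb by linarith
  assume "N = 2"
  then have "?t = 4" using \<open>int ?t = 2 * N\<close> by linarith
  then have "(x1,y1,x2,y2,x3,y3) = (0,0,1,1,1,1) \<or> (x1,y1,x2,y2,x3,y3) = (1,1,0,0,1,1) \<or>
    (x1,y1,x2,y2,x3,y3) = (1,1,1,1,0,0)" using tb by linarith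
  then consider "U = 0" "V = -1" "W = -1" "2*A+V+W = 0" "2*B+U+W = 1" "2*C+U+V = 1"
    | "U = -1" "V = 0" "W = -1" "2*A+V+W = 1" "2*B+U+W = 0" "2*C+U+V = 1"
    | "U = -1" "V = -1" "W = 0" "2*A+V+W = 1" "2*B+U+W = 1" "2*C+U+V = 0"
    by (elim disjE) (use i in simp_all)
  then show "formN a b R N 1 1 1 (-1) (-1) 0"
  proof cases
    case 1
    then have "A = 1" "B = 1" "C = 1" by linarith+
    then show ?thesis using formN_cyc[OF F] by (simp add: 1(1-3))
  next
    case 2
    then have "A = 1" "B = 1" "C = 1" by linarith+
    then show ?thesis using formN_cyc[OF formN_cyc[OF F]] by (simp add: 2(1-3))
  next
    case 3
    then have "A = 1" "B = 1" "C = 1" by linarith+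
    then show ?thesis using F by (simp add: 3(1-3))
  qed
qed

section \<open>The half-discriminant of a maximal order is p\<close>

lemma is_Bp_neg:
  assumes "is_Bp p a b" shows "a < 0" "b < 0" "a \<noteq> 0" "b \<noteq> 0"
proof -
  from assms have n: "a \<noteq> 0" "b \<noteq> 0" "\<not> hilbert_trivial_inf a b" unfolding is_Bp_def by auto
  show "a \<noteq> 0" "b \<noteq> 0" by fact+
  show "a < 0"
  proof (rule ccontr)
    assume "\<not> a < 0"
    then have "of_int a * 1^2 + of_int b * 0^2 = (sqrt (of_int a))^2" by simp
    then show False using n unfolding hilbert_trivial_inf_def
      by (metis prod.inject zero_neq_one)
  qed
  show "b < 0"
  proof (rule ccontr)
    assume "\<not> b < 0"
    then have "of_int a * 0^2 + of_int b * 1^2 = (sqrt (of_int b))^2" by simp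
    then show False using n unfolding hilbert_trivial_inf_def
      by (metis prod.inject zero_neq_one)
  qed
qed

theorem maximal_order_disc:
  assumes p: "prime p" and Bp: "is_Bp p a b" and m: "maximal_order a b R"
    and F: "formN a b R N A B C U V W"
  shows "N = int p"
proof -
  note ab = is_Bp_neg[OF Bp]
  have N2: "N \<ge> 2" using small_disc(1)[OF ab(1,2) F] .
  have key: "l = p \<and> \<not> (int l)^2 dvd N" if l: "prime l" and d: "int l dvd N" for l
  proof -
    have l': "prime (int l)" using l by simp
    show ?thesis
    proof (rule local_form[OF F m l' d])
      fix A B C U V W :: int
      assume F: "formN a b R N A B C U V W"
        and d: "int l dvd A" "int l dvd V" "int l dvd W" "\<not> (int l)^2 dvd A"
        and an: "\<And>y z. int l dvd B*y^2 + U*y*z + C*z^2 \<Longrightarrow> int l dvd y \<and> int l dvd z"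
      have "\<not> hilbert_trivial_at l a b" using aniso_not_hilbert[OF F ab(3,4) l d an] .
      then have "l = p" using Bp l unfolding is_Bp_def by blast
      moreover have "\<not> (int l)^2 dvd hdisc A B C U V W" by (rule aniso_disc[OF l' d]) (rule an)
      then have "\<not> (int l)^2 dvd N" using F unfolding formN_def by simp
      ultimately show "l = p \<and> \<not> (int l)^2 dvd N" by blast
    qed
  qed
  define n where "n = nat N"
  have n: "N = int n" "n \<noteq> 1" using N2 by (simp_all add: n_def)
  then obtain l where l: "prime l" "l dvd n" using prime_factor_nat by blast
  then have "l = p" using key n by simp
  then obtain k where k: "n = p * k" using l by (elim dvdE) simp
  \<comment> \<open>A prime factor of k divides N, hence is again p, and then p^2 would divide
    N.\<close>
  have "k = 1"
  proof (rule ccontr)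
    assume "k \<noteq> 1"
    then obtain q where q: "prime q" "q dvd k" using prime_factor_nat by blast
    then have "int q dvd N" using n k by simp
    then have "q = p" "\<not> (int q)^2 dvd N" using key q by blast+
    moreover have "p * p dvd n" using q(2) k \<open>q = p\<close> by simp
    ultimately show False using n by (simp add: power2_eq_square flip: of_nat_mult)
  qed
  then show ?thesis using k n by simp
qed

section \<open>The form of an order from its Gross lattice\<close>

lemma zspan_iff: "x \<in> zspan vs \<longleftrightarrow> (\<exists>c. x = lincomb c vs \<and> (\<forall>i<length vs. c i \<in> \<int>))"
  by (auto simp: zspan_def)

lemma zspan_qadd: "x \<in> zspan vs \<Longrightarrow> y \<in> zspan vs \<Longrightarrow> qadd x y \<in> zspan vs"
proof -
  assume "x \<in> zspan vs" "y \<in> zspan vs"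
  then obtain c d where "x = lincomb c vs" "y = lincomb d vs" and
    i: "\<forall>i<length vs. c i \<in> \<int>" "\<forall>i<length vs. d i \<in> \<int>" unfolding zspan_iff by blast
  then have "qadd x y = lincomb (\<lambda>i. c i + d i) vs"
    by (simp add: lincomb_def qadd_def sum.distrib distrib_right)
  then show ?thesis unfolding zspan_iff using i by (intro exI[of _ "\<lambda>i. c i + d i"]) auto
qed

lemma zspan_qsmult: "x \<in> zspan vs \<Longrightarrow> qsmult (of_int k) x \<in> zspan vs"
proof -
  assume "x \<in> zspan vs"
  then obtain c where "x = lincomb c vs" and i: "\<forall>i<length vs. c i \<in> \<int>" unfolding zspan_iff by blast
  then have "qsmult (of_int k) x = lincomb (\<lambda>i. of_int k * c i) vs"
    by (simp add: lincomb_def qsmult_def sum_distrib_left mult.assoc)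
  then show ?thesis unfolding zspan_iff using i by (intro exI[of _ "\<lambda>i. of_int k * c i"]) auto
qed

lemma zspan_denominator:
  "\<exists>K::int. K > 0 \<and> (\<forall>x\<in>zspan vs. of_int K * c0 x \<in> \<int> \<and> of_int K * c1 x \<in> \<int> \<and>
     of_int K * c2 x \<in> \<int> \<and> of_int K * c3 x \<in> \<int>)"
proof -
  obtain K :: int where K: "K > 0"
    "\<forall>x\<in>set (concat (map (\<lambda>v. [c0 v, c1 v, c2 v, c3 v]) vs)). of_int K * x \<in> \<int>"
    using common_denominator by blast
  have v: "of_int K * c0 v \<in> \<int>" "of_int K * c1 v \<in> \<int>" "of_int K * c2 v \<in> \<int>" "of_int K * c3 v \<in> \<int>"
    if "v \<in> set vs" for v
    using K(2) that by auto
  have s: "of_int K * (\<Sum>i<length vs. c i * f (vs ! i)) \<in> \<int>"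
    if "\<forall>i<length vs. c i \<in> \<int>" "\<And>v. v \<in> set vs \<Longrightarrow> of_int K * f v \<in> \<int>" for c and f :: "qel \<Rightarrow> rat"
  proof -
    have "of_int K * (\<Sum>i<length vs. c i * f (vs ! i)) = (\<Sum>i<length vs. c i * (of_int K * f (vs ! i)))"
      by (simp add: sum_distrib_left mult.left_commute)
    also have "\<dots> \<in> \<int>" using that by (intro Ints_sum Ints_mult[of "c _" "of_int K * f _"]) auto
    finally show ?thesis .
  qed
  have "\<forall>x\<in>zspan vs. of_int K * c0 x \<in> \<int> \<and> of_int K * c1 x \<in> \<int> \<and> of_int K * c2 x \<in> \<int> \<and> of_int K * c3 x \<in> \<int>"
  proof
    fix x assume "x \<in> zspan vs"
    then obtain c where "x = lincomb c vs" "\<forall>i<length vs. c i \<in> \<int>" unfolding zspan_iff by blast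
    then show "of_int K * c0 x \<in> \<int> \<and> of_int K * c1 x \<in> \<int> \<and> of_int K * c2 x \<in> \<int> \<and> of_int K * c3 x \<in> \<int>"
      using s v by (simp add: lincomb_def)
  qed
  then show ?thesis using K(1) by blast
qed

text \<open>Independent columns give a square matrix a left inverse, which is also a right inverse
  and supplies the coefficients.\<close>

lemma lin_indep_spans:
  assumes "lin_indep vs" "length vs = 4" shows "\<exists>c. lincomb c vs = x"
proof -
  from assms(2) obtain p q r s where vs: "vs = [p, q, r, s]"
    by (auto simp: numeral_eq_Suc length_Suc_conv)
  define A :: "rat^4^4" where "A = (\<chi> i j. (if i = 1 then c0 else if i = 2 then c1 else if i = 3 then c2 else c3)
    (if j = 1 then p else if j = 2 then q else if j = 3 then r else s))"
  have lc: "lincomb c vs = QE (c 0 * c0 p + c 1 * c0 q + c 2 * c0 r + c 3 * c0 s)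
     (c 0 * c1 p + c 1 * c1 q + c 2 * c1 r + c 3 * c1 s) (c 0 * c2 p + c 1 * c2 q + c 2 * c2 r + c 3 * c2 s)
     (c 0 * c3 p + c 1 * c3 q + c 2 * c3 r + c 3 * c3 s)" for c
    by (simp add: vs lincomb_def lessThan_nums numeral_eq_Suc)
  have "\<forall>c. sum (\<lambda>i. c i *s column i A) UNIV = 0 \<longrightarrow> (\<forall>i. c i = 0)"
  proof (intro allI impI)
    fix c i assume "sum (\<lambda>i. c i *s column i A) (UNIV :: 4 set) = 0"
    \<comment> \<open>The columns are indexed by 1 to 4 and the list positions by 0 to 3, hence the
      shift by one.\<close>
    then have "lincomb (\<lambda>n. [c 1, c 2, c 3, c 4] ! n) vs = qzero"
      unfolding lc qzero_def
      by (simp add: vec_eq_iff forall_4 sum_4 column_def A_def numeral_eq_Suc)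
    then have "\<forall>n<4. [c 1, c 2, c 3, c 4] ! n = 0" using assms unfolding lin_indep_def by auto
    then have "c 1 = 0 \<and> c 2 = 0 \<and> c 3 = 0 \<and> c 4 = 0" by (simp add: all_less4 numeral_eq_Suc)
    then show "c i = 0" using forall_4[of "\<lambda>i. c i = 0"] by blast
  qed
  then obtain B where "B ** A = mat 1" using matrix_left_invertible_independent_columns by blast
  then have "A ** B = mat 1" by (simp add: matrix_left_right_inverse)
  define y :: "rat^4" where "y = (\<chi> i. (if i = 1 then c0 else if i = 2 then c1 else if i = 3 then c2 else c3) x)"
  define z where "z = B *v y"
  have "A *v z = y" unfolding z_def using \<open>A ** B = mat 1\<close> by (simp add: matrix_vector_mul_assoc)
  then have "lincomb (\<lambda>n. [z $ 1, z $ 2, z $ 3, z $ 4] ! n) vs = x"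
    unfolding lc by (cases x) (simp add: vec_eq_iff forall_4 sum_4 matrix_vector_mult_def A_def y_def numeral_eq_Suc mult.commute)
  then show ?thesis by blast
qed

text \<open>If q is the denominator of r, then q^k divides M for every k, which forces q =
  1.\<close>

lemma Ints_if_bounded_powers:
  fixes r :: rat and M :: int
  assumes M: "M \<noteq> 0" and h: "\<And>k. of_int M * r^k \<in> \<int>" shows "r \<in> \<int>"
proof -
  obtain p q where pq: "quotient_of r = (p, q)" by fastforce
  then have q: "q > 0" "r = of_int p / of_int q" "coprime p q"
    using quotient_of_denom_pos quotient_of_div quotient_of_coprime by auto
  have "q^k dvd M" for k
  proof -
    obtain n where "of_int M * r^k = of_int n" using h Ints_cases by blast
    then have "rat_of_int (M * p^k) = of_int (n * q^k)"
      using q by (simp add: power_divide field_simps)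
    then have "M * p^k = n * q^k" unfolding of_int_eq_iff .
    then have "q^k dvd M * p^k" by simp
    moreover have "coprime (q^k) (p^k)" using q(3) by (simp add: coprime_commute)
    ultimately show ?thesis by (simp add: coprime_dvd_mult_left_iff)
  qed
  then have "\<not> q > 1" using power_not_dvd[of q M] M by blast
  then have "q = 1" using q(1) by simp
  then show ?thesis using q(2) by simp
qed

lemma qnrd_mult: "qnrd a b (qmul a b x y) = qnrd a b x * qnrd a b y"
  unfolding nrd_coords by (simp add: qmul_def Let_def algebra_simps power2_eq_square)

locale quat_order =
  fixes a b :: int and R :: "qel set"
  assumes ord: "is_order a b R"
begin

lemma basis: obtains vs where "length vs = 4" "lin_indep vs" "R = zspan vs"
  using ord unfolding is_order_def is_Zbasis_def by blast

lemma R_add: "x \<in> R \<Longrightarrow> y \<in> R \<Longrightarrow> qadd x y \<in> R"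
  by (rule basis) (simp add: zspan_qadd)

lemma R_smult: "x \<in> R \<Longrightarrow> qsmult (of_int k) x \<in> R"
  by (rule basis) (simp add: zspan_qsmult)

lemma R_mult: "x \<in> R \<Longrightarrow> y \<in> R \<Longrightarrow> qmul a b x y \<in> R"
  using ord unfolding is_order_def by blast

lemma R_one: "qone \<in> R"
  using ord unfolding is_order_def by blast

lemma R_sub: "x \<in> R \<Longrightarrow> y \<in> R \<Longrightarrow> qsub x y \<in> R"
  using R_add R_smult[of y "-1"] by (simp add: qsub_def)

lemma R_scalar: "QE (of_int k) 0 0 0 \<in> R"
  using R_smult[OF R_one, of k] by (simp add: qsmult_def qone_def)

lemma R_multiple: "\<exists>M::int. M > 0 \<and> qsmult (of_int M) x \<in> R"
proof -
  obtain vs where vs: "length vs = 4" "lin_indep vs" "R = zspan vs" by (rule basis)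
  obtain c where c: "lincomb c vs = x" using lin_indep_spans[OF vs(2,1)] by blast
  obtain M :: int where M: "M > 0" "\<forall>t\<in>set (map c [0..<4]). of_int M * t \<in> \<int>"
    using common_denominator by blast
  have "qsmult (of_int M) x = lincomb (\<lambda>i. of_int M * c i) vs"
    unfolding c[symmetric] by (simp add: lincomb_def qsmult_def sum_distrib_left mult.assoc)
  moreover have "\<forall>i<length vs. of_int M * c i \<in> \<int>" using M(2) vs(1) by simp
  ultimately have "qsmult (of_int M) x \<in> R" unfolding vs(3) zspan_iff by blast
  then show ?thesis using M(1) by blast
qed

text \<open>Powers of the norm of x are norms of powers of x, which stay in R. Norms on R have the
  common denominator K^2, so all powers of the norm have bounded denominator.\<close>

lemma nrd_int: assumes x: "x \<in> R" shows "qnrd a b x \<in> \<int>"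
proof -
  obtain vs where vs: "R = zspan vs" by (rule basis)
  obtain K :: int where K: "K > 0" "\<forall>x\<in>R. of_int K * c0 x \<in> \<int> \<and> of_int K * c1 x \<in> \<int> \<and>
     of_int K * c2 x \<in> \<int> \<and> of_int K * c3 x \<in> \<int>" using zspan_denominator[of vs] vs by blast
  have d: "of_int (K^2) * qnrd a b y \<in> \<int>" if y: "y \<in> R" for y
  proof -
    have "of_int (K^2) * qnrd a b y = (of_int K * c0 y)^2 - of_int a * (of_int K * c1 y)^2
       - of_int b * (of_int K * c2 y)^2 + of_int a * of_int b * (of_int K * c3 y)^2"
      unfolding nrd_coords by (simp add: algebra_simps power2_eq_square)
    moreover obtain i j k l where "of_int K * c0 y = of_int i" "of_int K * c1 y = of_int j"
      "of_int K * c2 y = of_int k" "of_int K * c3 y = of_int l"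
      using K(2)[rule_format, OF y] by (elim conjE Ints_cases)
    ultimately have "of_int (K^2) * qnrd a b y = of_int (i^2 - a * j^2 - b * k^2 + a * b * l^2)"
      by simp
    then show ?thesis by (metis Ints_of_int)
  qed
  have ex: "\<exists>y\<in>R. qnrd a b y = (qnrd a b x)^k" for k
  proof (induction k)
    case 0 show ?case using R_one by (intro bexI[of _ qone]) (simp_all add: nrd_coords qone_def)
  next
    case (Suc k)
    then obtain y where "y \<in> R" "qnrd a b y = (qnrd a b x)^k" by blast
    then show ?case using R_mult[OF x, of y] by (intro bexI[of _ "qmul a b x y"]) (simp_all add: qnrd_mult)
  qed
  have "of_int (K^2) * (qnrd a b x)^k \<in> \<int>" for k
  proof -
    obtain y where "y \<in> R" "qnrd a b y = (qnrd a b x)^k" using ex by blast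
    then show ?thesis using d[of y] by simp
  qed
  moreover have "K^2 \<noteq> 0" using K(1) by simp
  ultimately show ?thesis using Ints_if_bounded_powers by blast
qed

lemma trd_int: assumes x: "x \<in> R" shows "2 * c0 x \<in> \<int>"
proof -
  have "2 * c0 x = qnrd a b (qadd x qone) - qnrd a b x - 1"
    unfolding nrd_coords by (simp add: qadd_def qone_def algebra_simps power2_eq_square)
  also have "\<dots> \<in> \<int>" using nrd_int[OF x] nrd_int[OF R_add[OF x R_one]] by simp
  finally show ?thesis .
qed

section \<open>The Gross lattice and its vector product\<close>

definition imq :: "qel \<Rightarrow> qel" where "imq x = QE 0 (2 * c1 x) (2 * c2 x) (2 * c3 x)"

abbreviation L where "L \<equiv> gross a b R"

lemma gross_eq: "L = imq ` R"
  unfolding gross_def imq_def qsub_def qadd_def qsmult_def qscalar_def qtrd_def qconj_def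
  by auto

lemma L_pure: "x \<in> L \<Longrightarrow> c0 x = 0"
  unfolding gross_eq imq_def by auto

lemma L_sub: "x \<in> L \<Longrightarrow> y \<in> L \<Longrightarrow> qsub x y \<in> L"
proof -
  assume "x \<in> L" "y \<in> L"
  then obtain s t where "s \<in> R" "t \<in> R" "x = imq s" "y = imq t" unfolding gross_eq by blast
  then have "qsub s t \<in> R" "qsub x y = imq (qsub s t)"
    using R_sub by (simp_all add: imq_def qsub_def qadd_def qsmult_def)
  then show ?thesis unfolding gross_eq by blast
qed

lemma L_smult: "x \<in> L \<Longrightarrow> qsmult (of_int k) x \<in> L"
proof -
  assume "x \<in> L"
  then obtain s where "s \<in> R" "x = imq s" unfolding gross_eq by blast
  then have "qsmult (of_int k) s \<in> R" "qsmult (of_int k) x = imq (qsmult (of_int k) s)"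
    using R_smult by (simp_all add: imq_def qsmult_def)
  then show ?thesis unfolding gross_eq by blast
qed

text \<open>For x = 2 s - trd s and y = 2 t - trd t the product is 4 (s, t) - trd s trd t, and 2 (s,
  t) is integral by polarising the norm on R.\<close>

lemma L_inner: assumes "x \<in> L" "y \<in> L" shows "qinner a b x y \<in> \<int>"
proof -
  from assms obtain s t where st: "s \<in> R" "t \<in> R" "x = imq s" "y = imq t" unfolding gross_eq by blast
  have "qinner a b x y = 2 * (qnrd a b (qadd s t) - qnrd a b s - qnrd a b t) - (2 * c0 s) * (2 * c0 t)"
    unfolding inner_coords nrd_coords st(3,4)
    by (simp add: imq_def qadd_def algebra_simps power2_eq_square)
  also have "\<dots> \<in> \<int>"
    by (intro Ints_diff Ints_mult[OF Ints_numeral] Ints_mult[OF trd_int trd_int] nrd_int R_add st(1,2))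
  finally show ?thesis .
qed

text \<open>The norm of 2 s - trd s is minus the discriminant of the reduced characteristic
  polynomial of s.\<close>

lemma L_norm_mod4:
  assumes "x \<in> L" obtains n t :: int where "qnrd a b x = of_int (4 * n - t^2)"
proof -
  from assms obtain s where s: "s \<in> R" "x = imq s" unfolding gross_eq by blast
  obtain n where n: "qnrd a b s = of_int n" using nrd_int[OF s(1)] Ints_cases by blast
  obtain t where t: "2 * c0 s = of_int t" using trd_int[OF s(1)] Ints_cases by blast
  have "qnrd a b x = 4 * qnrd a b s - (2 * c0 s)^2"
    unfolding nrd_coords s(2) by (simp add: imq_def algebra_simps power2_eq_square)
  also have "\<dots> = of_int (4*n - t^2)" unfolding n t by simp
  finally show ?thesis using that by blast
qed

text \<open>On pure quaternions this is half the commutator, the vector product belonging to the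
  norm form.\<close>

definition cross :: "qel \<Rightarrow> qel \<Rightarrow> qel" where
  "cross x y = QE 0 (c1 (qmul a b x y)) (c2 (qmul a b x y)) (c3 (qmul a b x y))"

text \<open>The vector product of 2 s - trd s and 2 t - trd t is 2 z - trd z for the commutator z =
  s t - t s.\<close>

lemma L_cross: assumes "x \<in> L" "y \<in> L" shows "cross x y \<in> L"
proof -
  from assms obtain s t where st: "s \<in> R" "t \<in> R" "x = imq s" "y = imq t" unfolding gross_eq by blast
  have "cross x y = imq (qsub (qmul a b s t) (qmul a b t s))"
    unfolding st(3,4) by (simp add: cross_def imq_def qsub_def qadd_def qsmult_def qmul_def Let_def algebra_simps)
  then show ?thesis unfolding gross_eq using R_sub R_mult st by blast
qed

lemma inner_cross:
  assumes "c0 u = 0" "c0 v = 0" "c0 w = 0"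
  shows "qinner a b u (cross v w) = of_int a * of_int b * det3 u v w"
  using assms unfolding inner_coords
  by (simp add: cross_def qmul_def Let_def det3_def algebra_simps)

lemma L_det_int: assumes "u \<in> L" "v \<in> L" "w \<in> L" shows "of_int a * of_int b * det3 u v w \<in> \<int>"
  using inner_cross[of u v w] L_inner[OF assms(1) L_cross[OF assms(2,3)]] L_pure assms by simp

lemma lin3_in_L:
  assumes "u \<in> L" "v \<in> L" "w \<in> L"
  shows "lin3 u v w (of_int x) (of_int y) (of_int z) \<in> L"
proof -
  have "lin3 u v w (of_int x) (of_int y) (of_int z) =
    qsub (qsub (qsmult (of_int x) u) (qsmult (of_int (-y)) v)) (qsmult (of_int (-z)) w)"
    by (simp add: lin3_def lin_def qsub_def qadd_def qsmult_def)
  then show ?thesis by (simp only:) (intro L_sub L_smult assms)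
qed

end

lemma det3_indep:
  assumes "c0 u = 0" "c0 v = 0" "c0 w = 0" "det3 u v w \<noteq> 0"
  shows "lin_indep [u, v, w]"
  unfolding lin_indep3
proof (intro allI impI)
  fix x y z assume "lin3 u v w x y z = qzero"
  then have z: "x * c1 u + y * c1 v + z * c1 w = 0" "x * c2 u + y * c2 v + z * c2 w = 0"
    "x * c3 u + y * c3 v + z * c3 w = 0" by (simp_all add: lin3_def lin_def qzero_def)
  have "x * det3 u v w = (x * c1 u + y * c1 v + z * c1 w) * (c2 v * c3 w - c3 v * c2 w)
     - (x * c2 u + y * c2 v + z * c2 w) * (c1 v * c3 w - c3 v * c1 w)
     + (x * c3 u + y * c3 v + z * c3 w) * (c1 v * c2 w - c2 v * c1 w)"
    by (simp add: det3_def algebra_simps)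
  moreover have "y * det3 u v w = - (x * c1 u + y * c1 v + z * c1 w) * (c2 u * c3 w - c3 u * c2 w)
     + (x * c2 u + y * c2 v + z * c2 w) * (c1 u * c3 w - c3 u * c1 w)
     - (x * c3 u + y * c3 v + z * c3 w) * (c1 u * c2 w - c2 u * c1 w)"
    by (simp add: det3_def algebra_simps)
  moreover have "z * det3 u v w = (x * c1 u + y * c1 v + z * c1 w) * (c2 u * c3 v - c3 u * c2 v)
     - (x * c2 u + y * c2 v + z * c2 w) * (c1 u * c3 v - c3 u * c1 v)
     + (x * c3 u + y * c3 v + z * c3 w) * (c1 u * c2 v - c2 u * c1 v)"
    by (simp add: det3_def algebra_simps)
  ultimately show "x = 0 \<and> y = 0 \<and> z = 0" using assms(4) unfolding z by simp
qed

lemma inner_lin3: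
  "qinner a b (lin3 u v w x y z) t = x * qinner a b u t + y * qinner a b v t + z * qinner a b w t"
  unfolding inner_coords by (simp add: lin3_def lin_def algebra_simps)

lemma inner_commute: "qinner a b x y = qinner a b y x"
  unfolding inner_coords by simp

lemma det3_sub: "det3 (qsub x (qsmult k u)) v w = det3 x v w - k * det3 u v w"
  by (simp add: det3_def qsub_def qadd_def qsmult_def algebra_simps)

lemma det3_cyc: "det3 u v w = det3 v w u"
  by (simp add: det3_def algebra_simps)

lemma gram_det:
  assumes "c0 u = 0" "c0 v = 0" "c0 w = 0"
  shows "(of_int a * of_int b * det3 u v w)^2 =
    qinner a b u u * qinner a b v v * qinner a b w w + 2 * qinner a b u v * qinner a b v w * qinner a b u w
    - qinner a b u u * (qinner a b v w)^2 - qinner a b v v * (qinner a b u w)^2 - qinner a b w w * (qinner a b u v)^2"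
  using assms unfolding inner_coords det3_def
  by (simp add: algebra_simps power2_eq_square)

context quat_order
begin

text \<open>Otherwise removing the integral part of the coefficient from x gives a vector that can
  replace u and makes the determinant smaller but not zero.\<close>

lemma minimal_triple_coefficient:
  assumes uvw: "u \<in> L" "v \<in> L" "w \<in> L" and d: "det3 u v w \<noteq> 0"
    and min: "\<And>u' v' w'. u' \<in> L \<Longrightarrow> v' \<in> L \<Longrightarrow> w' \<in> L \<Longrightarrow> det3 u' v' w' \<noteq> 0 \<Longrightarrow>
      \<bar>det3 u v w\<bar> \<le> \<bar>det3 u' v' w'\<bar>"
    and x: "x \<in> L"
  shows "det3 x v w / det3 u v w \<in> \<int>"
proof (rule ccontr)
  define r where "r = det3 x v w / det3 u v w"
  assume "\<not> det3 x v w / det3 u v w \<in> \<int>"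
  then have r: "r \<notin> \<int>" by (simp add: r_def)
  define k where "k = \<lfloor>r\<rfloor>"
  have "r \<noteq> of_int k" using r by auto
  then have k: "0 < r - of_int k" "r - of_int k < 1" unfolding k_def by linarith+
  let ?x = "qsub x (qsmult (of_int k) u)"
  have e: "det3 ?x v w = (r - of_int k) * det3 u v w" using d unfolding det3_sub r_def
    by (simp add: algebra_simps)
  have "?x \<in> L" using L_sub[OF x L_smult[OF uvw(1)]] .
  moreover have "det3 ?x v w \<noteq> 0" unfolding e using k d by simp
  ultimately have "\<bar>det3 u v w\<bar> \<le> \<bar>det3 ?x v w\<bar>" using min uvw by blast
  also have "\<dots> = (r - of_int k) * \<bar>det3 u v w\<bar>" unfolding e abs_mult using k by simp
  also have "\<dots> < 1 * \<bar>det3 u v w\<bar>" using k d by (intro mult_strict_right_mono) auto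
  finally show False by simp
qed

lemma L_independent_triple: "\<exists>u v w. u \<in> L \<and> v \<in> L \<and> w \<in> L \<and> det3 u v w \<noteq> 0"
proof -
  obtain i where i: "i > 0" "qsmult (of_int i) (QE 0 1 0 0) \<in> R" using R_multiple by blast
  obtain j where j: "j > 0" "qsmult (of_int j) (QE 0 0 1 0) \<in> R" using R_multiple by blast
  obtain k where k: "k > 0" "qsmult (of_int k) (QE 0 0 0 1) \<in> R" using R_multiple by blast
  have "det3 (imq (qsmult (of_int i) (QE 0 1 0 0))) (imq (qsmult (of_int j) (QE 0 0 1 0)))
      (imq (qsmult (of_int k) (QE 0 0 0 1))) \<noteq> 0"
    using i(1) j(1) k(1) by (simp add: det3_def imq_def qsmult_def)
  then show ?thesis unfolding gross_eq using i(2) j(2) k(2) by blast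
qed

text \<open>An independent triple of smallest determinant is a basis.\<close>
lemma gross_basis:
  assumes ab: "a \<noteq> 0" "b \<noteq> 0"
  obtains u v w where "u \<in> L" "v \<in> L" "w \<in> L" "det3 u v w \<noteq> 0" "L = zspan [u, v, w]"
proof -
  \<comment> \<open>The factor a b makes the determinants of triples in L integers, so a smallest
    one exists.\<close>
  let ?m = "\<lambda>u v w. nat \<lfloor>\<bar>of_int a * of_int b * det3 u v w\<bar>\<rfloor>"
  define P where "P n \<longleftrightarrow> (\<exists>u v w. u \<in> L \<and> v \<in> L \<and> w \<in> L \<and> det3 u v w \<noteq> 0 \<and> ?m u v w = n)" for n
  have "\<exists>n. P n" using L_independent_triple unfolding P_def by blast
  then have "P (LEAST n. P n)" by (rule LeastI_ex)
  then obtain u v w where uvw: "u \<in> L" "v \<in> L" "w \<in> L" and d: "det3 u v w \<noteq> 0"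
    and m: "?m u v w = (LEAST n. P n)" unfolding P_def by blast
  have ab0: "\<bar>rat_of_int a * of_int b\<bar> > 0" using ab by simp
  have min: "\<bar>det3 u v w\<bar> \<le> \<bar>det3 u' v' w'\<bar>"
    if L': "u' \<in> L" "v' \<in> L" "w' \<in> L" and d': "det3 u' v' w' \<noteq> 0" for u' v' w'
  proof -
    have "P (?m u' v' w')" unfolding P_def using that by blast
    then have le: "?m u v w \<le> ?m u' v' w'" unfolding m by (rule Least_le)
    obtain n n' where n: "of_int a * of_int b * det3 u v w = of_int n"
      "of_int a * of_int b * det3 u' v' w' = of_int n'"
      using L_det_int[OF uvw] L_det_int[OF L'] by (elim Ints_cases)
    have "nat \<bar>n\<bar> \<le> nat \<bar>n'\<bar>" using le unfolding n of_int_abs[symmetric] floor_of_int .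
    then have "\<bar>n\<bar> \<le> \<bar>n'\<bar>" by linarith
    then have "\<bar>rat_of_int n\<bar> \<le> \<bar>of_int n'\<bar>" by linarith
    then have "\<bar>rat_of_int a * of_int b\<bar> * \<bar>det3 u v w\<bar> \<le> \<bar>rat_of_int a * of_int b\<bar> * \<bar>det3 u' v' w'\<bar>"
      unfolding n[symmetric] abs_mult by (simp add: mult.assoc)
    then show ?thesis using ab0 by (rule mult_left_le_imp_le)
  qed
  have "L = zspan [u, v, w]"
  proof
    show "zspan [u, v, w] \<subseteq> L" unfolding zspan3 using lin3_in_L[OF uvw] by blast
    show "L \<subseteq> zspan [u, v, w]"
    proof
      fix x assume x: "x \<in> L"
      note p = L_pure[OF uvw(1)] L_pure[OF uvw(2)] L_pure[OF uvw(3)] L_pure[OF x]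
      have c: "det3 v w u = det3 u v w" "det3 w u v = det3 u v w"
        by (simp_all add: det3_def algebra_simps)
      have d2: "det3 v w u \<noteq> 0" "det3 w u v \<noteq> 0" using d unfolding c by simp_all
      have "det3 x v w / det3 u v w \<in> \<int>"
        using min by (rule minimal_triple_coefficient[OF uvw d _ x])
      moreover have "det3 x w u / det3 v w u \<in> \<int>"
        using min unfolding c(1)[symmetric] by (rule minimal_triple_coefficient[OF uvw(2,3,1) d2(1) _ x])
      moreover have "det3 x u v / det3 w u v \<in> \<int>"
        using min unfolding c(2)[symmetric] by (rule minimal_triple_coefficient[OF uvw(3,1,2) d2(2) _ x])
      ultimately obtain i j k where ijk: "det3 x v w / det3 u v w = of_int i"
        "det3 x w u / det3 v w u = of_int j" "det3 x u v / det3 w u v = of_int k"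
        by (elim Ints_cases)
      have "det3 u x w / det3 u v w = of_int j" "det3 u v x / det3 u v w = of_int k"
        using ijk(2,3) unfolding c det3_cyc[of u x w] det3_cyc[of x u v, symmetric] by simp_all
      then have "x = lin3 u v w (of_int i) (of_int j) (of_int k)"
        using cramer[OF p d] ijk(1) by simp
      then show "x \<in> zspan [u, v, w]" unfolding zspan3 by blast
    qed
  qed
  then show ?thesis using that uvw d by blast
qed

section \<open>Recovering the form from a basis of the Gross lattice\<close>

lemma cross_coords:
  assumes "c0 u = 0" "c0 v = 0"
  shows "qmul a b u v = QE (- qinner a b u v) (c1 (cross u v)) (c2 (cross u v)) (c3 (cross u v))"
    "c0 (cross u v) = 0"
    "c1 (cross v u) = - c1 (cross u v)" "c2 (cross v u) = - c2 (cross u v)" "c3 (cross v u) = - c3 (cross u v)"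
  using assms unfolding inner_coords by (simp_all add: cross_def qmul_def Let_def)

text \<open>The lift of a pure quaternion u with trace s is (s + u) / 2; this multiplies two
  lifts.\<close>

lemma half_mul:
  assumes "c0 u = 0" "c0 v = 0"
  shows "qmul a b (QE (s/2) (c1 u/2) (c2 u/2) (c3 u/2)) (QE (t/2) (c1 v/2) (c2 v/2) (c3 v/2)) =
    QE ((s*t - qinner a b u v)/4) ((s * c1 v + t * c1 u + c1 (cross u v))/4)
       ((s * c2 v + t * c2 u + c2 (cross u v))/4) ((s * c3 v + t * c3 u + c3 (cross u v))/4)"
  using assms unfolding inner_coords
  by (simp add: cross_def qmul_def Let_def add_divide_distrib diff_divide_distrib algebra_simps)

lemma inner_cross_cross:
  assumes "c0 u = 0" "c0 v = 0" "c0 x = 0" "c0 y = 0"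
  shows "qinner a b (cross u v) (cross x y) =
    qinner a b u x * qinner a b v y - qinner a b u y * qinner a b v x"
  using assms unfolding inner_coords
  by (simp add: cross_def qmul_def Let_def algebra_simps)

end

lemma int_square_quarter:
  fixes n :: int assumes "4 dvd n^2" shows "even n"
proof -
  have "(2::int) dvd 4" by simp
  then have "even (n^2)" using assms by (rule dvd_trans)
  then show ?thesis by simp
qed

context quat_order
begin

lemma half_in_R:
  assumes sp: "L = zspan [u, v, w]" and x: "x \<in> R"
  obtains i j k :: int where "2 * c1 x = of_int i * c1 u + of_int j * c1 v + of_int k * c1 w"
    "2 * c2 x = of_int i * c2 u + of_int j * c2 v + of_int k * c2 w"
    "2 * c3 x = of_int i * c3 u + of_int j * c3 v + of_int k * c3 w"
proof -
  have "imq x \<in> zspan [u, v, w]" using x sp unfolding gross_eq by blast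
  then obtain i j k :: int where "imq x = lin3 u v w (of_int i) (of_int j) (of_int k)"
    unfolding zspan3 by blast
  then show ?thesis using that[of i j k] by (simp add: imq_def lin3_def lin_def)
qed

lemma L_lift:
  assumes "u \<in> L" obtains s :: int where "QE (of_int s/2) (c1 u/2) (c2 u/2) (c3 u/2) \<in> R"
proof -
  from assms obtain x where x: "x \<in> R" "u = imq x" unfolding gross_eq by blast
  obtain s where "2 * c0 x = of_int s" using trd_int[OF x(1)] by (elim Ints_cases)
  then have "QE (of_int s/2) (c1 u/2) (c2 u/2) (c3 u/2) = x"
    unfolding x(2) by (cases x) (simp add: imq_def)
  then show ?thesis using that[of s] x(1) by simp
qed

lemma R_shift:
  assumes x: "QE (of_int s/2) p q r \<in> R" and "s = t + 2 * k"
  shows "QE (of_int t/2) p q r \<in> R"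
proof -
  have "qsub (QE (of_int s/2) p q r) (QE (of_int k) 0 0 0) = QE (of_int t/2) p q r"
    using assms(2) by (simp add: qsub_def qadd_def qsmult_def add_divide_distrib)
  then show ?thesis using R_sub[OF x R_scalar[of k]] by simp
qed

lemma indep_coeffs:
  assumes "c0 u = 0" "c0 v = 0" "c0 w = 0" "det3 u v w \<noteq> 0"
    and "lin3 u v w x y z = lin3 u v w x' y' z'"
  shows "x = x'" "y = y'" "z = z'"
proof -
  have "lin3 u v w (x - x') (y - y') (z - z') = qzero"
    using assms(5) by (simp add: lin3_def lin_def qzero_def algebra_simps)
  then have "x - x' = 0 \<and> y - y' = 0 \<and> z - z' = 0"
    using det3_indep[OF assms(1-4)] unfolding lin_indep3 by blast
  then show "x = x'" "y = y'" "z = z'" by simp_all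
qed

text \<open>Reading off parities from the product of lifts of \<open>v\<close> and \<open>w\<close>.\<close>
lemma cross_parity:
  assumes uvw: "u \<in> L" "v \<in> L" "w \<in> L" "det3 u v w \<noteq> 0" and sp: "L = zspan [u, v, w]"
    and s: "QE (of_int s/2) (c1 v/2) (c2 v/2) (c3 v/2) \<in> R"
    and t: "QE (of_int t/2) (c1 w/2) (c2 w/2) (c3 w/2) \<in> R"
    and cr: "cross v w = lin3 u v w (of_int k) (of_int l) (of_int m)"
  shows "even k" "even (l + t)" "even (m + s)"
proof -
  note p = L_pure[OF uvw(1)] L_pure[OF uvw(2)] L_pure[OF uvw(3)]
  have X: "qmul a b (QE (of_int s/2) (c1 v/2) (c2 v/2) (c3 v/2)) (QE (of_int t/2) (c1 w/2) (c2 w/2) (c3 w/2)) \<in> R"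
    using R_mult[OF s t] .
  obtain i j n :: int where h:
    "2 * ((of_int s * c1 w + of_int t * c1 v + c1 (cross v w))/4) = of_int i * c1 u + of_int j * c1 v + of_int n * c1 w"
    "2 * ((of_int s * c2 w + of_int t * c2 v + c2 (cross v w))/4) = of_int i * c2 u + of_int j * c2 v + of_int n * c2 w"
    "2 * ((of_int s * c3 w + of_int t * c3 v + c3 (cross v w))/4) = of_int i * c3 u + of_int j * c3 v + of_int n * c3 w"
    using half_in_R[OF sp X] unfolding half_mul[OF p(2,3)] qel.sel by blast
  have "lin3 u v w (of_int k) (of_int (l + t)) (of_int (m + s)) = lin3 u v w (of_int (2*i)) (of_int (2*j)) (of_int (2*n))"
    using h p unfolding cr by (simp add: lin3_def lin_def algebra_simps)
  from indep_coeffs[OF p uvw(4) this] have "k = 2*i" "l + t = 2*j" "m + s = 2*n"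
    unfolding of_int_eq_iff by blast+
  then show "even k" "even (l + t)" "even (m + s)" by simp_all
qed

text \<open>Let g be the Gram matrix of the basis, D = a b \<open>det3\<close>, and m the matrix of
  the vector products in the basis. Then m D = adj(g), so m is symmetric, and det g = D^2 gives g =
  adj(m). Products of lifts show that the diagonal of m is even. Hence -m is the Gram matrix of an
  integral form, and its half-discriminant -D / 2 is positive.\<close>

lemma gross_form_oriented:
  assumes uvw: "u \<in> L" "v \<in> L" "w \<in> L" and sp: "L = zspan [u, v, w]"
    and neg: "of_int a * of_int b * det3 u v w < 0"
  shows "\<exists>N A B C U V W. formN a b R N A B C U V W \<and>
    qinner a b u u = of_int (4*B*C - U^2) \<and> qinner a b v v = of_int (4*A*C - V^2) \<and>
    qinner a b w w = of_int (4*A*B - W^2) \<and> qinner a b u v = of_int (U*V - 2*C*W) \<and>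
    qinner a b u w = of_int (U*W - 2*B*V) \<and> qinner a b v w = of_int (V*W - 2*A*U)"
proof -
  note p = L_pure[OF uvw(1)] L_pure[OF uvw(2)] L_pure[OF uvw(3)]
  have d: "det3 u v w \<noteq> 0" using neg by auto
  have dc: "det3 v w u = det3 u v w" "det3 w u v = det3 u v w"
    by (simp_all add: det3_def algebra_simps)
  have lc: "lin3 v w u x y z = lin3 u v w z x y" "lin3 w u v x y z = lin3 u v w y z x" for x y z
    by (simp_all add: lin3_def lin_def algebra_simps)
  have cyc: "zspan [v, w, u] \<subseteq> zspan [u, v, w]" for u v w
  proof
    fix x assume "x \<in> zspan [v, w, u]"
    then obtain i j k :: int where "x = lin3 v w u (of_int i) (of_int j) (of_int k)" unfolding zspan3 by blast
    then have "x = lin3 u v w (of_int k) (of_int i) (of_int j)" by (simp add: lin3_def lin_def)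
    then show "x \<in> zspan [u, v, w]" unfolding zspan3 by blast
  qed
  have spc: "L = zspan [v, w, u]" "L = zspan [w, u, v]"
    unfolding sp using cyc[of u v w] cyc[of v w u] cyc[of w u v] by auto
  obtain m11 m12 m13 :: int where X1: "cross v w = lin3 u v w (of_int m11) (of_int m12) (of_int m13)"
    using L_cross[OF uvw(2,3)] unfolding sp zspan3 by blast
  obtain m21 m22 m23 :: int where X2: "cross w u = lin3 u v w (of_int m21) (of_int m22) (of_int m23)"
    using L_cross[OF uvw(3,1)] unfolding sp zspan3 by blast
  obtain m31 m32 m33 :: int where X3: "cross u v = lin3 u v w (of_int m31) (of_int m32) (of_int m33)"
    using L_cross[OF uvw(1,2)] unfolding sp zspan3 by blast
  define D where "D = of_int a * of_int b * det3 u v w"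
  have dz: "det3 v v w = 0" "det3 w v w = 0" "det3 u w u = 0" "det3 w w u = 0" "det3 u u v = 0" "det3 v u v = 0"
    by (simp_all add: det3_def algebra_simps)
  define g11 g22 g33 g12 g13 g23 where "g11 = qinner a b u u" and "g22 = qinner a b v v" and
    "g33 = qinner a b w w" and "g12 = qinner a b u v" and "g13 = qinner a b u w" and "g23 = qinner a b v w"
  have gc: "qinner a b v u = g12" "qinner a b w u = g13" "qinner a b w v = g23"
    unfolding g12_def g13_def g23_def by (simp_all add: inner_commute)
  note gd = g11_def[symmetric] g22_def[symmetric] g33_def[symmetric] g12_def[symmetric] g13_def[symmetric]
    g23_def[symmetric]
  have c1: "qinner a b (cross v w) y = of_int m11 * qinner a b u y + of_int m12 * qinner a b v y + of_int m13 * qinner a b w y"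
    and c2: "qinner a b (cross w u) y = of_int m21 * qinner a b u y + of_int m22 * qinner a b v y + of_int m23 * qinner a b w y"
    and c3: "qinner a b (cross u v) y = of_int m31 * qinner a b u y + of_int m32 * qinner a b v y + of_int m33 * qinner a b w y"
    for y unfolding X1 X2 X3 inner_lin3 by simp_all
  have ic: "qinner a b u (cross v w) = D" "qinner a b v (cross v w) = 0" "qinner a b w (cross v w) = 0"
    "qinner a b u (cross w u) = 0" "qinner a b v (cross w u) = D" "qinner a b w (cross w u) = 0"
    "qinner a b u (cross u v) = 0" "qinner a b v (cross u v) = 0" "qinner a b w (cross u v) = D"
    using p by (simp_all add: inner_cross dz dc D_def)
  \<comment> \<open>Two vector products are paired in two ways: through the coordinates, where a
    single triple product D survives, and through the Lagrange identity.\<close>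
  have m11: "of_int m11 * D = g22 * g33 - g23^2"
    using c1[of "cross v w"] unfolding ic inner_cross_cross[OF p(2,3) p(2,3)] gd gc
    by (simp add: power2_eq_square algebra_simps)
  have m22: "of_int m22 * D = g11 * g33 - g13^2"
    using c2[of "cross w u"] unfolding ic inner_cross_cross[OF p(3,1) p(3,1)] gd gc
    by (simp add: power2_eq_square algebra_simps)
  have m33: "of_int m33 * D = g11 * g22 - g12^2"
    using c3[of "cross u v"] unfolding ic inner_cross_cross[OF p(1,2) p(1,2)] gd gc
    by (simp add: power2_eq_square algebra_simps)
  have m12: "of_int m12 * D = g23 * g13 - g12 * g33"
    using c1[of "cross w u"] unfolding ic inner_cross_cross[OF p(2,3) p(3,1)] gd gc
    by (simp add: power2_eq_square algebra_simps)
  have m21: "of_int m21 * D = g23 * g13 - g12 * g33"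
    using c2[of "cross v w"] unfolding ic inner_cross_cross[OF p(3,1) p(2,3)] gd gc
    by (simp add: power2_eq_square algebra_simps)
  have m13: "of_int m13 * D = g12 * g23 - g22 * g13"
    using c1[of "cross u v"] unfolding ic inner_cross_cross[OF p(2,3) p(1,2)] gd gc
    by (simp add: power2_eq_square algebra_simps)
  have m31: "of_int m31 * D = g12 * g23 - g22 * g13"
    using c3[of "cross v w"] unfolding ic inner_cross_cross[OF p(1,2) p(2,3)] gd gc
    by (simp add: power2_eq_square algebra_simps)
  have m23: "of_int m23 * D = g12 * g13 - g11 * g23"
    using c2[of "cross u v"] unfolding ic inner_cross_cross[OF p(3,1) p(1,2)] gd gc
    by (simp add: power2_eq_square algebra_simps)
  have m32: "of_int m32 * D = g12 * g13 - g11 * g23"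
    using c3[of "cross w u"] unfolding ic inner_cross_cross[OF p(1,2) p(3,1)] gd gc
    by (simp add: power2_eq_square algebra_simps)
  note m = m11 m22 m33 m12 m21 m13 m31 m23 m32
  have D0: "D \<noteq> 0" "D < 0" using neg unfolding D_def by auto
  have sym: "m21 = m12" "m31 = m13" "m32 = m23" 
    using m12[folded m21] m13[folded m31] m23[folded m32] D0(1) by auto
  have D2: "D^2 = g11*g22*g33 + 2*g12*g23*g13 - g11*g23^2 - g22*g13^2 - g33*g12^2"
    using gram_det[OF p, of a b] unfolding D_def[symmetric] gd .
  obtain s1 where s1: "QE (of_int s1/2) (c1 u/2) (c2 u/2) (c3 u/2) \<in> R" using L_lift[OF uvw(1)] .
  obtain s2 where s2: "QE (of_int s2/2) (c1 v/2) (c2 v/2) (c3 v/2) \<in> R" using L_lift[OF uvw(2)] .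
  obtain s3 where s3: "QE (of_int s3/2) (c1 w/2) (c2 w/2) (c3 w/2) \<in> R" using L_lift[OF uvw(3)] .
  have X2': "cross w u = lin3 v w u (of_int m22) (of_int m23) (of_int m21)"
    and X3': "cross u v = lin3 w u v (of_int m33) (of_int m31) (of_int m32)"
    unfolding X2 X3 lc by simp_all
  have ev: "even m11" "even (m12 + s3)" "even (m13 + s2)"
    "even m22" "even (m23 + s1)" "even m33"
    using cross_parity[OF uvw d sp s2 s3 X1] cross_parity[OF uvw(2,3,1) _ spc(1) s3 s1 X2']
      cross_parity[OF uvw(3,1,2) _ spc(2) s1 s2 X3'] d unfolding dc by blast+
  from ev(1,4,6) obtain A' B' C' where h: "m11 = 2*A'" "m22 = 2*B'" "m33 = 2*C'" by (elim evenE)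
  \<comment> \<open>The signs are chosen so that negative D becomes positive
    \<open>hdisc\<close>.\<close>
  define A B C U V W where "A = -A'" and "B = -B'" and "C = -C'" and "U = -m23" and "V = -m13" and "W = -m12"
  have mm: "m11 = -2*A" "m22 = -2*B" "m33 = -2*C" "m23 = -U" "m13 = -V" "m12 = -W"
    "m32 = -U" "m31 = -V" "m21 = -W"
    using h sym by (simp_all add: A_def B_def C_def U_def V_def W_def)
  have adj: "g11 = of_int (4*B*C - U^2)" "g22 = of_int (4*A*C - V^2)" "g33 = of_int (4*A*B - W^2)"
    "g12 = of_int (U*V - 2*C*W)" "g13 = of_int (U*W - 2*B*V)" "g23 = of_int (V*W - 2*A*U)"
  proof -
    have c: "x = y" if "x * D^2 = y * D^2" for x y using that D0(1) by simp
    \<comment> \<open>Entrywise adj(adj g) = det(g) g, with det g = D^2.\<close>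
    have "g11 * D^2 = (of_int m22 * D) * (of_int m33 * D) - (of_int m23 * D)^2"
      unfolding m D2 by (simp add: algebra_simps power2_eq_square)
    also have "\<dots> = of_int (4*B*C - U^2) * D^2" unfolding mm by (simp add: algebra_simps power2_eq_square)
    finally show "g11 = of_int (4*B*C - U^2)" by (rule c)
    have "g22 * D^2 = (of_int m11 * D) * (of_int m33 * D) - (of_int m13 * D)^2"
      unfolding m D2 by (simp add: algebra_simps power2_eq_square)
    also have "\<dots> = of_int (4*A*C - V^2) * D^2" unfolding mm by (simp add: algebra_simps power2_eq_square)
    finally show "g22 = of_int (4*A*C - V^2)" by (rule c)
    have "g33 * D^2 = (of_int m11 * D) * (of_int m22 * D) - (of_int m12 * D)^2"
      unfolding m D2 by (simp add: algebra_simps power2_eq_square)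
    also have "\<dots> = of_int (4*A*B - W^2) * D^2" unfolding mm by (simp add: algebra_simps power2_eq_square)
    finally show "g33 = of_int (4*A*B - W^2)" by (rule c)
    have "g12 * D^2 = (of_int m13 * D) * (of_int m23 * D) - (of_int m12 * D) * (of_int m33 * D)"
      unfolding m D2 by (simp add: algebra_simps power2_eq_square)
    also have "\<dots> = of_int (U*V - 2*C*W) * D^2" unfolding mm by (simp add: algebra_simps power2_eq_square)
    finally show "g12 = of_int (U*V - 2*C*W)" by (rule c)
    have "g13 * D^2 = (of_int m12 * D) * (of_int m23 * D) - (of_int m13 * D) * (of_int m22 * D)"
      unfolding m D2 by (simp add: algebra_simps power2_eq_square)
    also have "\<dots> = of_int (U*W - 2*B*V) * D^2" unfolding mm by (simp add: algebra_simps power2_eq_square)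
    finally show "g13 = of_int (U*W - 2*B*V)" by (rule c)
    have "g23 * D^2 = (of_int m12 * D) * (of_int m13 * D) - (of_int m23 * D) * (of_int m11 * D)"
      unfolding m D2 by (simp add: algebra_simps power2_eq_square)
    also have "\<dots> = of_int (V*W - 2*A*U) * D^2" unfolding mm by (simp add: algebra_simps power2_eq_square)
    finally show "g23 = of_int (V*W - 2*A*U)" by (rule c)
  qed
  have N: "of_int (2 * hdisc A B C U V W) = - D"
  proof -
    have "D * D = D * - (of_int (2 * hdisc A B C U V W))"
    proof -
      have "D^2 = - D * (of_int (2*A) * g11 + of_int W * g12 + of_int V * g13)"
      proof -
        \<comment> \<open>Expansion of det g along its first row.\<close>
        have "D^2 = (of_int m11 * D) * g11 + (of_int m12 * D) * g12 + (of_int m13 * D) * g13"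
          unfolding m D2 by (simp add: algebra_simps power2_eq_square)
        then show ?thesis by (simp add: mm algebra_simps)
      qed
      also have "of_int (2*A) * g11 + of_int W * g12 + of_int V * g13 = of_int (2 * hdisc A B C U V W)"
        unfolding adj hdisc_def by (simp add: algebra_simps power2_eq_square)
      finally show ?thesis by (simp add: power2_eq_square)
    qed
    then have "D = - (of_int (2 * hdisc A B C U V W))" using D0(1) mult_left_cancel by blast
    then show ?thesis by simp
  qed
  then have "rat_of_int (2 * hdisc A B C U V W) > 0" using D0(2) by simp
  then have pos: "hdisc A B C U V W > 0" unfolding of_int_0_less_iff by simp
  define e1 e2 e3 where "e1 = QE (of_int U/2) (c1 u/2) (c2 u/2) (c3 u/2)"
    and "e2 = QE (of_int V/2) (c1 v/2) (c2 v/2) (c3 v/2)" and "e3 = QE (of_int W/2) (c1 w/2) (c2 w/2) (c3 w/2)"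
  \<comment> \<open>The given lifts have traces of the same parity as U, V, W, so the lifts with
    exactly these traces also lie in R.\<close>
  have "even (s1 - U)" "even (s2 - V)" "even (s3 - W)"
    using ev(2,3,5) unfolding mm by (simp_all add: even_diff)
  then obtain k1 k2 k3 where k: "s1 - U = 2*k1" "s2 - V = 2*k2" "s3 - W = 2*k3" by (elim evenE)
  have eR: "e1 \<in> R" "e2 \<in> R" "e3 \<in> R"
    unfolding e1_def e2_def e3_def
    using R_shift[OF s1, of U k1] R_shift[OF s2, of V k2] R_shift[OF s3, of W k3] k by simp_all
  have "zspan [qone, e1, e2, e3] \<subseteq> R"
  proof
    fix x assume "x \<in> zspan [qone, e1, e2, e3]"
    then obtain n0 n1 n2 n3 :: int where
      "x = lin e1 e2 e3 (of_int n0) (of_int n1) (of_int n2) (of_int n3)" unfolding zspan4 by blast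
    then have x: "x = qadd (qadd (qadd (QE (of_int n0) 0 0 0) (qsmult (of_int n1) e1)) (qsmult (of_int n2) e2))
        (qsmult (of_int n3) e3)"
      by (simp add: lin_def qadd_def qsmult_def)
    show "x \<in> R" unfolding x by (intro R_add R_smult eR R_scalar)
  qed
  moreover have "R \<subseteq> zspan [qone, e1, e2, e3]"
  proof
    fix x assume x: "x \<in> R"
    obtain i j l :: int where h: "2 * c1 x = of_int i * c1 u + of_int j * c1 v + of_int l * c1 w"
      "2 * c2 x = of_int i * c2 u + of_int j * c2 v + of_int l * c2 w"
      "2 * c3 x = of_int i * c3 u + of_int j * c3 v + of_int l * c3 w"
      using half_in_R[OF sp x] .
    define t where "t = c0 x - (of_int i * of_int U + of_int j * of_int V + of_int l * of_int W) / 2"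
    have xl: "x = lin e1 e2 e3 t (of_int i) (of_int j) (of_int l)"
      using h by (cases x) (simp add: lin_def e1_def e2_def e3_def t_def add_divide_distrib)
    \<comment> \<open>What remains after removing the e1, e2, e3 part is a rational scalar t in R.
      Its trace 2t and norm t^2 are integers, hence so is t.\<close>
    have "QE t 0 0 0 = qsub x (qadd (qadd (qsmult (of_int i) e1) (qsmult (of_int j) e2)) (qsmult (of_int l) e3))"
      unfolding xl by (simp add: lin_def qsub_def qadd_def qsmult_def)
    then have tR: "QE t 0 0 0 \<in> R" using x eR by (simp only:) (intro R_sub R_add R_smult)
    obtain n where n: "2 * t = of_int n" using trd_int[OF tR] by (auto elim: Ints_cases)
    obtain r where r: "t^2 = of_int r" using nrd_int[OF tR] by (auto simp: nrd_coords elim: Ints_cases)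
    have "rat_of_int (n^2) = (2 * t)^2" unfolding n by simp
    also have "\<dots> = of_int (4 * r)" using r by (simp add: power_mult_distrib)
    finally have "n^2 = 4 * r" unfolding of_int_eq_iff .
    then have "even n" using int_square_quarter by simp
    then obtain q where "n = 2 * q" by (elim evenE)
    then have "t = of_int q" using n by simp
    then show "x \<in> zspan [qone, e1, e2, e3]" unfolding xl zspan4 by blast
  qed
  ultimately have RR: "R = zspan [qone, e1, e2, e3]" by blast
  have cx: "c1 (cross v w) = - (2 * of_int A * c1 u + of_int W * c1 v + of_int V * c1 w)"
    "c2 (cross v w) = - (2 * of_int A * c2 u + of_int W * c2 v + of_int V * c2 w)"
    "c3 (cross v w) = - (2 * of_int A * c3 u + of_int W * c3 v + of_int V * c3 w)"
    "c1 (cross w u) = - (of_int W * c1 u + 2 * of_int B * c1 v + of_int U * c1 w)"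
    "c2 (cross w u) = - (of_int W * c2 u + 2 * of_int B * c2 v + of_int U * c2 w)"
    "c3 (cross w u) = - (of_int W * c3 u + 2 * of_int B * c3 v + of_int U * c3 w)"
    "c1 (cross u v) = - (of_int V * c1 u + of_int U * c1 v + 2 * of_int C * c1 w)"
    "c2 (cross u v) = - (of_int V * c2 u + of_int U * c2 v + 2 * of_int C * c2 w)"
    "c3 (cross u v) = - (of_int V * c3 u + of_int U * c3 v + 2 * of_int C * c3 w)"
    unfolding X1 X2 X3 mm by (simp_all add: lin3_def lin_def)
  have cs: "c1 (cross x x) = 0" "c2 (cross x x) = 0" "c3 (cross x x) = 0" if "c0 x = 0" for x
    using cross_coords(3-5)[OF that that] by simp_all
  note hm = half_mul[OF p(1) p(1)] half_mul[OF p(2) p(2)] half_mul[OF p(3) p(3)]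
    half_mul[OF p(2) p(3)] half_mul[OF p(3) p(1)] half_mul[OF p(1) p(2)]
    half_mul[OF p(3) p(2)] half_mul[OF p(1) p(3)] half_mul[OF p(2) p(1)]
  have "ftab a b e1 e2 e3 (of_int A) (of_int B) (of_int C) (of_int U) (of_int V) (of_int W)"
    unfolding ftab_def e1_def e2_def e3_def hm gd gc cs[OF p(1)] cs[OF p(2)] cs[OF p(3)]
      cross_coords(3-5)[OF p(2) p(3)] cross_coords(3-5)[OF p(3) p(1)] cross_coords(3-5)[OF p(1) p(2)] cx adj
    by (intro conjI; simp add: lin_def field_simps power2_eq_square)
  then have "formN a b R (hdisc A B C U V W) A B C U V W"
    unfolding formN_def has_form_def using RR pos by blast
  then show ?thesis using adj unfolding gd by blast
qed

text \<open>Negating all three vectors reverses the orientation and keeps the Gram matrix.\<close>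

lemma gross_form:
  assumes ab: "a \<noteq> 0" "b \<noteq> 0" and bs: "is_Zbasis L [u, v, w]" and d: "det3 u v w \<noteq> 0"
  obtains N A B C U V W where "formN a b R N A B C U V W"
    "qinner a b u u = of_int (4*B*C - U^2)" "qinner a b v v = of_int (4*A*C - V^2)"
    "qinner a b w w = of_int (4*A*B - W^2)" "qinner a b u v = of_int (U*V - 2*C*W)"
    "qinner a b u w = of_int (U*W - 2*B*V)" "qinner a b v w = of_int (V*W - 2*A*U)"
proof -
  have sp: "L = zspan [u, v, w]" using bs unfolding is_Zbasis_def by blast
  have lu: "u = lin3 u v w (of_int 1) (of_int 0) (of_int 0)" "v = lin3 u v w (of_int 0) (of_int 1) (of_int 0)"
    "w = lin3 u v w (of_int 0) (of_int 0) (of_int 1)"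
    by (simp_all add: lin3_def lin_def)
  have uvw: "u \<in> L" "v \<in> L" "w \<in> L" unfolding sp zspan3 using lu by blast+
  show ?thesis
  proof (cases "of_int a * of_int b * det3 u v w < 0")
    case True
    then show ?thesis using gross_form_oriented[OF uvw sp] that by blast
  next
    case False
    let ?n = "qsmult (-1)"
    have "of_int a * of_int b * det3 u v w \<noteq> 0" using ab d by simp
    moreover have "of_int a * of_int b * det3 (?n u) (?n v) (?n w) = - (of_int a * of_int b * det3 u v w)"
      by (simp add: det3_def qsmult_def algebra_simps)
    ultimately have neg: "of_int a * of_int b * det3 (?n u) (?n v) (?n w) < 0" using False by linarith
    have uvw': "?n u \<in> L" "?n v \<in> L" "?n w \<in> L" using L_smult[of _ "-1"] uvw by simp_all
    have "lin3 (?n u) (?n v) (?n w) (of_int x) (of_int y) (of_int z) =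
      lin3 u v w (of_int (-x)) (of_int (-y)) (of_int (-z))" for x y z
      by (simp add: lin3_def lin_def qsmult_def)
    moreover have "lin3 u v w (of_int x) (of_int y) (of_int z) =
      lin3 (?n u) (?n v) (?n w) (of_int (-x)) (of_int (-y)) (of_int (-z))" for x y z
      by (simp add: lin3_def lin_def qsmult_def)
    ultimately have sp': "L = zspan [?n u, ?n v, ?n w]" unfolding sp zspan3 by blast
    have "qinner a b (?n x) (?n y) = qinner a b x y" for x y
      unfolding inner_coords by (simp add: qsmult_def)
    then show ?thesis using gross_form_oriented[OF uvw' sp' neg] that by (elim exE conjE) simp
  qed
qed

end

lemma nrd_inner: "qnrd a b x = qinner a b x x"
  unfolding nrd_coords inner_coords by (simp add: power2_eq_square)

lemma inner_lin3_right:
  "qinner a b t (lin3 u v w x y z) = x * qinner a b t u + y * qinner a b t v + z * qinner a b t w"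
  using inner_lin3[of a b u v w x y z t] by (simp add: inner_commute)

lemma nrd_lin3:
  "qnrd a b (lin3 u v w x y z) = x^2 * qinner a b u u + y^2 * qinner a b v v + z^2 * qinner a b w w
     + 2 * x * y * qinner a b u v + 2 * x * z * qinner a b u w + 2 * y * z * qinner a b v w"
  unfolding nrd_inner inner_lin3 inner_lin3_right
    inner_commute[of a b v u] inner_commute[of a b w u] inner_commute[of a b w v]
  by (simp add: algebra_simps power2_eq_square)

text \<open>A singular Gram matrix would give vectors of norm zero from the rows of its adjugate.\<close>
lemma lin_indep_det3:
  fixes a b :: int
  assumes ab: "a < 0" "b < 0" and p: "c0 u = 0" "c0 v = 0" "c0 w = 0" and li: "lin_indep [u, v, w]"
  shows "det3 u v w \<noteq> 0"
proof
  assume "det3 u v w = 0"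
  note li' = li[unfolded lin_indep3, rule_format]
  have zero: "x = 0 \<and> y = 0 \<and> z = 0" if "qnrd a b (lin3 u v w x y z) = 0" for x y z :: rat
  proof -
    have "lin3 u v w x y z = qzero"
    proof (rule ccontr)
      assume "lin3 u v w x y z \<noteq> qzero"
      from nrd_pos[OF ab this] that show False by simp
    qed
    then show ?thesis by (rule li')
  qed
  define g11 g22 g33 g12 g13 g23 where "g11 = qinner a b u u" and "g22 = qinner a b v v" and
    "g33 = qinner a b w w" and "g12 = qinner a b u v" and "g13 = qinner a b u w" and "g23 = qinner a b v w"
  note gd = g11_def[symmetric] g22_def[symmetric] g33_def[symmetric] g12_def[symmetric] g13_def[symmetric]
    g23_def[symmetric]
  have D: "g11*g22*g33 + 2*g12*g23*g13 - g11*g23^2 - g22*g13^2 - g33*g12^2 = 0"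
    using gram_det[OF p, of a b] \<open>det3 u v w = 0\<close> unfolding gd by simp
  have "qnrd a b (lin3 u v w (g22*g33 - g23^2) (g13*g23 - g12*g33) (g12*g23 - g22*g13))
      = (g22*g33 - g23^2) * (g11*g22*g33 + 2*g12*g23*g13 - g11*g23^2 - g22*g13^2 - g33*g12^2)"
    unfolding nrd_lin3 gd by (simp add: algebra_simps power2_eq_square)
  from zero[OF this[unfolded D mult_zero_right]] have m: "g22*g33 - g23^2 = 0" by blast
  have "qnrd a b (lin3 u v w 0 g33 (- g23)) = g33 * (g22*g33 - g23^2)"
    unfolding nrd_lin3 gd by (simp add: algebra_simps power2_eq_square)
  from zero[OF this[unfolded m mult_zero_right]] have "g33 = 0" by blast
  then have "qnrd a b (lin3 u v w 0 0 1) = 0" unfolding nrd_lin3 gd by simp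
  from zero[OF this] show False by simp
qed

text \<open>This is det(adj G) = (det G)^2 with det G = 2 \<open>hdisc\<close>.\<close>

lemma gram_det_adj:
  fixes A B C U V W :: int
  shows "(4*B*C - U^2) * (4*A*C - V^2) * (4*A*B - W^2)
    + 2 * (U*V - 2*C*W) * (U*W - 2*B*V) * (V*W - 2*A*U) - (4*B*C - U^2) * (V*W - 2*A*U)^2
    - (4*A*C - V^2) * (U*W - 2*B*V)^2 - (4*A*B - W^2) * (U*V - 2*C*W)^2 = 4 * (hdisc A B C U V W)^2"
  by (simp add: hdisc_def algebra_simps power2_eq_square)

section \<open>Orthogonal lattices\<close>

lemma lincomb_unit: "i < length vs \<Longrightarrow> lincomb (\<lambda>j. if j = i then 1 else 0) vs = vs ! i"
  by (cases "vs ! i") (simp add: lincomb_def if_distrib[of "\<lambda>t. t * _"] sum.delta cong: if_cong)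

lemma nth_in_zspan: "i < length vs \<Longrightarrow> vs ! i \<in> zspan vs"
  unfolding zspan_iff by (rule exI[of _ "\<lambda>j. if j = i then 1 else 0"]) (simp add: lincomb_unit)

lemma lin_indep_nth_nonzero:
  assumes "lin_indep vs" "i < length vs" shows "vs ! i \<noteq> qzero"
proof
  assume "vs ! i = qzero"
  then have "lincomb (\<lambda>j. if j = i then 1 else 0) vs = qzero" using assms(2) by (simp add: lincomb_unit)
  then have "\<forall>k<length vs. (if k = i then 1 else 0 :: rat) = 0" using assms(1) unfolding lin_indep_def by blast
  then show False using assms(2) by auto
qed

context quat_order
begin

text \<open>\<open>orthogonal_lattice\<close> leaves the length of the basis open. A fourth pure
  vector orthogonal to three others is zero, as those three already span; with fewer than three
  vectors all determinants of triples in L would vanish.\<close>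

lemma orthogonal_basis_length:
  assumes ab: "a < 0" "b < 0" and bs: "is_Zbasis L vs"
    and orth: "\<And>i j. i < length vs \<Longrightarrow> j < length vs \<Longrightarrow> i \<noteq> j \<Longrightarrow> qinner a b (vs ! i) (vs ! j) = 0"
  shows "length vs = 3"
proof -
  have li: "lin_indep vs" and sp: "L = zspan vs" using bs unfolding is_Zbasis_def by blast+
  have pure: "c0 (vs ! i) = 0" if "i < length vs" for i using L_pure sp nth_in_zspan[OF that] by blast
  have npos: "qinner a b (vs ! i) (vs ! i) > 0" if "i < length vs" for i
    using nrd_pos[OF ab lin_indep_nth_nonzero[OF li that]] unfolding nrd_inner .
  have "\<not> length vs > 3"
  proof
    assume "length vs > 3"
    then have l: "0 < length vs" "1 < length vs" "2 < length vs" "3 < length vs" by linarith+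
    note p = pure[OF l(1)] pure[OF l(2)] pure[OF l(3)] pure[OF l(4)]
    have o: "qinner a b (vs!0) (vs!1) = 0" "qinner a b (vs!0) (vs!2) = 0" "qinner a b (vs!1) (vs!2) = 0"
      "qinner a b (vs!3) (vs!0) = 0" "qinner a b (vs!3) (vs!1) = 0" "qinner a b (vs!3) (vs!2) = 0"
      by (rule orth; use l in simp)+
    have "(of_int a * of_int b * det3 (vs!0) (vs!1) (vs!2))^2 \<noteq> 0"
      unfolding gram_det[OF p(1-3)] o using npos[OF l(1)] npos[OF l(2)] npos[OF l(3)] by simp
    then have d: "det3 (vs!0) (vs!1) (vs!2) \<noteq> 0" by auto
    from cramer[OF p d] obtain x y z where x: "vs!3 = lin3 (vs!0) (vs!1) (vs!2) x y z" by (rule that)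
    have "x * qinner a b (vs!0) (vs!0) = 0" "y * qinner a b (vs!1) (vs!1) = 0" "z * qinner a b (vs!2) (vs!2) = 0"
      using o(4-6)[unfolded x inner_lin3] unfolding inner_commute[of a b "vs!1" "vs!0"]
        inner_commute[of a b "vs!2" "vs!0"] inner_commute[of a b "vs!2" "vs!1"] o(1-3) by simp_all
    then have "x = 0" "y = 0" "z = 0" using npos[OF l(1)] npos[OF l(2)] npos[OF l(3)] by auto
    then have "vs!3 = qzero" unfolding x by (simp add: lin3_def lin_def qzero_def)
    then show False using lin_indep_nth_nonzero[OF li l(4)] by blast
  qed
  moreover have "\<not> length vs < 3"
  proof
    assume "length vs < 3"
    then have "length vs = 0 \<or> length vs = 1 \<or> length vs = 2" by linarith
    \<comment> \<open>Padding with zero treats the lengths 0, 1 and 2 together.\<close>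
    then have "\<exists>p q. \<forall>c. \<exists>s t. lincomb c vs = lin3 p q qzero s t 0"
    proof (elim disjE)
      assume "length vs = 0"
      then have "lincomb c vs = lin3 qzero qzero qzero 0 0 0" for c
        by (simp add: lincomb_def lin3_def lin_def qzero_def)
      then show ?thesis by blast
    next
      assume "length vs = 1"
      then obtain p where vs: "vs = [p]" by (auto simp: length_Suc_conv)
      have "lincomb c vs = lin3 p qzero qzero (c 0) 0 0" for c
        by (simp add: vs lincomb_def lin3_def lin_def qzero_def)
      then show ?thesis by blast
    next
      assume "length vs = 2"
      then obtain p q where vs: "vs = [p, q]" by (auto simp: length_Suc_conv numeral_2_eq_2)
      have "lincomb c vs = lin3 p q qzero (c 0) (c 1) 0" for c
        by (simp add: vs lincomb_def lin3_def lin_def qzero_def lessThan_Suc add.commute)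
      then show ?thesis by blast
    qed
    then obtain p q where h: "\<And>c. \<exists>s t. lincomb c vs = lin3 p q qzero s t 0" by blast
    have pq: "\<exists>s t. x = lin3 p q qzero s t 0" if xL: "x \<in> L" for x
    proof -
      obtain c where "x = lincomb c vs" using xL unfolding sp zspan_iff by blast
      then show ?thesis using h by simp
    qed
    obtain u v w where uvw: "u \<in> L" "v \<in> L" "w \<in> L" "det3 u v w \<noteq> 0" using L_independent_triple by blast
    obtain s1 t1 where 1: "u = lin3 p q qzero s1 t1 0" using pq[OF uvw(1)] by blast
    obtain s2 t2 where 2: "v = lin3 p q qzero s2 t2 0" using pq[OF uvw(2)] by blast
    obtain s3 t3 where 3: "w = lin3 p q qzero s3 t3 0" using pq[OF uvw(3)] by blast
    have "det3 u v w = 0" unfolding 1 2 3 by (simp add: det3_def lin3_def lin_def qzero_def algebra_simps)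
    then show False using uvw(4) by blast
  qed
  ultimately show ?thesis by linarith
qed

lemma not_orthogonal:
  assumes p: "prime p" and Bp: "is_Bp p a b" and m: "maximal_order a b R"
  shows "\<not> orthogonal_lattice a b L"
proof
  assume "orthogonal_lattice a b L"
  then obtain vs where bs: "is_Zbasis L vs"
    and orth: "\<And>i j. i < length vs \<Longrightarrow> j < length vs \<Longrightarrow> i \<noteq> j \<Longrightarrow> qinner a b (vs ! i) (vs ! j) = 0"
    unfolding orthogonal_lattice_def by blast
  note ab = is_Bp_neg[OF Bp]
  have l3: "length vs = 3" using orthogonal_basis_length[OF ab(1,2) bs orth] .
  then obtain u v w where vs: "vs = [u, v, w]" by (auto simp: length_Suc_conv numeral_3_eq_3)
  have li: "lin_indep [u, v, w]" and sp: "L = zspan [u, v, w]" using bs vs unfolding is_Zbasis_def by blast+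
  have L: "u \<in> L" "v \<in> L" "w \<in> L"
    using nth_in_zspan[of 0 "[u,v,w]"] nth_in_zspan[of 1 "[u,v,w]"] nth_in_zspan[of 2 "[u,v,w]"] unfolding sp by simp_all
  note p0 = L_pure[OF L(1)] L_pure[OF L(2)] L_pure[OF L(3)]
  have d: "det3 u v w \<noteq> 0" using lin_indep_det3[OF ab(1,2) p0 li] .
  have nz: "u \<noteq> qzero" "v \<noteq> qzero"
    using lin_indep_nth_nonzero[OF li, of 0] lin_indep_nth_nonzero[OF li, of 1] by simp_all
  have o: "qinner a b u v = 0" "qinner a b u w = 0" "qinner a b v w = 0"
    using orth[of 0 1] orth[of 0 2] orth[of 1 2] by (simp_all add: vs)
  obtain N A B C U V W where F: "formN a b R N A B C U V W"
    and g: "qinner a b u u = of_int (4*B*C - U^2)" "qinner a b v v = of_int (4*A*C - V^2)"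
      "qinner a b w w = of_int (4*A*B - W^2)"
      "qinner a b u v = of_int (U*V - 2*C*W)" "qinner a b u w = of_int (U*W - 2*B*V)"
      "qinner a b v w = of_int (V*W - 2*A*U)"
    by (rule gross_form[OF ab(3,4) bs[unfolded vs] d])
  have z: "U*V - 2*C*W = 0" "U*W - 2*B*V = 0" "V*W - 2*A*U = 0"
    using o unfolding g by (simp_all only: of_int_eq_0_iff)
  have pos: "4*B*C - U^2 > 0" "4*A*C - V^2 > 0"
    using nrd_pos[OF ab(1,2) nz(1)] nrd_pos[OF ab(1,2) nz(2)] unfolding nrd_inner g by (simp_all only: of_int_0_less_iff)
  \<comment> \<open>These are off-diagonal entries of G adj(G). Since adj(G) is diagonal here, they
    reduce to W, V and U times positive norms.\<close>
  have "W * (4*B*C - U^2) + 2*B*(U*V - 2*C*W) + U*(U*W - 2*B*V) = 0"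
    "V * (4*B*C - U^2) + U*(U*V - 2*C*W) + 2*C*(U*W - 2*B*V) = 0"
    "U * (4*A*C - V^2) + V*(U*V - 2*C*W) + 2*C*(V*W - 2*A*U) = 0"
    by (simp_all add: algebra_simps power2_eq_square)
  then have "W = 0" "V = 0" "U = 0" using pos unfolding z by auto
  then have "N = 4*A*B*C" using F unfolding formN_def hdisc_def by simp
  then have "4 dvd int p" using maximal_order_disc[OF p Bp m F] by simp
  then have 4: "4 dvd p" by presburger
  then have "2 dvd p" by presburger
  then have "p = 2" using p primes_dvd_imp_eq two_is_prime_nat by blast
  then show False using 4 by simp
qed

end

section \<open>Well-rounded lattices\<close>

text \<open>In terms of \<open>\<alpha> = d - x\<close> etc. the difference of the two sides is a sum of products of nonnegative terms.\<close>
lemma wr_det_bound_pos: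
  fixes d x y z :: int
  assumes "0 \<le> x" "x \<le> d" "0 \<le> y" "y \<le> d" "0 \<le> z" "z \<le> d"
  shows "d * (x^2 + y^2 + z^2) \<le> 2*d^3 + x*y*z"
proof -
  define \<alpha> \<beta> \<gamma> where "\<alpha> = d - x" and "\<beta> = d - y" and "\<gamma> = d - z"
  have h: "\<alpha> \<ge> 0" "\<beta> \<ge> 0" "\<gamma> \<ge> 0" "\<gamma> \<le> d" "d \<ge> 0" using assms by (simp_all add: \<alpha>_def \<beta>_def \<gamma>_def)
  have "2*d^3 + x*y*z - d * (x^2 + y^2 + z^2) =
     d * (\<alpha>*x + \<beta>*y + \<gamma>*z) + d*(\<beta>*\<gamma> + \<alpha>*\<gamma>) + \<alpha>*\<beta>*(d - \<gamma>)"
    by (simp add: \<alpha>_def \<beta>_def \<gamma>_def algebra_simps power2_eq_square power3_eq_cube)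
  also have "\<dots> \<ge> 0" using h assms by (intro add_nonneg_nonneg mult_nonneg_nonneg) auto
  finally show ?thesis by simp
qed

text \<open>For x = y = z = d > 0 the bound fails; the condition on the sum excludes this. It
  expresses that a signed sum of the three vectors is not shorter than each of them.\<close>

lemma wr_det_bound_neg:
  fixes d x y z :: int
  assumes "0 \<le> x" "x \<le> d" "0 \<le> y" "y \<le> d" "0 \<le> z" "z \<le> d" and s: "x + y + z \<le> 2*d"
  shows "d * (x^2 + y^2 + z^2) \<le> 2*d^3 - x*y*z"
proof (cases "x + y + z \<ge> d")
  case True
  define \<alpha> \<beta> \<gamma> where "\<alpha> = d - x" and "\<beta> = d - y" and "\<gamma> = d - z"
  have h: "\<alpha> \<ge> 0" "\<beta> \<ge> 0" "\<gamma> \<ge> 0" "d \<ge> 0" using assms by (simp_all add: \<alpha>_def \<beta>_def \<gamma>_def)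
  have "2*d^3 - x*y*z - d * (x^2 + y^2 + z^2) =
     d * (2*d - (x+y+z)) * ((x+y+z) - d) + d*(\<alpha>*\<beta> + \<beta>*\<gamma> + \<alpha>*\<gamma>) + \<alpha>*\<beta>*\<gamma>"
    by (simp add: \<alpha>_def \<beta>_def \<gamma>_def algebra_simps power2_eq_square power3_eq_cube)
  also have "\<dots> \<ge> 0" using h s True by (intro add_nonneg_nonneg mult_nonneg_nonneg) auto
  finally show ?thesis by simp
next
  case False
  have d: "d \<ge> 0" using assms by simp
  \<comment> \<open>For x + y + z < d crude estimates suffice: both d (x^2 + y^2 + z^2) and x y z
    are at most d^3.\<close>
  have "x^2 + y^2 + z^2 \<le> (x+y+z)^2" using assms by (simp add: power2_eq_square algebra_simps)
  also have "\<dots> \<le> d^2" using False assms by (intro power_mono) auto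
  finally have 1: "d * (x^2 + y^2 + z^2) \<le> d * d^2" using d by (rule mult_left_mono)
  have "x*y*z \<le> d*d*d" using assms by (intro mult_mono) auto
  with 1 show ?thesis by (simp add: power2_eq_square power3_eq_cube)
qed

text \<open>Here x, y, z stand for doubled off-diagonal Gram entries. After passing to absolute
  values, only the parity of the number of negative entries matters: an even number leads to the
  first bound, an odd number to the second, with the matching condition from
  \<open>s\<close>.\<close>

lemma wr_det_bound:
  fixes d x y z :: int
  assumes b: "\<bar>x\<bar> \<le> d" "\<bar>y\<bar> \<le> d" "\<bar>z\<bar> \<le> d"
    and s: "2*d + x + y + z \<ge> 0" "2*d + x - y - z \<ge> 0" "2*d - x + y - z \<ge> 0" "2*d - x - y + z \<ge> 0"
  shows "d * (x^2 + y^2 + z^2) \<le> 2*d^3 + x*y*z"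
proof (cases "x \<ge> 0"; cases "y \<ge> 0"; cases "z \<ge> 0")
  assume "x \<ge> 0" "y \<ge> 0" "z \<ge> 0" then show ?thesis using wr_det_bound_pos[of x d y z] b by simp
next
  assume "x \<ge> 0" "y \<ge> 0" "\<not> z \<ge> 0" then show ?thesis using wr_det_bound_neg[of x d y "-z"] b s by simp
next
  assume "x \<ge> 0" "\<not> y \<ge> 0" "z \<ge> 0" then show ?thesis using wr_det_bound_neg[of x d "-y" z] b s by simp
next
  assume "x \<ge> 0" "\<not> y \<ge> 0" "\<not> z \<ge> 0" then show ?thesis using wr_det_bound_pos[of x d "-y" "-z"] b s by simp
next
  assume "\<not> x \<ge> 0" "y \<ge> 0" "z \<ge> 0" then show ?thesis using wr_det_bound_neg[of "-x" d y z] b s by simp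
next
  assume "\<not> x \<ge> 0" "y \<ge> 0" "\<not> z \<ge> 0" then show ?thesis using wr_det_bound_pos[of "-x" d y "-z"] b s by simp
next
  assume "\<not> x \<ge> 0" "\<not> y \<ge> 0" "z \<ge> 0" then show ?thesis using wr_det_bound_pos[of "-x" d "-y" z] b s by simp
next
  assume "\<not> x \<ge> 0" "\<not> y \<ge> 0" "\<not> z \<ge> 0" then show ?thesis using wr_det_bound_neg[of "-x" d "-y" "-z"] b s by simp
qed

text \<open>Both factors of d^2 - x^2 are even, and p divides one of them.\<close>

lemma wr_congruence:
  fixes p d x c :: int
  assumes p: "prime p" "p \<noteq> 2" and e: "d^2 - x^2 = 4*p*c" and nd: "\<not> p dvd d"
  shows "2*p dvd d - x \<or> 2*p dvd d + x"
proof -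
  have "p dvd (d - x) * (d + x)" using e by (simp add: algebra_simps power2_eq_square)
  then have "p dvd d - x \<or> p dvd d + x" using p(1) by (meson prime_dvd_mult_iff)
  moreover have ev: "even (d - x)" "even (d + x)"
  proof -
    have "even (d^2 - x^2)" unfolding e by simp
    then show "even (d - x)" "even (d + x)" by simp_all
  qed
  moreover have "coprime 2 p" using p primes_coprime[of 2 p] by auto
  ultimately show ?thesis using divides_mult by blast
qed

text \<open>If p divides d, then p divides x, y and z, and p^3 divides the determinant 4 p^2, which
  is impossible. Otherwise 2p divides d - x or d + x, and |2x| <= d gives 4p <= 3d. Together with
  d^3 <= 8 p^2 only p = 3, d = 4 survives, and the determinant rules it out.\<close>

lemma wr_arith:
  fixes p d x y z A B C :: int
  assumes p: "prime p" "p \<ge> 3" and d: "d > 0"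
    and e: "d^2 - x^2 = 4*p*C" "d^2 - y^2 = 4*p*B" "d^2 - z^2 = 4*p*A"
    and det: "d^3 + 2*x*y*z - d*(x^2 + y^2 + z^2) = 4*p^2"
    and b: "\<bar>2*x\<bar> \<le> d" "\<bar>2*y\<bar> \<le> d" "\<bar>2*z\<bar> \<le> d"
    and s: "d + x + y + z \<ge> 0" "d + x - y - z \<ge> 0" "d - x + y - z \<ge> 0" "d - x - y + z \<ge> 0"
  shows False
proof (cases "p dvd d")
  case True
  have x: "p dvd x" if "d^2 - x^2 = 4*p*c" for x c
  proof -
    have "x^2 = d^2 - p * (4*c)" using that by simp
    moreover have "p dvd d^2" using True by (simp add: power2_eq_square)
    ultimately have "p dvd x^2" by simp
    then show ?thesis using p(1) prime_dvd_power by blast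
  qed
  obtain d' x' y' z' where f: "d = p*d'" "x = p*x'" "y = p*y'" "z = p*z'"
    using True x[OF e(1)] x[OF e(2)] x[OF e(3)] by (elim dvdE)
  have "p^2 * (p * (d'^3 + 2*x'*y'*z' - d'*(x'^2 + y'^2 + z'^2))) = p^2 * 4"
    using det unfolding f by (simp add: algebra_simps power2_eq_square power3_eq_cube)
  then have "p * (d'^3 + 2*x'*y'*z' - d'*(x'^2 + y'^2 + z'^2)) = 4" using p(2) by simp
  then have "p dvd 2*2" by (metis dvd_triv_left mult_2 numeral_Bit0)
  then have "p dvd 2" using p(1) by (meson prime_dvd_mult_iff)
  then show False using p(2) zdvd_imp_le[of p 2] by simp
next
  case False
  have p2: "p \<noteq> 2" using p(2) by simp
  have "d * ((2*x)^2 + (2*y)^2 + (2*z)^2) \<le> 2*d^3 + (2*x)*(2*y)*(2*z)"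
    using b s by (intro wr_det_bound) auto
  then have "2*d^3 \<le> 4*(d^3 + 2*x*y*z - d*(x^2 + y^2 + z^2))"
    by (simp add: algebra_simps power2_eq_square power3_eq_cube)
  then have D: "d^3 \<le> 8*p^2" unfolding det by simp
  have "2*p dvd d - x \<or> 2*p dvd d + x" by (rule wr_congruence[OF p(1) p2 e(1) False])
  then have "2*p \<le> d - x \<or> 2*p \<le> d + x" using zdvd_imp_le b d by fastforce
  then have P: "4*p \<le> 3*d" using b(1) by linarith
  \<comment> \<open>64 p^3 <= 27 d^3 <= 216 p^2 leaves only p = 3.\<close>
  have "64 * p^3 = (4*p)^3" by (simp add: power_mult_distrib)
  also have "\<dots> \<le> (3*d)^3" using P p(2) by (intro power_mono) auto
  also have "\<dots> = 27 * d^3" by (simp add: power_mult_distrib)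
  also have "\<dots> \<le> 27 * (8 * p^2)" using D by simp
  finally have "p^2 * (64*p) \<le> p^2 * 216" by (simp add: power2_eq_square power3_eq_cube)
  then have "p = 3" using p(2) by (simp add: mult_le_cancel_left)
  then have d4: "d \<ge> 4" using P by simp
  have "d < 5"
  proof (rule ccontr)
    assume "\<not> d < 5"
    then have "(5::int)^3 \<le> d^3" by (intro power_mono) auto
    then show False using D \<open>p = 3\<close> by simp
  qed
  then have d: "d = 4" using d4 by simp
  have two: "t = 2 \<or> t = -2" if "d^2 - t^2 = 4*p*c" "\<bar>2*t\<bar> \<le> d" for t c
  proof -
    have "6 dvd 4 - t \<or> 6 dvd 4 + t"
      using wr_congruence[OF p(1) p2 that(1) False] unfolding d \<open>p = 3\<close> by simp
    then show ?thesis using that(2) unfolding d by presburger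
  qed
  have "x = 2 \<or> x = -2" "y = 2 \<or> y = -2" "z = 2 \<or> z = -2"
    using two[OF e(1) b(1)] two[OF e(2) b(2)] two[OF e(3) b(3)] .
  \<comment> \<open>The left side of \<open>det\<close> is 64 + 16 - 48 or 64 - 16 - 48, never
    36.\<close>
  then show False using det unfolding d \<open>p = 3\<close> by (elim disjE) simp_all
qed

text \<open>Rounding up with probability \<open>r - \<lfloor>r\<rfloor>\<close> increases the expected norm by at most a quarter of the norm of \<open>v\<close>.\<close>
lemma rounding:
  fixes a b :: int
  assumes ab: "a < 0" "b < 0"
  shows "\<exists>k::int. qnrd a b (qadd (qsmult (r - of_int k) v) y) \<le> qnrd a b y + qnrd a b v / 4"
proof (rule ccontr)
  assume n: "\<not> ?thesis"
  have n': "\<not> qnrd a b (qadd (qsmult (r - of_int k) v) y) \<le> qnrd a b y + qnrd a b v / 4" for k :: int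
    using n by blast
  define k where "k = \<lfloor>r\<rfloor>"
  define s where "s = r - of_int k"
  have s: "0 \<le> s" "s \<le> 1" unfolding s_def k_def by linarith+
  define q where "q = qinner a b v y"
  have e: "qnrd a b (qadd (qsmult t v) y) = t^2 * qnrd a b v + 2 * t * q + qnrd a b y" for t
    unfolding nrd_coords inner_coords q_def by (simp add: qadd_def qsmult_def algebra_simps power2_eq_square)
  have v: "qnrd a b v \<ge> 0"
  proof (cases "v = qzero")
    case True then show ?thesis by (simp add: nrd_coords qzero_def)
  next
    case False then show ?thesis using nrd_pos[OF ab False] by simp
  qed
  have 1: "s^2 * qnrd a b v + 2 * s * q > qnrd a b v / 4"
    using n'[of k] unfolding s_def[symmetric] e by linarith
  have sk: "r - of_int (k + 1) = s - 1" by (simp add: s_def)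
  have 2: "(s-1)^2 * qnrd a b v + 2 * (s-1) * q > qnrd a b v / 4"
    using n'[of "k+1"] unfolding sk e by linarith
  \<comment> \<open>With weights 1 - s and s for the two neighbouring integers, the terms linear in
    q cancel.\<close>
  have "(1 - s) * (s^2 * qnrd a b v + 2 * s * q) + s * ((s-1)^2 * qnrd a b v + 2 * (s-1) * q)
      = s * (1 - s) * qnrd a b v"
    by (simp add: algebra_simps power2_eq_square)
  moreover have "(1 - s) * (s^2 * qnrd a b v + 2 * s * q) + s * ((s-1)^2 * qnrd a b v + 2 * (s-1) * q)
      > (1 - s) * (qnrd a b v / 4) + s * (qnrd a b v / 4)"
  proof (cases "s = 1")
    case True then show ?thesis using 2 by simp
  next
    case False
    then have "(1 - s) * (s^2 * qnrd a b v + 2 * s * q) > (1 - s) * (qnrd a b v / 4)"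
      using 1 s by (intro mult_strict_left_mono) auto
    moreover have "s * ((s-1)^2 * qnrd a b v + 2 * (s-1) * q) \<ge> s * (qnrd a b v / 4)"
      using 2 s by (intro mult_left_mono) auto
    ultimately show ?thesis by linarith
  qed
  moreover have "s * (1 - s) * qnrd a b v \<le> (1/4) * qnrd a b v"
  proof (rule mult_right_mono[OF _ v])
    have "0 \<le> (s - 1/2)^2" by simp
    then show "s * (1 - s) \<le> 1/4" by (simp add: algebra_simps power2_eq_square)
  qed
  moreover have "(1 - s) * t + s * t = t" for t by (simp add: algebra_simps)
  then have "(1 - s) * (qnrd a b v / 4) + s * (qnrd a b v / 4) = qnrd a b v / 4" .
  ultimately show False by linarith
qed

context quat_order
begin

text \<open>Round the three coordinates of a lattice vector one after the other: the remainder has norm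
  at most three quarters of the minimum.\<close>
lemma minimal_vectors_basis:
  assumes ab: "a < 0" "b < 0" and L: "u \<in> L" "v \<in> L" "w \<in> L" and li: "lin_indep [u, v, w]"
    and eq: "qnrd a b u = d" "qnrd a b v = d" "qnrd a b w = d"
    and min: "\<And>x. x \<in> L \<Longrightarrow> x \<noteq> qzero \<Longrightarrow> d \<le> qnrd a b x"
  shows "is_Zbasis L [u, v, w]"
  unfolding is_Zbasis_def
proof (intro conjI li subset_antisym subsetI)
  fix x assume "x \<in> zspan [u, v, w]"
  then show "x \<in> L" unfolding zspan3 using lin3_in_L[OF L] by blast
next
  fix x assume x: "x \<in> L"
  note p = L_pure[OF L(1)] L_pure[OF L(2)] L_pure[OF L(3)]
  have det: "det3 u v w \<noteq> 0" by (rule lin_indep_det3[OF ab p li])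
  from cramer[OF p L_pure[OF x] det] obtain r s t where xr: "x = lin3 u v w r s t" by (rule that)
  have dpos: "d > 0" using nrd_pos[OF ab] lin_indep_nth_nonzero[OF li, of 0] eq(1) by force
  obtain i where i: "qnrd a b (qadd (qsmult (r - of_int i) u) qzero) \<le> qnrd a b qzero + d / 4"
    using rounding[OF ab, of r u qzero] unfolding eq by blast
  define y where "y = qadd (qsmult (r - of_int i) u) qzero"
  obtain j where j: "qnrd a b (qadd (qsmult (s - of_int j) v) y) \<le> qnrd a b y + d / 4"
    using rounding[OF ab, of s v y] unfolding eq by blast
  define z where "z = qadd (qsmult (s - of_int j) v) y"
  obtain k where k: "qnrd a b (qadd (qsmult (t - of_int k) w) z) \<le> qnrd a b z + d / 4"
    using rounding[OF ab, of t w z] unfolding eq by blast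
  let ?q = "qadd (qsmult (t - of_int k) w) z"
  have "qnrd a b qzero = 0" by (simp add: nrd_coords qzero_def)
  then have "qnrd a b ?q < d" using i j k dpos unfolding y_def[symmetric] z_def[symmetric] by linarith
  moreover have q: "?q = qsub x (lin3 u v w (of_int i) (of_int j) (of_int k))"
    unfolding xr z_def y_def
    by (simp add: lin3_def lin_def qsub_def qadd_def qsmult_def qzero_def algebra_simps)
  then have "?q \<in> L" using L_sub[OF x lin3_in_L[OF L]] by simp
  ultimately have "?q = qzero" using min[of ?q] by linarith
  then have "x = lin3 u v w (of_int i) (of_int j) (of_int k)"
    unfolding q by (cases x) (simp add: lin3_def lin_def qsub_def qadd_def qsmult_def qzero_def)
  then show "x \<in> zspan [u, v, w]" unfolding zspan3 by blast
qed

lemma not_well_rounded: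
  assumes p: "prime p" "p \<ge> 3" and Bp: "is_Bp p a b" and m: "maximal_order a b R"
  shows "\<not> well_rounded a b 3 L"
proof
  assume "well_rounded a b 3 L"
  then obtain vs where vs: "length vs = 3" "lin_indep vs" "set vs \<subseteq> L"
    and vmin: "\<And>v x. v \<in> set vs \<Longrightarrow> x \<in> L \<Longrightarrow> x \<noteq> qzero \<Longrightarrow> qnrd a b v \<le> qnrd a b x"
    unfolding well_rounded_def by blast
  note ab = is_Bp_neg[OF Bp]
  from vs(1) obtain u v w where vs3: "vs = [u, v, w]" by (auto simp: length_Suc_conv numeral_3_eq_3)
  note li = vs(2)[unfolded vs3]
  have L: "u \<in> L" "v \<in> L" "w \<in> L" and S: "u \<in> set vs" "v \<in> set vs" "w \<in> set vs"
    using vs(3) unfolding vs3 by simp_all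
  have nz: "u \<noteq> qzero" "v \<noteq> qzero" "w \<noteq> qzero"
    using lin_indep_nth_nonzero[OF li, of 0] lin_indep_nth_nonzero[OF li, of 1]
      lin_indep_nth_nonzero[OF li, of 2] by simp_all
  note p0 = L_pure[OF L(1)] L_pure[OF L(2)] L_pure[OF L(3)]
  have det: "det3 u v w \<noteq> 0" by (rule lin_indep_det3[OF ab(1,2) p0 li])
  have e: "qnrd a b v = qnrd a b u" "qnrd a b w = qnrd a b u"
    using vmin[OF S(1) L(2) nz(2)] vmin[OF S(2) L(1) nz(1)] vmin[OF S(1) L(3) nz(3)] vmin[OF S(3) L(1) nz(1)]
    by linarith+
  \<comment> \<open>The relation with the form requires a basis, while minimal vectors are a priori
    only independent.\<close>
  have bs: "is_Zbasis L [u, v, w]"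
    by (rule minimal_vectors_basis[OF ab(1,2) L li refl e]) (rule vmin[OF S(1)])
  obtain N A B C U V W where F: "formN a b R N A B C U V W"
    and g: "qinner a b u u = of_int (4*B*C - U^2)" "qinner a b v v = of_int (4*A*C - V^2)"
      "qinner a b w w = of_int (4*A*B - W^2)"
      "qinner a b u v = of_int (U*V - 2*C*W)" "qinner a b u w = of_int (U*W - 2*B*V)"
      "qinner a b v w = of_int (V*W - 2*A*U)"
    by (rule gross_form[OF ab(3,4) bs det])
  have N: "hdisc A B C U V W = int p" using maximal_order_disc[OF p(1) Bp m F] F unfolding formN_def by simp
  define d x y z where "d = 4*B*C - U^2" and "x = U*V - 2*C*W" and "y = U*W - 2*B*V" and "z = V*W - 2*A*U"
  have d: "4*A*C - V^2 = d" "4*A*B - W^2 = d"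
    using e unfolding nrd_inner g d_def[symmetric] by (simp_all only: of_int_eq_iff)
  note g' = g[unfolded d d_def[symmetric] x_def[symmetric] y_def[symmetric] z_def[symmetric]]
  have dpos: "d > 0" using nrd_pos[OF ab(1,2) nz(1)] unfolding nrd_inner g' of_int_0_less_iff .
  \<comment> \<open>The principal 2x2 minors of adj(G) are det G = 2N times the diagonal entries 2C,
    2B, 2A of G.\<close>
  have minor: "(4*A*C - V^2) * (4*B*C - U^2) - (U*V - 2*C*W)^2 = 4 * hdisc A B C U V W * C"
    "(4*A*B - W^2) * (4*B*C - U^2) - (U*W - 2*B*V)^2 = 4 * hdisc A B C U V W * B"
    "(4*A*B - W^2) * (4*A*C - V^2) - (V*W - 2*A*U)^2 = 4 * hdisc A B C U V W * A"
    by (simp_all add: hdisc_def algebra_simps power2_eq_square)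
  note minor' = minor[unfolded d d_def[symmetric] x_def[symmetric] y_def[symmetric] z_def[symmetric] N]
  have dt: "d*d*d + 2*x*y*z - d*z^2 - d*y^2 - d*x^2 = 4 * (int p)^2"
    using gram_det_adj[of B C U A V W] unfolding d d_def[symmetric] x_def[symmetric] y_def[symmetric] z_def[symmetric] N .
  have low: "d \<le> (i^2 + j^2 + k^2) * d + 2*i*j*x + 2*i*k*y + 2*j*k*z"
    if "i \<noteq> 0 \<or> j \<noteq> 0 \<or> k \<noteq> 0" for i j k :: int
  proof -
    let ?q = "lin3 u v w (of_int i) (of_int j) (of_int k)"
    have "?q \<noteq> qzero" using li[unfolded lin_indep3] that by force
    then have "qnrd a b u \<le> qnrd a b ?q" using vmin[OF S(1) lin3_in_L[OF L]] by blast
    also have "\<dots> = of_int ((i^2 + j^2 + k^2) * d + 2*i*j*x + 2*i*k*y + 2*j*k*z)"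
      unfolding nrd_lin3 g' by (simp add: algebra_simps)
    finally show ?thesis unfolding nrd_inner g' of_int_le_iff .
  qed
  show False
  proof (rule wr_arith[of "int p" d x C y B z A])
    show "prime (int p)" "int p \<ge> 3" using p by simp_all
    show "d^2 - x^2 = 4*int p*C" "d^2 - y^2 = 4*int p*B" "d^2 - z^2 = 4*int p*A"
      using minor' by (simp_all add: power2_eq_square)
    show "d^3 + 2*x*y*z - d*(x^2 + y^2 + z^2) = 4*(int p)^2"
      using dt by (simp add: power3_eq_cube algebra_simps)
    show "\<bar>2*x\<bar> \<le> d" using low[of 1 1 0] low[of 1 "-1" 0] by simp
    show "\<bar>2*y\<bar> \<le> d" using low[of 1 0 1] low[of 1 0 "-1"] by simp
    show "\<bar>2*z\<bar> \<le> d" using low[of 0 1 1] low[of 0 1 "-1"] by simp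
    show "d + x + y + z \<ge> 0" using low[of 1 1 1] by simp
    show "d + x - y - z \<ge> 0" using low[of 1 1 "-1"] by simp
    show "d - x + y - z \<ge> 0" using low[of 1 "-1" 1] by simp
    show "d - x - y + z \<ge> 0" using low[of "-1" 1 1] by simp
  qed (fact dpos)
qed

end

section \<open>The case \<open>p = 2\<close>\<close>

lemma inner_pure: "c0 x = 0 \<Longrightarrow> c0 y = 0 \<Longrightarrow> qinner a b x y = - c0 (qmul a b x y)"
  by (simp add: inner_coords qmul_def Let_def)

lemma int_square_mod4: fixes t :: int shows "t^2 mod 4 = 0 \<or> t^2 mod 4 = 1"
proof (cases "even t")
  case True then obtain k where "t = 2*k" by (elim evenE)
  then have "t^2 = 4 * k^2" by (simp add: power2_eq_square)
  then show ?thesis by simp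
next
  case False then obtain k where "t = 2*k+1" by (elim oddE)
  then have "t^2 = 4 * (k^2 + k) + 1" by (simp add: power2_eq_square algebra_simps)
  then show ?thesis by presburger
qed

context quat_order
begin

text \<open>Norms in L are 0 or 3 modulo 4.\<close>

lemma L_norm_ge_3:
  assumes ab: "a < 0" "b < 0" and x: "x \<in> L" "x \<noteq> qzero"
  shows "3 \<le> qnrd a b x"
proof -
  obtain n t :: int where n: "qnrd a b x = of_int (4*n - t^2)" by (rule L_norm_mod4[OF x(1)])
  have "4*n - t^2 > 0" using nrd_pos[OF ab x(2)] unfolding n of_int_0_less_iff .
  then have "4*n - t^2 \<ge> 3" using int_square_mod4[of t] by presburger
  then have "rat_of_int 3 \<le> of_int (4*n - t^2)" unfolding of_int_le_iff .
  then show ?thesis unfolding n by simp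
qed

lemma basis_p2:
  assumes Bp: "is_Bp 2 a b" and m: "maximal_order a b R"
  obtains u v w where "is_Zbasis L [u, v, w]" "u \<in> L" "v \<in> L" "w \<in> L"
    "qinner a b u u = 3" "qinner a b v v = 3" "qinner a b w w = 3"
    "qinner a b u v = 1" "qinner a b u w = 1" "qinner a b v w = - 1"
proof -
  note ab = is_Bp_neg[OF Bp]
  obtain u0 v0 w0 where uvw: "u0 \<in> L" "v0 \<in> L" "w0 \<in> L" "det3 u0 v0 w0 \<noteq> 0" "L = zspan [u0, v0, w0]"
    by (rule gross_basis[OF ab(3,4)])
  have bs: "is_Zbasis L [u0, v0, w0]"
    unfolding is_Zbasis_def using det3_indep[OF L_pure[OF uvw(1)] L_pure[OF uvw(2)] L_pure[OF uvw(3)] uvw(4)] uvw(5) by blast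
  obtain N A B C U V W where F0: "formN a b R N A B C U V W"
    by (rule gross_form[OF ab(3,4) bs uvw(4)])
  have "N = 2" using maximal_order_disc[OF two_is_prime_nat Bp m F0] by simp
  from small_disc(2)[OF ab(1,2) F0 this] obtain e1 e2 e3 where e: "R = zspan [qone, e1, e2, e3]"
    and t: "ftab a b e1 e2 e3 1 1 1 (-1) (-1) 0"
    unfolding formN_def has_form_def by auto
  \<comment> \<open>u and v are 2 e - trd e for e = e1, e2. The third generator 2 e3 has norm 4; w =
    u - 2 e3 has norm 3 and replaces it.\<close>
  define u v w where "u = lin e1 e2 e3 1 2 0 0" and "v = lin e1 e2 e3 1 0 2 0" and "w = lin e1 e2 e3 1 2 0 (-2)"
  note d = u_def v_def w_def
  have p: "c0 u = 0" "c0 v = 0" "c0 w = 0" unfolding d c0_lin[OF t] by simp_all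
  have g: "qinner a b u u = 3" "qinner a b v v = 3" "qinner a b w w = 3"
    "qinner a b u v = 1" "qinner a b u w = 1" "qinner a b v w = - 1"
    unfolding inner_pure[OF p(1) p(1)] inner_pure[OF p(2) p(2)] inner_pure[OF p(3) p(3)]
      inner_pure[OF p(1) p(2)] inner_pure[OF p(1) p(3)] inner_pure[OF p(2) p(3)]
    unfolding d lin_mul[OF t] c0_lin[OF t] by simp_all
  have "(of_int a * of_int b * det3 u v w)^2 \<noteq> 0" unfolding gram_det[OF p] g by simp
  then have "det3 u v w \<noteq> 0" by auto
  then have li: "lin_indep [u, v, w]" by (rule det3_indep[OF p])
  have L: "u \<in> L" "v \<in> L" "w \<in> L"
  proof -
    have h: "x \<in> L" if "y \<in> R" "x = imq y" for x y unfolding gross_eq using that by blast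
    have eR: "{e1, e2, e3} \<subseteq> R" unfolding e by (rule e_in_zspan4)
    have c: "c0 e1 = -1/2" "c0 e2 = -1/2" "c0 e3 = 0" using t by (simp_all add: ftab_def)
    show "u \<in> L" using eR c by (intro h[of e1]) (auto simp: d lin_def imq_def)
    show "v \<in> L" using eR c by (intro h[of e2]) (auto simp: d lin_def imq_def)
    have "qsub e1 e3 \<in> R" using R_sub eR by blast
    then show "w \<in> L" using c by (intro h[of "qsub e1 e3"]) (auto simp: d lin_def imq_def qsub_def qadd_def qsmult_def)
  qed
  have "L \<subseteq> zspan [u, v, w]"
  proof
    fix x assume "x \<in> L"
    then obtain y where y: "y \<in> R" "x = imq y" unfolding gross_eq by blast
    then obtain n0 n1 n2 n3 :: int where x: "x = imq (lin e1 e2 e3 (of_int n0) (of_int n1) (of_int n2) (of_int n3))"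
      unfolding e zspan4 by blast
    have c: "c0 e1 = -1/2" "c0 e2 = -1/2" "c0 e3 = 0" using t by (simp_all add: ftab_def)
    \<comment> \<open>The coefficients come from 2 e3 = u - w.\<close>
    have "x = lin3 u v w (of_int (n1 + n3)) (of_int n2) (of_int (- n3))"
      unfolding x d lin3_lin by (simp add: lin_def imq_def c algebra_simps)
    then show "x \<in> zspan [u, v, w]" unfolding zspan3 by blast
  qed
  moreover have "zspan [u, v, w] \<subseteq> L" unfolding zspan3 using lin3_in_L[OF L] by blast
  ultimately have "is_Zbasis L [u, v, w]" unfolding is_Zbasis_def using li by blast
  then show ?thesis using that[of u v w] L g by blast
qed

lemma lin_indep_prefix:
  assumes "lin_indep [u, v, w]" shows "lin_indep [u]" "lin_indep [u, v]"
proof -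
  have z: "lin3 u v w x y 0 = qzero \<Longrightarrow> x = 0 \<and> y = 0" for x y using assms unfolding lin_indep3 by blast
  have "lincomb c [u] = lin3 u v w (c 0) 0 0" for c by (simp add: lincomb_def lin3_def lin_def)
  then show "lin_indep [u]" unfolding lin_indep_def using z[of _ 0] by simp
  have "lincomb c [u, v] = lin3 u v w (c 0) (c 1) 0" for c
    by (simp add: lincomb_def lin3_def lin_def lessThan_Suc add.commute)
  then show "lin_indep [u, v]" unfolding lin_indep_def using z by (auto simp: less_Suc_eq)
qed

lemma succ_min_p2:
  assumes ab: "a < 0" "b < 0" and bs: "is_Zbasis L [u, v, w]" and L: "u \<in> L" "v \<in> L" "w \<in> L"
    and g: "qinner a b u u = 3" "qinner a b v v = 3" "qinner a b w w = 3" and i: "i < 3"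
  shows "succ_min a b L (Suc i) = 3"
  unfolding succ_min_def
proof (rule Least_equality)
  have li: "lin_indep [u, v, w]" using bs unfolding is_Zbasis_def by blast
  have S: "{u, v, w} \<subseteq> {x \<in> L. qnrd a b x \<le> 3}" using L g by (simp add: nrd_inner)
  have "i = 0 \<or> i = 1 \<or> i = 2" using i by linarith
  then show "\<exists>vs. length vs = Suc i \<and> lin_indep vs \<and> set vs \<subseteq> {x \<in> L. qnrd a b x \<le> 3}"
  proof (elim disjE)
    assume "i = 0" then show ?thesis using lin_indep_prefix(1)[OF li] S by (intro exI[of _ "[u]"]) auto
  next
    assume "i = 1" then show ?thesis using lin_indep_prefix(2)[OF li] S by (intro exI[of _ "[u, v]"]) auto
  next
    assume "i = 2" then show ?thesis using li S by (intro exI[of _ "[u, v, w]"]) auto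
  qed
next
  fix y assume "\<exists>vs. length vs = Suc i \<and> lin_indep vs \<and> set vs \<subseteq> {x \<in> L. qnrd a b x \<le> y}"
  then obtain vs where vs: "length vs = Suc i" "lin_indep vs" "set vs \<subseteq> {x \<in> L. qnrd a b x \<le> y}" by blast
  \<comment> \<open>One nonzero member of the list already gives the lower bound for every
    index.\<close>
  have "vs ! 0 \<noteq> qzero" using lin_indep_nth_nonzero[OF vs(2), of 0] vs(1) by simp
  moreover have "vs ! 0 \<in> set vs" using vs(1) by simp
  then have "vs ! 0 \<in> {x \<in> L. qnrd a b x \<le> y}" using vs(3) by blast
  ultimately show "3 \<le> y" using L_norm_ge_3[OF ab, of "vs ! 0"] by simp
qed

text \<open>16 = 4 * 2^2 is the determinant of the Gross lattice for p = 2. Among the few matrices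
  with diagonal 3 and entries in these ranges only one has it.\<close>

lemma gram_arith:
  fixes x y z :: int
  assumes "27 + 2*x*y*z - 3*z^2 - 3*y^2 - 3*x^2 = 16" "0 \<le> x" "x \<le> 1" "0 \<le> y" "y \<le> 1" "-1 \<le> z" "z \<le> 1"
  shows "x = 1 \<and> y = 1 \<and> z = -1"
proof -
  have "x = 0 \<or> x = 1" "y = 0 \<or> y = 1" "z = -1 \<or> z = 0 \<or> z = 1" using assms by linarith+
  then show ?thesis using assms(1) by (elim disjE) simp_all
qed

text \<open>All successive minima are 3. Applied to sums and differences of basis vectors, the
  minimum bounds the off-diagonal entries by 1 in absolute value. Normalization fixes two signs, and
  the determinant decides the rest.\<close>

lemma gram_p2:
  assumes Bp: "is_Bp 2 a b" and m: "maximal_order a b R"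
    and sm: "succ_min_basis a b L vs" and nm: "normalized a b vs"
  shows "gram a b vs = [[3, 1, 1], [1, 3, -1], [1, -1, 3]]"
proof -
  note ab = is_Bp_neg[OF Bp]
  obtain u0 v0 w0 where b0: "is_Zbasis L [u0, v0, w0]" "u0 \<in> L" "v0 \<in> L" "w0 \<in> L"
    "qinner a b u0 u0 = 3" "qinner a b v0 v0 = 3" "qinner a b w0 w0 = 3"
    by (rule basis_p2[OF Bp m])
  note s3 = succ_min_p2[OF ab(1,2) b0]
  from sm have "length vs = 3" unfolding succ_min_basis_def by blast
  then obtain u v w where vs: "vs = [u, v, w]" by (auto simp: length_Suc_conv numeral_3_eq_3)
  have bs: "is_Zbasis L [u, v, w]" using sm unfolding succ_min_basis_def vs by blast
  have q: "\<forall>i<3. qnrd a b ([u, v, w] ! i) = 3" using sm s3 unfolding succ_min_basis_def vs by simp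
  have n: "qinner a b u u = 3" "qinner a b v v = 3" "qinner a b w w = 3"
    using q[rule_format, of 0] q[rule_format, of 1] q[rule_format, of 2] unfolding nrd_inner by simp_all
  have li: "lin_indep [u, v, w]" and sp: "L = zspan [u, v, w]" using bs unfolding is_Zbasis_def by blast+
  have L: "u \<in> L" "v \<in> L" "w \<in> L"
    using nth_in_zspan[of 0 "[u,v,w]"] nth_in_zspan[of 1 "[u,v,w]"] nth_in_zspan[of 2 "[u,v,w]"] unfolding sp by simp_all
  note p0 = L_pure[OF L(1)] L_pure[OF L(2)] L_pure[OF L(3)]
  have det: "det3 u v w \<noteq> 0" by (rule lin_indep_det3[OF ab(1,2) p0 li])
  obtain N A B C U V W where F: "formN a b R N A B C U V W"
    and g: "qinner a b u u = of_int (4*B*C - U^2)" "qinner a b v v = of_int (4*A*C - V^2)"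
      "qinner a b w w = of_int (4*A*B - W^2)"
      "qinner a b u v = of_int (U*V - 2*C*W)" "qinner a b u w = of_int (U*W - 2*B*V)"
      "qinner a b v w = of_int (V*W - 2*A*U)"
    by (rule gross_form[OF ab(3,4) bs det])
  have N: "hdisc A B C U V W = 2"
    using maximal_order_disc[OF two_is_prime_nat Bp m F] F unfolding formN_def by simp
  define x y z where "x = U*V - 2*C*W" and "y = U*W - 2*B*V" and "z = V*W - 2*A*U"
  have "rat_of_int (4*B*C - U^2) = of_int 3" "rat_of_int (4*A*C - V^2) = of_int 3" "rat_of_int (4*A*B - W^2) = of_int 3"
    using n unfolding g by simp_all
  then have d: "4*B*C - U^2 = 3" "4*A*C - V^2 = 3" "4*A*B - W^2 = 3" unfolding of_int_eq_iff .
  note g' = g[unfolded d x_def[symmetric] y_def[symmetric] z_def[symmetric]]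
  have dt: "27 + 2*x*y*z - 3*z^2 - 3*y^2 - 3*x^2 = 16"
    using gram_det_adj[of B C U A V W] unfolding d x_def[symmetric] y_def[symmetric] z_def[symmetric] N by simp
  have low: "3 \<le> (i^2 + j^2 + k^2) * 3 + 2*i*j*x + 2*i*k*y + 2*j*k*z"
    if nz: "i \<noteq> 0 \<or> j \<noteq> 0 \<or> k \<noteq> 0" for i j k :: int
  proof -
    let ?q = "lin3 u v w (of_int i) (of_int j) (of_int k)"
    have "?q \<noteq> qzero" using li[unfolded lin_indep3] nz by force
    then have "3 \<le> qnrd a b ?q" using L_norm_ge_3[OF ab(1,2) lin3_in_L[OF L]] by blast
    also have "\<dots> = of_int ((i^2 + j^2 + k^2) * 3 + 2*i*j*x + 2*i*k*y + 2*j*k*z)"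
      unfolding nrd_lin3 g' by (simp add: algebra_simps)
    finally have "rat_of_int 3 \<le> of_int ((i^2 + j^2 + k^2) * 3 + 2*i*j*x + 2*i*k*y + 2*j*k*z)" by simp
    then show ?thesis unfolding of_int_le_iff .
  qed
  have "rat_of_int x \<ge> 0" "rat_of_int y \<ge> 0"
    using nm unfolding normalized_def vs by (simp_all add: g')
  then have "x \<ge> 0" "y \<ge> 0" by simp_all
  moreover have "x \<le> 1" using low[of 1 "-1" 0] by simp
  moreover have "y \<le> 1" using low[of 1 0 "-1"] by simp
  moreover have "z \<le> 1" "-1 \<le> z" using low[of 0 1 "-1"] low[of 0 1 1] by simp_all
  ultimately have "x = 1 \<and> y = 1 \<and> z = -1" using gram_arith[OF dt] by blast
  then have "qinner a b u v = 1" "qinner a b u w = 1" "qinner a b v w = -1" using g' by simp_all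
  then show ?thesis unfolding gram_def vs
    using n inner_commute[of a b v u] inner_commute[of a b w u] inner_commute[of a b w v] by simp
qed

text \<open>The second claim shows that the description of the Gram matrix is not vacuous.\<close>

lemma well_rounded_p2:
  assumes Bp: "is_Bp 2 a b" and m: "maximal_order a b R"
  shows "well_rounded a b 3 L" "\<exists>vs. succ_min_basis a b L vs \<and> normalized a b vs"
proof -
  note ab = is_Bp_neg[OF Bp]
  obtain u v w where b0: "is_Zbasis L [u, v, w]" "u \<in> L" "v \<in> L" "w \<in> L"
    "qinner a b u u = 3" "qinner a b v v = 3" "qinner a b w w = 3"
    and o: "qinner a b u v = 1" "qinner a b u w = 1"
    by (rule basis_p2[OF Bp m])
  note s3 = succ_min_p2[OF ab(1,2) b0]
  have li: "lin_indep [u, v, w]" using b0(1) unfolding is_Zbasis_def by blast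
  have n3: "qnrd a b x = 3" if "x \<in> set [u, v, w]" for x using that b0(5-7) by (auto simp: nrd_inner)
  have "\<forall>x\<in>set [u, v, w]. \<forall>y\<in>L. y \<noteq> qzero \<longrightarrow> qnrd a b x \<le> qnrd a b y"
    using n3 L_norm_ge_3[OF ab(1,2)] by metis
  moreover have "set [u, v, w] \<subseteq> L" using b0 by simp
  ultimately show "well_rounded a b 3 L"
    unfolding well_rounded_def using li by (intro exI[of _ "[u, v, w]"]) simp
  have "\<forall>i<3. qnrd a b ([u, v, w] ! i) = succ_min a b L (Suc i)"
  proof (intro allI impI)
    fix i :: nat assume i: "i < 3"
    then have "[u, v, w] ! i \<in> set [u, v, w]" by (intro nth_mem) simp
    then show "qnrd a b ([u, v, w] ! i) = succ_min a b L (Suc i)" using n3 s3[OF i] by metis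
  qed
  then have "succ_min_basis a b L [u, v, w]" unfolding succ_min_basis_def using b0(1) by simp
  moreover have "normalized a b [u, v, w]" unfolding normalized_def using o by simp
  ultimately show "\<exists>vs. succ_min_basis a b L vs \<and> normalized a b vs" by blast
qed

end

theorem mainTheorem13:
  fixes p :: nat
  assumes "prime p"
  shows "(p = 2 \<longrightarrow> (\<forall>a b R. is_Bp p a b \<and> maximal_order a b R \<longrightarrow>
            well_rounded a b 3 (gross a b R) \<and> \<not> orthogonal_lattice a b (gross a b R) \<and>
            (\<exists>vs. succ_min_basis a b (gross a b R) vs \<and> normalized a b vs) \<and>
            (\<forall>vs. succ_min_basis a b (gross a b R) vs \<and> normalized a b vs \<longrightarrow>
                gram a b vs = [[3, 1, 1], [1, 3, -1], [1, -1, 3]])))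
       \<and> (p \<ge> 3 \<longrightarrow> (\<forall>a b R. is_Bp p a b \<and> maximal_order a b R \<longrightarrow>
            \<not> orthogonal_lattice a b (gross a b R) \<and> \<not> well_rounded a b 3 (gross a b R)))"
proof -
  have q: "quat_order a b R" if "maximal_order a b R" for a b R
    using that unfolding maximal_order_def quat_order_def by blast
  show ?thesis
  proof (intro conjI impI allI; elim conjE)
    fix a b R assume p2: "p = 2" and Bp: "is_Bp p a b" and m: "maximal_order a b R"
    interpret quat_order a b R by (rule q[OF m])
    show "well_rounded a b 3 (gross a b R)" "\<exists>vs. succ_min_basis a b (gross a b R) vs \<and> normalized a b vs"
      using well_rounded_p2[OF Bp[unfolded p2] m] .
    show "\<not> orthogonal_lattice a b (gross a b R)" by (rule not_orthogonal[OF assms Bp m])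
    show "gram a b vs = [[3, 1, 1], [1, 3, -1], [1, -1, 3]]"
      if "succ_min_basis a b (gross a b R) vs" "normalized a b vs" for vs
      using gram_p2[OF Bp[unfolded p2] m that] .
  next
    fix a b R assume p3: "p \<ge> 3" and Bp: "is_Bp p a b" and m: "maximal_order a b R"
    interpret quat_order a b R by (rule q[OF m])
    show "\<not> orthogonal_lattice a b (gross a b R)" by (rule not_orthogonal[OF assms Bp m])
    show "\<not> well_rounded a b 3 (gross a b R)" by (rule not_well_rounded[OF assms p3 Bp m])
  qed
qed

end
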